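(* Let $\mathcal{A}$ be a $\operatorname{Hom}$-finite idempotent complete $\mathbb{F}_q$-linear additively finite category and let $\mathcal{E}'<\mathcal{E}$ be a pair of exact structures on $\mathcal{A}$. Then $$\mathcal{D}^{\mathcal{E},\mathcal{E}'}=\{\varphi\in (K_0(\mathcal{E}^{\mathrm{add}})\otimes_{\mathbb{Z}}\mathbb{R})^*\mid \varphi(x)>0\text{ for all } 0\neq x\in\mathcal{C}^{\mathcal{E},\mathcal{E}'};\ \varphi(y)=0\text{ for all } y\in\mathcal{C}^{\mathcal{E}',\mathcal{E}^{\mathrm{add}}}\},$$ where functions on the set $\operatorname{ind}(\mathcal{A})$ are identified with linear functionals on $K_0(\mathcal{E}^{\mathrm{add}})\otimes_{\mathbb{Z}}\mathbb{R}$ via the basis $\operatorname{ind}(\mathcal{A})$ of $K_0(\mathcal{E}^{\mathrm{add}})$.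
   Context: All categories are essentially small. An additive category is additively finite if it has finitely many indecomposable objects up to isomorphism; $\operatorname{ind}(\mathcal{A})$ is the set of isomorphism classes of indecomposables and $\operatorname{Iso}(\mathcal{A})$ the set of isomorphism classes of objects. An exact structure on $\mathcal{A}$ is a Quillen exact structure, i.e. a class of kernel-cokernel pairs, called conflations, closed under isomorphism and satisfying Quillen's axioms; $\mathcal{E}'<\mathcal{E}$ means strict inclusion of the classes of conflations, $\mathcal{E}\setminus\mathcal{E}'$ denotes the class of conflations in $\mathcal{E}$ that are not conflations in $\mathcal{E}'$, and $\mathcal{E}^{\mathrm{add}}$ is the split exact structure. Under the stated hypotheses on $\mathcal{A}$ every exact structure on $\mathcal{A}$ is $\operatorname{Ext}^1$-finite. $K_0(\mathcal{E})$ is the free abelian group on $\operatorname{Iso}(\mathcal{A})$ modulo $[B]=[A]+[C]$ for all conflations $A\rightarrowtail B\twoheadrightarrow C$ in $\mathcal{E}$; $K_0(\mathcal{E}^{\mathrm{add}})=K_0^{\mathrm{add}}(\mathcal{A})$ is free on $\operatorname{ind}(\mathcal{A})$. For $\mathcal{E}'\le\mathcal{E}$, let $\Lambda^{\mathcal{E},\mathcal{E}'}$ be the kernel of the canonical surjection $K_0(\mathcal{E}')\twoheadrightarrow K_0(\mathcal{E})$, and let $\mathcal{C}^{\mathcal{E},\mathcal{E}'}\subseteq\Lambda^{\mathcal{E},\mathcal{E}'}\otimes_{\mathbb{Z}}\mathbb{R}$ be the polyhedral cone generated by the elements $[X]-[Y]+[Z]$ for $X\rightarrowtail Y\twoheadrightarrow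 Z$ a conflation in $\mathcal{E}\setminus\mathcal{E}'$. A functional $\varphi$ vanishing on $\mathcal{C}^{\mathcal{E}',\mathcal{E}^{\mathrm{add}}}$ descends to $K_0(\mathcal{E}')\otimes_{\mathbb{Z}}\mathbb{R}$, and $\varphi(x)$ for $x\in\mathcal{C}^{\mathcal{E},\mathcal{E}'}$ is understood in this sense. Hall algebra: $\mathcal{H}(\mathcal{E})$ is the $\mathbb{Q}$-vector space with basis $\{[A]\mid A\in\operatorname{Iso}(\mathcal{A})\}$ and multiplication $[A]\diamond[C]=\sum_{B}\frac{|\operatorname{Ext}^1_{\mathcal{E}}(A,C)_B|}{|\operatorname{Hom}(A,C)|}[B]$, where $\operatorname{Ext}^1_{\mathcal{E}}(A,C)_B$ is the set of classes of conflations $C\rightarrowtail B'\twoheadrightarrow A$ in $\mathcal{E}$ with $B'\cong B$; it is associative with unit $[0]$. Degree cone: a function $\mathbf{d}:\operatorname{ind}(\mathcal{A})\to\mathbb{R}$ gives a filtered vector space structure on $\mathcal{H}(\mathcal{E})$ by assigning to $[M]$ degree $\mathbf{d}(M)$ for $M$ indecomposable, extended additively on direct sums, i.e. the $t$-th filtered piece ($t\in\mathbb{R}$) is the span of the $[M]$ with $\mathbf{d}(M)\le t$. Then $$\mathcal{D}^{\mathcal{E},\mathcal{E}'}:=\{\mathbf{d}\in\mathbb{R}^{\operatorname{ind}(\mathcal{A})}\mid\mathbf{d}\text{ induces an algebra filtration on }\mathcal{H}(\mathcal{E})\text{ and }\operatorname{gr}_{\mathbf{d}}(\mathcal{H}(\mathcal{E}))=\mathcal{H}(\mathcal{E}')\},$$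 where $\operatorname{gr}_{\mathbf{d}}$ is the associated graded algebra, and the equality is via the identification of the class of $[M]$ in degree $\mathbf{d}(M)$ with the basis element $[M]$ of $\mathcal{H}(\mathcal{E}')$. *)

theory Defs
  imports Complex_Main "HOL-Algebra.Free_Abelian_Groups" "HOL-Algebra.Module" "HOL-Algebra.QuotRing"
begin

section \<open>Linear categories\<close>

text \<open>
  Categories are small: objects and arrows form sets.  Every arrow has one source and one target, and
  \<open>comp_arr C g f\<close> is the composite of \<open>f\<close> followed by \<open>g\<close>.  The fields are only meaningful on
  composable (respectively parallel) arrows.
\<close>

record ('o, 'm, 'k) lincat =
  obj :: "'o set"
  arr :: "'m set"
  src :: "'m \<Rightarrow> 'o"
  tgt :: "'m \<Rightarrow> 'o"
  id_arr :: "'o \<Rightarrow> 'm"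
  comp_arr :: "'m \<Rightarrow> 'm \<Rightarrow> 'm"
  zero_arr :: "'o \<Rightarrow> 'o \<Rightarrow> 'm"
  add_arr :: "'m \<Rightarrow> 'm \<Rightarrow> 'm"
  scale_arr :: "'k \<Rightarrow> 'm \<Rightarrow> 'm"

definition Hom :: "('o, 'm, 'k) lincat \<Rightarrow> 'o \<Rightarrow> 'o \<Rightarrow> 'm set" where
  "Hom C A B = {f \<in> arr C. src C f = A \<and> tgt C f = B}"

text \<open>The record type requires a multiplication and a unit, but the locale \<open>module\<close> does not use them.\<close>

definition hom_module :: "('o, 'm, 'k) lincat \<Rightarrow> 'o \<Rightarrow> 'o \<Rightarrow> ('k, 'm) module" where
  "hom_module C A B =
    \<lparr>carrier = Hom C A B, monoid.mult = undefined, one = undefined,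
     zero = zero_arr C A B, add = add_arr C, smult = scale_arr C\<rparr>"

locale linear_category =
  fixes K :: "('k, 'x) ring_scheme" and C :: "('o, 'm, 'k) lincat"
  assumes field: "field K"
    and src_in_obj: "f \<in> arr C \<Longrightarrow> src C f \<in> obj C"
    and tgt_in_obj: "f \<in> arr C \<Longrightarrow> tgt C f \<in> obj C"
    and id_in_Hom: "A \<in> obj C \<Longrightarrow> id_arr C A \<in> Hom C A A"
    and comp_in_Hom: "f \<in> Hom C A B \<Longrightarrow> g \<in> Hom C B D \<Longrightarrow> comp_arr C g f \<in> Hom C A D"
    and comp_assoc: "f \<in> Hom C A B \<Longrightarrow> g \<in> Hom C B D \<Longrightarrow> h \<in> Hom C D F \<Longrightarrow>
      comp_arr C h (comp_arr C g f) = comp_arr C (comp_arr C h g) f"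
    and comp_id_right: "f \<in> Hom C A B \<Longrightarrow> comp_arr C f (id_arr C A) = f"
    and comp_id_left: "f \<in> Hom C A B \<Longrightarrow> comp_arr C (id_arr C B) f = f"
    and hom_module: "A \<in> obj C \<Longrightarrow> B \<in> obj C \<Longrightarrow> module K (hom_module C A B)"
    and comp_add_right: "f \<in> Hom C A B \<Longrightarrow> f' \<in> Hom C A B \<Longrightarrow> g \<in> Hom C B D \<Longrightarrow>
      comp_arr C g (add_arr C f f') = add_arr C (comp_arr C g f) (comp_arr C g f')"
    and comp_add_left: "f \<in> Hom C A B \<Longrightarrow> g \<in> Hom C B D \<Longrightarrow> g' \<in> Hom C B D \<Longrightarrow>
      comp_arr C (add_arr C g g') f = add_arr C (comp_arr C g f) (comp_arr C g' f)"
    and comp_scale_right: "c \<in> carrier K \<Longrightarrow> f \<in> Hom C A B \<Longrightarrow> g \<in> Hom C B D \<Longrightarrow>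
      comp_arr C g (scale_arr C c f) = scale_arr C c (comp_arr C g f)"
    and comp_scale_left: "c \<in> carrier K \<Longrightarrow> f \<in> Hom C A B \<Longrightarrow> g \<in> Hom C B D \<Longrightarrow>
      comp_arr C (scale_arr C c g) f = scale_arr C c (comp_arr C g f)"

definition hom_finite :: "('k, 'x) ring_scheme \<Rightarrow> ('o, 'm, 'k) lincat \<Rightarrow> bool" where
  "hom_finite K C \<longleftrightarrow> (\<forall>A\<in>obj C. \<forall>B\<in>obj C. \<exists>S. finite S \<and> S \<subseteq> Hom C A B \<and>
    (\<forall>N. submodule N K (hom_module C A B) \<and> S \<subseteq> N \<longrightarrow> N = Hom C A B))"

definition idempotent_complete :: "('o, 'm, 'k) lincat \<Rightarrow> bool" where
  "idempotent_complete C \<longleftrightarrow> (\<forall>A\<in>obj C. \<forall>e\<in>Hom C A A. comp_arr C e e = e \<longrightarrow>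
    (\<exists>B\<in>obj C. \<exists>r\<in>Hom C A B. \<exists>s\<in>Hom C B A.
      comp_arr C s r = e \<and> comp_arr C r s = id_arr C B))"

subsection \<open>Isomorphisms\<close>

definition iso_arr :: "('o, 'm, 'k) lincat \<Rightarrow> 'm \<Rightarrow> bool" where
  "iso_arr C f \<longleftrightarrow> f \<in> arr C \<and> (\<exists>g\<in>Hom C (tgt C f) (src C f).
    comp_arr C g f = id_arr C (src C f) \<and> comp_arr C f g = id_arr C (tgt C f))"

definition isomorphic :: "('o, 'm, 'k) lincat \<Rightarrow> 'o \<Rightarrow> 'o \<Rightarrow> bool" where
  "isomorphic C A B \<longleftrightarrow> (\<exists>f\<in>Hom C A B. iso_arr C f)"

definition iso_class :: "('o, 'm, 'k) lincat \<Rightarrow> 'o \<Rightarrow> 'o set" where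
  "iso_class C A = {B \<in> obj C. isomorphic C A B}"

definition Iso :: "('o, 'm, 'k) lincat \<Rightarrow> 'o set set" where
  "Iso C = iso_class C ` obj C"

subsection \<open>Direct sums and indecomposable objects\<close>

definition zero_object :: "('o, 'm, 'k) lincat \<Rightarrow> 'o \<Rightarrow> bool" where
  "zero_object C Z \<longleftrightarrow> Z \<in> obj C \<and>
    (\<forall>A\<in>obj C. (\<exists>!f. f \<in> Hom C A Z) \<and> (\<exists>!f. f \<in> Hom C Z A))"

definition biproduct ::
  "('o, 'm, 'k) lincat \<Rightarrow> 'o \<Rightarrow> 'o \<Rightarrow> 'o \<Rightarrow> 'm \<Rightarrow> 'm \<Rightarrow> 'm \<Rightarrow> 'm \<Rightarrow> bool" where
  "biproduct C M A B i1 i2 p1 p2 \<longleftrightarrow>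
    i1 \<in> Hom C A M \<and> i2 \<in> Hom C B M \<and> p1 \<in> Hom C M A \<and> p2 \<in> Hom C M B \<and>
    comp_arr C p1 i1 = id_arr C A \<and> comp_arr C p2 i2 = id_arr C B \<and>
    comp_arr C p2 i1 = zero_arr C A B \<and> comp_arr C p1 i2 = zero_arr C B A \<and>
    add_arr C (comp_arr C i1 p1) (comp_arr C i2 p2) = id_arr C M"

definition direct_sum :: "('o, 'm, 'k) lincat \<Rightarrow> 'o \<Rightarrow> 'o \<Rightarrow> 'o \<Rightarrow> bool" where
  "direct_sum C M A B \<longleftrightarrow> M \<in> obj C \<and> A \<in> obj C \<and> B \<in> obj C \<and>
    (\<exists>i1 i2 p1 p2. biproduct C M A B i1 i2 p1 p2)"

definition additive_category :: "('o, 'm, 'k) lincat \<Rightarrow> bool" where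
  "additive_category C \<longleftrightarrow> (\<exists>Z. zero_object C Z) \<and>
    (\<forall>A\<in>obj C. \<forall>B\<in>obj C. \<exists>M. direct_sum C M A B)"

definition indecomposable :: "('o, 'm, 'k) lincat \<Rightarrow> 'o \<Rightarrow> bool" where
  "indecomposable C M \<longleftrightarrow> M \<in> obj C \<and> \<not> zero_object C M \<and>
    (\<forall>A B. direct_sum C M A B \<longrightarrow> zero_object C A \<or> zero_object C B)"

definition ind :: "('o, 'm, 'k) lincat \<Rightarrow> 'o set set" where
  "ind C = iso_class C ` {M. indecomposable C M}"

definition additively_finite :: "('o, 'm, 'k) lincat \<Rightarrow> bool" where
  "additively_finite C \<longleftrightarrow> finite (ind C)"

fun direct_sum_list :: "('o, 'm, 'k) lincat \<Rightarrow> 'o \<Rightarrow> 'o list \<Rightarrow> bool" where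
  "direct_sum_list C M [] \<longleftrightarrow> zero_object C M"
| "direct_sum_list C M (A # As) \<longleftrightarrow> (\<exists>N. direct_sum C M A N \<and> direct_sum_list C N As)"

section \<open>Exact structures\<close>

definition is_kernel :: "('o, 'm, 'k) lincat \<Rightarrow> 'm \<Rightarrow> 'm \<Rightarrow> bool" where
  "is_kernel C i p \<longleftrightarrow> i \<in> arr C \<and> p \<in> arr C \<and> tgt C i = src C p \<and>
    comp_arr C p i = zero_arr C (src C i) (tgt C p) \<and>
    (\<forall>f\<in>arr C. tgt C f = src C p \<and> comp_arr C p f = zero_arr C (src C f) (tgt C p) \<longrightarrow>
      (\<exists>!g. g \<in> Hom C (src C f) (src C i) \<and> comp_arr C i g = f))"

definition is_cokernel :: "('o, 'm, 'k) lincat \<Rightarrow> 'm \<Rightarrow> 'm \<Rightarrow> bool" where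
  "is_cokernel C p i \<longleftrightarrow> i \<in> arr C \<and> p \<in> arr C \<and> tgt C i = src C p \<and>
    comp_arr C p i = zero_arr C (src C i) (tgt C p) \<and>
    (\<forall>f\<in>arr C. src C f = tgt C i \<and> comp_arr C f i = zero_arr C (src C i) (tgt C f) \<longrightarrow>
      (\<exists>!g. g \<in> Hom C (tgt C p) (tgt C f) \<and> comp_arr C g p = f))"

definition kernel_cokernel_pair :: "('o, 'm, 'k) lincat \<Rightarrow> 'm \<Rightarrow> 'm \<Rightarrow> bool" where
  "kernel_cokernel_pair C i p \<longleftrightarrow> is_kernel C i p \<and> is_cokernel C p i"

definition pair_isomorphic :: "('o, 'm, 'k) lincat \<Rightarrow> 'm \<times> 'm \<Rightarrow> 'm \<times> 'm \<Rightarrow> bool" where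
  "pair_isomorphic C = (\<lambda>(i, p) (i', p'). \<exists>a b c. iso_arr C a \<and> iso_arr C b \<and> iso_arr C c \<and>
    a \<in> Hom C (src C i) (src C i') \<and> b \<in> Hom C (tgt C i) (tgt C i') \<and>
    c \<in> Hom C (tgt C p) (tgt C p') \<and>
    comp_arr C b i = comp_arr C i' a \<and> comp_arr C c p = comp_arr C p' b)"

definition pushout_square :: "('o, 'm, 'k) lincat \<Rightarrow> 'm \<Rightarrow> 'm \<Rightarrow> 'm \<Rightarrow> 'm \<Rightarrow> bool"
  \<comment> \<open>pushout of \<open>i : A \<rightarrow> B\<close> along \<open>f : A \<rightarrow> A'\<close>, with \<open>i' : A' \<rightarrow> B'\<close> and \<open>f' : B \<rightarrow> B'\<close>\<close>
  where
  "pushout_square C i f i' f' \<longleftrightarrow>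
    i \<in> arr C \<and> f \<in> arr C \<and> i' \<in> arr C \<and> f' \<in> arr C \<and>
    src C i = src C f \<and> src C i' = tgt C f \<and> src C f' = tgt C i \<and> tgt C i' = tgt C f' \<and>
    comp_arr C f' i = comp_arr C i' f \<and>
    (\<forall>g\<in>arr C. \<forall>h\<in>arr C. src C g = tgt C f \<and> src C h = tgt C i \<and> tgt C g = tgt C h \<and>
      comp_arr C h i = comp_arr C g f \<longrightarrow>
      (\<exists>!u. u \<in> Hom C (tgt C i') (tgt C g) \<and> comp_arr C u i' = g \<and> comp_arr C u f' = h))"

definition pullback_square :: "('o, 'm, 'k) lincat \<Rightarrow> 'm \<Rightarrow> 'm \<Rightarrow> 'm \<Rightarrow> 'm \<Rightarrow> bool"
  \<comment> \<open>pullback of \<open>p : B \<rightarrow> A\<close> along \<open>f : A' \<rightarrow> A\<close>, with \<open>p' : B' \<rightarrow> A'\<close> and \<open>f' : B' \<rightarrow> B\<close>\<close>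
  where
  "pullback_square C p f p' f' \<longleftrightarrow>
    p \<in> arr C \<and> f \<in> arr C \<and> p' \<in> arr C \<and> f' \<in> arr C \<and>
    tgt C p = tgt C f \<and> tgt C p' = src C f \<and> tgt C f' = src C p \<and> src C p' = src C f' \<and>
    comp_arr C p f' = comp_arr C f p' \<and>
    (\<forall>g\<in>arr C. \<forall>h\<in>arr C. tgt C g = src C f \<and> tgt C h = src C p \<and> src C g = src C h \<and>
      comp_arr C p h = comp_arr C f g \<longrightarrow>
      (\<exists>!u. u \<in> Hom C (src C g) (src C p') \<and> comp_arr C p' u = g \<and> comp_arr C f' u = h))"

definition inflation :: "('m \<times> 'm) set \<Rightarrow> 'm \<Rightarrow> bool" where
  "inflation E i \<longleftrightarrow> (\<exists>p. (i, p) \<in> E)"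

definition deflation :: "('m \<times> 'm) set \<Rightarrow> 'm \<Rightarrow> bool" where
  "deflation E p \<longleftrightarrow> (\<exists>i. (i, p) \<in> E)"

text \<open>An exact structure is its set of conflations, each given as the pair of its two arrows.\<close>

definition exact_structure :: "('o, 'm, 'k) lincat \<Rightarrow> ('m \<times> 'm) set \<Rightarrow> bool" where
  "exact_structure C E \<longleftrightarrow>
    (\<forall>(i, p)\<in>E. kernel_cokernel_pair C i p) \<and>
    (\<forall>(i, p)\<in>E. \<forall>i' p'. kernel_cokernel_pair C i' p' \<and> pair_isomorphic C (i, p) (i', p') \<longrightarrow>
      (i', p') \<in> E) \<and>
    (\<forall>A\<in>obj C. inflation E (id_arr C A) \<and> deflation E (id_arr C A)) \<and>
    (\<forall>i j. inflation E i \<and> inflation E j \<and> tgt C i = src C j \<longrightarrow> inflation E (comp_arr C j i)) \<and>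
    (\<forall>p q. deflation E p \<and> deflation E q \<and> tgt C p = src C q \<longrightarrow> deflation E (comp_arr C q p)) \<and>
    (\<forall>i f. inflation E i \<and> f \<in> arr C \<and> src C f = src C i \<longrightarrow>
      (\<exists>i' f'. pushout_square C i f i' f' \<and> inflation E i')) \<and>
    (\<forall>p f. deflation E p \<and> f \<in> arr C \<and> tgt C f = tgt C p \<longrightarrow>
      (\<exists>p' f'. pullback_square C p f p' f' \<and> deflation E p'))"

definition split_structure :: "('o, 'm, 'k) lincat \<Rightarrow> ('m \<times> 'm) set" where
  "split_structure C = {(i, p). i \<in> arr C \<and> p \<in> arr C \<and>
    (\<exists>r s. biproduct C (tgt C i) (src C i) (tgt C p) i s r p)}"

section \<open>Tensor product of an abelian group with the reals\<close>

text \<open>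
  For an abelian group \<open>G\<close>, written multiplicatively, \<open>real_tensor G\<close> is the tensor product over the
  integers of \<open>G\<close> with the reals.  Its elements are cosets of \<open>tensor_relations G\<close>, and the product
  with that subgroup in \<open>real_scale\<close> and \<open>real_tensor_map\<close> turns the image of a coset into a coset.
\<close>

definition tensor_relations :: "('a, 'b) monoid_scheme \<Rightarrow> ('a \<times> real \<Rightarrow>\<^sub>0 int) set" where
  "tensor_relations G = generate (free_Abelian_group (carrier G \<times> UNIV))
    ({frag_of (g \<otimes>\<^bsub>G\<^esub> h, r) - frag_of (g, r) - frag_of (h, r) | g h r.
        g \<in> carrier G \<and> h \<in> carrier G} \<union>
     {frag_of (g, r + s) - frag_of (g, r) - frag_of (g, s) | g r s. g \<in> carrier G})"

definition real_tensor :: "('a, 'b) monoid_scheme \<Rightarrow> ('a \<times> real \<Rightarrow>\<^sub>0 int) set monoid" where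
  "real_tensor G = free_Abelian_group (carrier G \<times> UNIV) Mod tensor_relations G"

definition pure_tensor :: "('a, 'b) monoid_scheme \<Rightarrow> 'a \<Rightarrow> real \<Rightarrow> ('a \<times> real \<Rightarrow>\<^sub>0 int) set" where
  "pure_tensor G g r =
    tensor_relations G #>\<^bsub>free_Abelian_group (carrier G \<times> UNIV)\<^esub> frag_of (g, r)"

definition real_scale ::
  "('a, 'b) monoid_scheme \<Rightarrow> real \<Rightarrow> ('a \<times> real \<Rightarrow>\<^sub>0 int) set \<Rightarrow> ('a \<times> real \<Rightarrow>\<^sub>0 int) set" where
  "real_scale G c U = tensor_relations G <#>\<^bsub>free_Abelian_group (carrier G \<times> UNIV)\<^esub>
    (frag_extend (\<lambda>(g, r). frag_of (g, c * r)) ` U)"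

text \<open>The map induced on tensor products by a homomorphism \<open>f\<close> with codomain \<open>H\<close>.\<close>

definition real_tensor_map ::
  "('b, 'c) monoid_scheme \<Rightarrow> ('a \<Rightarrow> 'b) \<Rightarrow> ('a \<times> real \<Rightarrow>\<^sub>0 int) set \<Rightarrow> ('b \<times> real \<Rightarrow>\<^sub>0 int) set" where
  "real_tensor_map H f U = tensor_relations H <#>\<^bsub>free_Abelian_group (carrier H \<times> UNIV)\<^esub>
    (frag_extend (\<lambda>(g, r). frag_of (f g, r)) ` U)"

text \<open>Linear functionals are \<open>undefined\<close> outside the carrier, so that equality is equality on the carrier.\<close>

definition dual_space :: "('a, 'b) monoid_scheme \<Rightarrow> (('a \<times> real \<Rightarrow>\<^sub>0 int) set \<Rightarrow> real) set" where
  "dual_space G = {\<phi> \<in> extensional (carrier (real_tensor G)).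
    (\<forall>x\<in>carrier (real_tensor G). \<forall>y\<in>carrier (real_tensor G).
      \<phi> (x \<otimes>\<^bsub>real_tensor G\<^esub> y) = \<phi> x + \<phi> y) \<and>
    (\<forall>c. \<forall>x\<in>carrier (real_tensor G). \<phi> (real_scale G c x) = c * \<phi> x)}"

text \<open>The set of finite linear combinations of elements of \<open>S\<close> with nonnegative real coefficients.\<close>

inductive_set cone_generated ::
  "('a, 'b) monoid_scheme \<Rightarrow> ('a \<times> real \<Rightarrow>\<^sub>0 int) set set \<Rightarrow> ('a \<times> real \<Rightarrow>\<^sub>0 int) set set"
  for G S where
  zero: "\<one>\<^bsub>real_tensor G\<^esub> \<in> cone_generated G S"
| add_multiple: "x \<in> cone_generated G S \<Longrightarrow> s \<in> S \<Longrightarrow> 0 \<le> c \<Longrightarrow>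
    x \<otimes>\<^bsub>real_tensor G\<^esub> real_scale G c s \<in> cone_generated G S"

section \<open>Grothendieck groups and the cone of a pair of exact structures\<close>

definition K0_relations :: "('o, 'm, 'k) lincat \<Rightarrow> ('m \<times> 'm) set \<Rightarrow> ('o set \<Rightarrow>\<^sub>0 int) set" where
  "K0_relations C E = generate (free_Abelian_group (Iso C))
    {frag_of (iso_class C (tgt C i)) - frag_of (iso_class C (src C i))
       - frag_of (iso_class C (tgt C p)) | i p. (i, p) \<in> E}"

definition K0 :: "('o, 'm, 'k) lincat \<Rightarrow> ('m \<times> 'm) set \<Rightarrow> ('o set \<Rightarrow>\<^sub>0 int) set monoid" where
  "K0 C E = free_Abelian_group (Iso C) Mod K0_relations C E"

definition K0_class ::
  "('o, 'm, 'k) lincat \<Rightarrow> ('m \<times> 'm) set \<Rightarrow> 'o set \<Rightarrow> ('o set \<Rightarrow>\<^sub>0 int) set" where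
  "K0_class C E X = K0_relations C E #>\<^bsub>free_Abelian_group (Iso C)\<^esub> frag_of X"

text \<open>
  For exact structures \<open>E' \<subseteq> E\<close>, the map \<open>K0_map C E\<close> is the canonical surjection from \<open>K0 C E'\<close>
  to \<open>K0 C E\<close>: it sends a coset of the smaller subgroup to the coset of the larger one containing it.
\<close>

definition K0_map ::
  "('o, 'm, 'k) lincat \<Rightarrow> ('m \<times> 'm) set \<Rightarrow> ('o set \<Rightarrow>\<^sub>0 int) set \<Rightarrow> ('o set \<Rightarrow>\<^sub>0 int) set" where
  "K0_map C E U = K0_relations C E <#>\<^bsub>free_Abelian_group (Iso C)\<^esub> U"

definition Lambda ::
  "('o, 'm, 'k) lincat \<Rightarrow> ('m \<times> 'm) set \<Rightarrow> ('m \<times> 'm) set \<Rightarrow> ('o set \<Rightarrow>\<^sub>0 int) set monoid" where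
  "Lambda C E E' = (K0 C E')\<lparr>carrier := kernel (K0 C E') (K0 C E) (K0_map C E)\<rparr>"

definition euler_class ::
  "('o, 'm, 'k) lincat \<Rightarrow> ('m \<times> 'm) set \<Rightarrow> 'm \<times> 'm \<Rightarrow> ('o set \<Rightarrow>\<^sub>0 int) set"
  \<comment> \<open>the element \<open>[X] - [Y] + [Z]\<close> of \<open>K0 C E'\<close>\<close>
  where
  "euler_class C E' = (\<lambda>(i, p).
    K0_class C E' (iso_class C (src C i))
      \<otimes>\<^bsub>K0 C E'\<^esub> inv\<^bsub>K0 C E'\<^esub> K0_class C E' (iso_class C (tgt C i))
      \<otimes>\<^bsub>K0 C E'\<^esub> K0_class C E' (iso_class C (tgt C p)))"

definition conflation_cone ::
  "('o, 'm, 'k) lincat \<Rightarrow> ('m \<times> 'm) set \<Rightarrow> ('m \<times> 'm) set \<Rightarrow>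
    (('o set \<Rightarrow>\<^sub>0 int) set \<times> real \<Rightarrow>\<^sub>0 int) set set" where
  "conflation_cone C E E' = cone_generated (Lambda C E E')
    ((\<lambda>x. pure_tensor (Lambda C E E') (euler_class C E' x) 1) ` (E - E'))"

text \<open>
  The map from \<open>real_tensor (Lambda C E E')\<close> to \<open>real_tensor (K0 C E')\<close> induced by the inclusion of
  \<open>Lambda C E E'\<close> in \<open>K0 C E'\<close>.
\<close>

definition lattice_incl ::
  "('o, 'm, 'k) lincat \<Rightarrow> ('m \<times> 'm) set \<Rightarrow>
    (('o set \<Rightarrow>\<^sub>0 int) set \<times> real \<Rightarrow>\<^sub>0 int) set \<Rightarrow> (('o set \<Rightarrow>\<^sub>0 int) set \<times> real \<Rightarrow>\<^sub>0 int) set" where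
  "lattice_incl C E' = real_tensor_map (K0 C E') (\<lambda>g. g)"

text \<open>
  The functional on \<open>real_tensor (K0 C E')\<close> to which \<open>\<phi>\<close> descends.  It exists (and is unique) exactly
  when \<open>\<phi>\<close> vanishes on \<open>conflation_cone C E' (split_structure C)\<close>, and is only meant to be used then.
\<close>

definition descended ::
  "('o, 'm, 'k) lincat \<Rightarrow> ('m \<times> 'm) set \<Rightarrow>
    ((('o set \<Rightarrow>\<^sub>0 int) set \<times> real \<Rightarrow>\<^sub>0 int) set \<Rightarrow> real) \<Rightarrow>
    ((('o set \<Rightarrow>\<^sub>0 int) set \<times> real \<Rightarrow>\<^sub>0 int) set \<Rightarrow> real)" where
  "descended C E' \<phi> = (THE \<psi>. \<psi> \<in> dual_space (K0 C E') \<and>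
    (\<forall>z\<in>carrier (real_tensor (K0 C (split_structure C))).
      \<psi> (real_tensor_map (K0 C E') (K0_map C E') z) = \<phi> z))"

text \<open>The function on \<open>ind C\<close> given by the values of a functional on the basis of indecomposables.\<close>

definition basis_values ::
  "('o, 'm, 'k) lincat \<Rightarrow> ((('o set \<Rightarrow>\<^sub>0 int) set \<times> real \<Rightarrow>\<^sub>0 int) set \<Rightarrow> real) \<Rightarrow> 'o set \<Rightarrow> real" where
  "basis_values C \<phi> = (\<lambda>X\<in>ind C. \<phi> (pure_tensor (K0 C (split_structure C))
    (K0_class C (split_structure C) X) 1))"

section \<open>Hall algebras\<close>

definition conflations_on ::
  "('o, 'm, 'k) lincat \<Rightarrow> ('m \<times> 'm) set \<Rightarrow> 'o \<Rightarrow> 'o \<Rightarrow> ('m \<times> 'm) set"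
  \<comment> \<open>the conflations \<open>D \<rightarrow> B' \<rightarrow> A\<close>\<close>
  where
  "conflations_on C E A D = {(i, p) \<in> E. src C i = D \<and> tgt C p = A}"

definition extension_equiv ::
  "('o, 'm, 'k) lincat \<Rightarrow> ('m \<times> 'm) set \<Rightarrow> 'o \<Rightarrow> 'o \<Rightarrow> (('m \<times> 'm) \<times> ('m \<times> 'm)) set" where
  "extension_equiv C E A D = {((i, p), (i', p')).
    (i, p) \<in> conflations_on C E A D \<and> (i', p') \<in> conflations_on C E A D \<and>
    (\<exists>h\<in>Hom C (tgt C i) (tgt C i'). iso_arr C h \<and> comp_arr C h i = i' \<and> comp_arr C p' h = p)}"

definition Ext1_mid ::
  "('o, 'm, 'k) lincat \<Rightarrow> ('m \<times> 'm) set \<Rightarrow> 'o \<Rightarrow> 'o \<Rightarrow> 'o set \<Rightarrow> ('m \<times> 'm) set set"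
  \<comment> \<open>the classes of extensions whose middle term lies in the isomorphism class \<open>X\<close>\<close>
  where
  "Ext1_mid C E A D X =
    {(i, p) \<in> conflations_on C E A D. tgt C i \<in> X} // extension_equiv C E A D"

definition rep :: "'o set \<Rightarrow> 'o" where
  "rep X = (SOME A. A \<in> X)"

definition hall_coeff ::
  "('o, 'm, 'k) lincat \<Rightarrow> ('m \<times> 'm) set \<Rightarrow> 'o set \<Rightarrow> 'o set \<Rightarrow> 'o set \<Rightarrow> rat" where
  "hall_coeff C E X Z Y =
    of_nat (card (Ext1_mid C E (rep X) (rep Z) Y)) / of_nat (card (Hom C (rep X) (rep Z)))"

text \<open>
  Both \<open>card\<close> and the inner sum silently return 0 on infinite sets; this does not occur for
  Hom-finite, Ext-finite exact structures.
\<close>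

definition hall_algebra :: "('o, 'm, 'k) lincat \<Rightarrow> ('m \<times> 'm) set \<Rightarrow> ('o set \<Rightarrow>\<^sub>0 rat) ring" where
  "hall_algebra C E =
    \<lparr>carrier = {x. Poly_Mapping.keys x \<subseteq> Iso C},
     monoid.mult = (\<lambda>x y. \<Sum>X\<in>Poly_Mapping.keys x. \<Sum>Z\<in>Poly_Mapping.keys y.
       \<Sum>Y\<in>{Y \<in> Iso C. Ext1_mid C E (rep X) (rep Z) Y \<noteq> {}}.
         Poly_Mapping.single Y
           (Poly_Mapping.lookup x X * Poly_Mapping.lookup y Z * hall_coeff C E X Z Y)),
     one = Poly_Mapping.single {Z. zero_object C Z} 1,
     zero = 0,
     add = (+)\<rparr>"

section \<open>Filtrations indexed by the reals and associated graded algebras\<close>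

definition algebra_filtration :: "('a, 'b) ring_scheme \<Rightarrow> (real \<Rightarrow> 'a set) \<Rightarrow> bool" where
  "algebra_filtration R F \<longleftrightarrow>
    (\<forall>t. additive_subgroup (F t) R) \<and> (\<forall>s t. s \<le> t \<longrightarrow> F s \<subseteq> F t) \<and> (\<Union>t. F t) = carrier R \<and>
    \<one>\<^bsub>R\<^esub> \<in> F 0 \<and> (\<forall>s t. \<forall>x\<in>F s. \<forall>y\<in>F t. x \<otimes>\<^bsub>R\<^esub> y \<in> F (s + t))"

definition filtration_below :: "(real \<Rightarrow> 'a set) \<Rightarrow> real \<Rightarrow> 'a set" where
  "filtration_below F t = (\<Union>s\<in>{..<t}. F s)"

text \<open>
  An element of the associated graded algebra is a family whose entry at \<open>t\<close> is a coset in the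
  quotient of \<open>F t\<close> by \<open>filtration_below F t\<close>, almost all entries being zero.  The product is computed
  on representatives; for an algebra filtration its entries are again single cosets.
\<close>

definition associated_graded :: "('a, 'b) ring_scheme \<Rightarrow> (real \<Rightarrow> 'a set) \<Rightarrow> (real \<Rightarrow> 'a set) ring" where
  "associated_graded R F =
    \<lparr>carrier = {x. (\<forall>t. x t \<in> (\<lambda>a. filtration_below F t +>\<^bsub>R\<^esub> a) ` F t) \<and>
       finite {t. x t \<noteq> filtration_below F t}},
     monoid.mult = (\<lambda>x y t.
       {(\<Oplus>\<^bsub>R\<^esub>r\<in>{r. x r \<noteq> filtration_below F r}. a r \<otimes>\<^bsub>R\<^esub> b (t - r)) \<oplus>\<^bsub>R\<^esub> c | a b c.
          (\<forall>r. a r \<in> x r) \<and> (\<forall>s. b s \<in> y s) \<and> c \<in> filtration_below F t}),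
     one = (\<lambda>t. if t = 0 then filtration_below F 0 +>\<^bsub>R\<^esub> \<one>\<^bsub>R\<^esub> else filtration_below F t),
     zero = filtration_below F,
     add = (\<lambda>x y t. x t <+>\<^bsub>R\<^esub> y t)\<rparr>"

definition graded_class ::
  "('a, 'b) ring_scheme \<Rightarrow> (real \<Rightarrow> 'a set) \<Rightarrow> real \<Rightarrow> 'a \<Rightarrow> real \<Rightarrow> 'a set"
  \<comment> \<open>the class of \<open>a \<in> F t\<close> in degree \<open>t\<close>\<close>
  where
  "graded_class R F t a =
    (\<lambda>s. if s = t then filtration_below F t +>\<^bsub>R\<^esub> a else filtration_below F s)"

section \<open>The degree cone\<close>

text \<open>
  Additive extension of \<open>d\<close> to all isomorphism classes; the value is determined by the
  Krull--Schmidt property.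
\<close>

definition degree :: "('o, 'm, 'k) lincat \<Rightarrow> ('o set \<Rightarrow> real) \<Rightarrow> 'o set \<Rightarrow> real" where
  "degree C d X = (THE r. \<exists>M\<in>X. \<exists>Ms. (\<forall>N\<in>set Ms. indecomposable C N) \<and>
    direct_sum_list C M Ms \<and> r = (\<Sum>N\<leftarrow>Ms. d (iso_class C N)))"

text \<open>A vector lies in the span of a set of basis vectors iff its support does.\<close>

definition degree_filtration ::
  "('o, 'm, 'k) lincat \<Rightarrow> ('o set \<Rightarrow> real) \<Rightarrow> real \<Rightarrow> ('o set \<Rightarrow>\<^sub>0 rat) set" where
  "degree_filtration C d t = {x. Poly_Mapping.keys x \<subseteq> {X \<in> Iso C. degree C d X \<le> t}}"

text \<open>
  The equality of the associated graded algebra with the Hall algebra of \<open>E'\<close> says that sending the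
  basis element of \<open>X\<close> to its class in degree \<open>degree C d X\<close> extends to an isomorphism of algebras.
  Linearity over the rationals is automatic for additive maps.
\<close>

definition degree_cone ::
  "('o, 'm, 'k) lincat \<Rightarrow> ('m \<times> 'm) set \<Rightarrow> ('m \<times> 'm) set \<Rightarrow> ('o set \<Rightarrow> real) set" where
  "degree_cone C E E' = {d \<in> ind C \<rightarrow>\<^sub>E UNIV.
    algebra_filtration (hall_algebra C E) (degree_filtration C d) \<and>
    (\<exists>\<Psi>\<in>ring_iso (hall_algebra C E')
          (associated_graded (hall_algebra C E) (degree_filtration C d)).
      \<forall>X\<in>Iso C. \<Psi> (Poly_Mapping.single X 1) =
        graded_class (hall_algebra C E) (degree_filtration C d) (degree C d X)
          (Poly_Mapping.single X 1))}"

end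

theory Submission
  imports Defs
begin

text \<open>
  Write \<open>Z \<rightarrow> Y \<rightarrow> X\<close> for a conflation, and let \<open>d\<close> be a real function on the indecomposables, extended
  additively to a degree on all isomorphism classes.

  The structure constant of the Hall algebra at \<open>[X]\<close>, \<open>[Z]\<close>, \<open>[Y]\<close> is nonzero exactly if there is a
  conflation \<open>Z \<rightarrow> Y \<rightarrow> X\<close>.  Hence the degree filtration is multiplicative iff
  \<open>deg Y \<le> deg X + deg Z\<close> for all conflations of \<open>E\<close>, and the product of the associated graded algebra
  keeps exactly the structure constants with equality (\<open>graded_iff\<close>).  The classes of extensions in \<open>E'\<close>
  are among those in \<open>E\<close>, so their finite numbers agree only if the sets agree.  Therefore \<open>d\<close> lies in
  the degree cone iff \<open>deg X - deg Y + deg Z\<close> vanishes on the conflations of \<open>E'\<close> and is positive on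
  those of \<open>E\<close> outside \<open>E'\<close> (\<open>degree_cone_iff\<close>).

  On the other side, a functional on the real Grothendieck group of a class of conflations is a
  function on isomorphism classes that is additive on these conflations.  For the split structure such
  functions correspond to arbitrary functions on the indecomposables, by the Krull--Schmidt property
  (\<open>basis_values_bij\<close>).  This property is obtained by counting: for an indecomposable \<open>U\<close>, the quotient of
  \<open>Hom U Y\<close> by the radical maps has a logarithmic size additive in \<open>Y\<close>, and it vanishes on the
  indecomposables not isomorphic to \<open>U\<close>.

  The two descriptions agree except at one point: positivity on the cone is only demanded at nonzero
  elements, so one must know that \<open>[X] - [Y] + [Z]\<close> is nonzero over the reals for every conflation of
  \<open>E\<close> outside \<open>E'\<close>.  This is the heart of the proof (\<open>projective_detects\<close>, \<open>detecting_functional\<close>).  Among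
  the maps to \<open>X\<close> from indecomposables that do not lift to \<open>Y\<close> even after an \<open>E'\<close>-deflation onto their
  source, choose one with the fewest multiples, that is, composites with maps from indecomposables.
  Its source \<open>U\<close> is projective for \<open>E'\<close>: a deflation onto \<open>U\<close> that does not split would give a map with
  strictly fewer multiples, since nonisomorphisms of \<open>U\<close> are nilpotent.  Such maps exist because of the obscure axiom: if the identity of \<open>X\<close> lifted locally,
  then the conflation would belong to \<open>E'\<close>.  Now the logarithm of the size of \<open>Hom U W\<close> is additive in \<open>W\<close> on
  the conflations of \<open>E'\<close>, but not on \<open>Z \<rightarrow> Y \<rightarrow> X\<close>.
\<close>

section \<open>Arrows of a linear category\<close>

context linear_category begin

abbreviation compose (infixr "\<cdot>" 70) where "g \<cdot> f \<equiv> comp_arr C g f"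
abbreviation plus_arr (infixl "\<boxplus>" 65) where "f \<boxplus> g \<equiv> add_arr C f g"

text \<open>
  Arrow identities are proved by the simplifier from the sources and targets of the arrows involved;
  composites are kept associated to the right.
\<close>

lemma in_Hom: "f \<in> Hom C A B \<longleftrightarrow> f \<in> arr C \<and> src C f = A \<and> tgt C f = B"
  by (auto simp: Hom_def)

lemma Hom_obj: assumes "f \<in> Hom C A B" shows "A \<in> obj C" "B \<in> obj C"
  using assms src_in_obj tgt_in_obj by (auto simp: in_Hom)

lemma comp_arr_simps [simp]:
  assumes "f \<in> arr C" "g \<in> arr C" "src C g = tgt C f"
  shows "g \<cdot> f \<in> arr C" "src C (g \<cdot> f) = src C f" "tgt C (g \<cdot> f) = tgt C g"
  using comp_in_Hom[of f "src C f" "tgt C f" g "tgt C g"] assms by (auto simp: in_Hom)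

lemma id_arr_simps [simp]:
  assumes "A \<in> obj C"
  shows "id_arr C A \<in> arr C" "src C (id_arr C A) = A" "tgt C (id_arr C A) = A"
  using id_in_Hom[OF assms] by (auto simp: in_Hom)

lemma src_obj [simp]: "f \<in> arr C \<Longrightarrow> src C f \<in> obj C" and tgt_obj [simp]: "f \<in> arr C \<Longrightarrow> tgt C f \<in> obj C"
  by (auto simp: src_in_obj tgt_in_obj)

lemma comp_assoc_arr [simp]:
  assumes "f \<in> arr C" "g \<in> arr C" "h \<in> arr C" "src C g = tgt C f" "src C h = tgt C g"
  shows "(h \<cdot> g) \<cdot> f = h \<cdot> (g \<cdot> f)"
  using comp_assoc[of f "src C f" "tgt C f" g "tgt C g" h "tgt C h"] assms by (simp add: in_Hom)

lemma comp_id_arr [simp]: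
  assumes "f \<in> arr C"
  shows "src C f = A \<Longrightarrow> f \<cdot> id_arr C A = f" "tgt C f = A \<Longrightarrow> id_arr C A \<cdot> f = f"
  using comp_id_right[of f "src C f" "tgt C f"] comp_id_left[of f "src C f" "tgt C f"] assms
  by (auto simp: in_Hom)

text \<open>
  Rewrites with a known composite inside a right-associated composite.
\<close>

lemma collapse:
  assumes "a \<cdot> b = c" "x \<in> arr C" "a \<in> arr C" "b \<in> arr C" "src C a = tgt C b" "src C b = tgt C x"
  shows "a \<cdot> (b \<cdot> x) = c \<cdot> x"
  using comp_assoc_arr[of x b a] assms by simp

lemma Hom_group:
  assumes "A \<in> obj C" "B \<in> obj C"
  shows "abelian_group (hom_module C A B)"
  using hom_module[OF assms] by (simp add: module_def)

lemma hom_module_simps [simp]: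
  "carrier (hom_module C A B) = Hom C A B" "add (hom_module C A B) = add_arr C"
  "zero (hom_module C A B) = zero_arr C A B" "smult (hom_module C A B) = scale_arr C"
  by (simp_all add: hom_module_def)

lemma zero_arr_simps [simp]:
  assumes "A \<in> obj C" "B \<in> obj C"
  shows "zero_arr C A B \<in> arr C" "src C (zero_arr C A B) = A" "tgt C (zero_arr C A B) = B"
  using abelian_monoid.zero_closed[OF abelian_group.axioms(1)[OF Hom_group[OF assms]]]
  by (auto simp: in_Hom)

lemma add_arr_simps [simp]:
  assumes "f \<in> arr C" "g \<in> arr C" "src C f = src C g" "tgt C f = tgt C g"
  shows "f \<boxplus> g \<in> arr C" "src C (f \<boxplus> g) = src C g" "tgt C (f \<boxplus> g) = tgt C g"
proof -
  have "f \<boxplus> g \<in> Hom C (src C g) (tgt C g)"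
    using abelian_monoid.a_closed[OF abelian_group.axioms(1)[OF Hom_group[OF src_obj[OF assms(2)] tgt_obj[OF assms(2)]]], of f g] assms
    by (simp add: in_Hom)
  then show "f \<boxplus> g \<in> arr C" "src C (f \<boxplus> g) = src C g" "tgt C (f \<boxplus> g) = tgt C g"
    by (auto simp: in_Hom)
qed

lemma add_arr_assoc:
  assumes "f \<in> arr C" "g \<in> arr C" "h \<in> arr C" "src C f = src C g" "tgt C f = tgt C g"
    "src C g = src C h" "tgt C g = tgt C h"
  shows "(f \<boxplus> g) \<boxplus> h = f \<boxplus> (g \<boxplus> h)"
  using abelian_monoid.a_assoc[OF abelian_group.axioms(1)[OF Hom_group[OF src_obj[OF assms(2)] tgt_obj[OF assms(2)]]], of f g h] assms
  by (simp add: in_Hom)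

lemma add_arr_comm:
  assumes "f \<in> arr C" "g \<in> arr C" "src C f = src C g" "tgt C f = tgt C g"
  shows "f \<boxplus> g = g \<boxplus> f"
  using abelian_monoid.a_comm[OF abelian_group.axioms(1)[OF Hom_group[OF src_obj[OF assms(2)] tgt_obj[OF assms(2)]]], of f g] assms
  by (simp add: in_Hom)

lemma add_arr_zero [simp]:
  assumes "f \<in> arr C" "src C f = A" "tgt C f = B"
  shows "f \<boxplus> zero_arr C A B = f" "zero_arr C A B \<boxplus> f = f"
proof -
  have obj: "A \<in> obj C" "B \<in> obj C" using assms by auto
  show "f \<boxplus> zero_arr C A B = f" "zero_arr C A B \<boxplus> f = f"
    using abelian_monoid.r_zero[OF abelian_group.axioms(1)[OF Hom_group[OF obj]], of f]
      abelian_monoid.l_zero[OF abelian_group.axioms(1)[OF Hom_group[OF obj]], of f] assms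
    by (simp_all add: in_Hom)
qed

lemma add_arr_cancel:
  assumes "f \<in> arr C" "g \<in> arr C" "h \<in> arr C" "src C f = src C h" "tgt C f = tgt C h"
    "src C g = src C h" "tgt C g = tgt C h"
  shows "f \<boxplus> h = g \<boxplus> h \<longleftrightarrow> f = g" "h \<boxplus> f = h \<boxplus> g \<longleftrightarrow> f = g"
proof -
  have obj: "src C h \<in> obj C" "tgt C h \<in> obj C" using assms by auto
  show "f \<boxplus> h = g \<boxplus> h \<longleftrightarrow> f = g"
    using abelian_group.r_neg[OF Hom_group[OF obj]] abelian_monoid.a_assoc[OF abelian_group.axioms(1)[OF Hom_group[OF obj]]]
    by (smt (verit, del_insts) Hom_group abelian_group.a_inv_closed abelian_monoid.r_zero abelian_group.axioms(1) assms hom_module_simps(1-2) in_Hom obj)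
  then show "h \<boxplus> f = h \<boxplus> g \<longleftrightarrow> f = g"
    using assms add_arr_comm[of h f] add_arr_comm[of h g] by simp
qed

lemma diff_arr_ex:
  assumes "f \<in> Hom C A B" "g \<in> Hom C A B"
  obtains h where "h \<in> Hom C A B" "f \<boxplus> h = g"
proof -
  have obj: "A \<in> obj C" "B \<in> obj C" using assms Hom_obj by auto
  interpret G: abelian_group "hom_module C A B" by (rule Hom_group[OF obj])
  show ?thesis
  proof (rule that[of "a_inv (hom_module C A B) f \<boxplus> g"])
    show "a_inv (hom_module C A B) f \<boxplus> g \<in> Hom C A B"
      using G.a_closed[OF G.a_inv_closed[of f], of g] assms by simp
    show "f \<boxplus> (a_inv (hom_module C A B) f \<boxplus> g) = g"
      using G.r_neg2[of f g] assms by simp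
  qed
qed

lemma comp_add [simp]:
  assumes "f \<in> arr C" "f' \<in> arr C" "src C f = src C f'" "tgt C f = tgt C f'" "g \<in> arr C"
  shows "src C g = tgt C f' \<Longrightarrow> g \<cdot> (f \<boxplus> f') = g \<cdot> f \<boxplus> g \<cdot> f'"
    "tgt C g = src C f' \<Longrightarrow> (f \<boxplus> f') \<cdot> g = f \<cdot> g \<boxplus> f' \<cdot> g"
  using comp_add_right[of f "src C f'" "tgt C f'" f' g "tgt C g"]
    comp_add_left[of g "src C g" "src C f'" f "tgt C f'" f'] assms
  by (auto simp: in_Hom)

lemma comp_zero [simp]:
  assumes "g \<in> arr C" "A \<in> obj C"
  shows "src C g = B \<Longrightarrow> g \<cdot> zero_arr C A B = zero_arr C A (tgt C g)"
    "tgt C g = B \<Longrightarrow> zero_arr C B A \<cdot> g = zero_arr C (src C g) A"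
proof -
  assume B: "src C g = B"
  then have o: "B \<in> obj C" using assms by auto
  let ?z = "g \<cdot> zero_arr C A B"
  have "?z \<boxplus> ?z = g \<cdot> (zero_arr C A B \<boxplus> zero_arr C A B)"
    using assms B o by (intro comp_add(1)[symmetric]) simp_all
  also have "\<dots> = ?z \<boxplus> zero_arr C A (tgt C g)" using assms B o by (simp del: comp_add)
  finally show "?z = zero_arr C A (tgt C g)" using add_arr_cancel(2)[of ?z _ ?z] assms B o by (metis comp_arr_simps zero_arr_simps src_obj tgt_obj)
next
  assume B: "tgt C g = B"
  then have o: "B \<in> obj C" using assms by auto
  let ?z = "zero_arr C B A \<cdot> g"
  have "?z \<boxplus> ?z = (zero_arr C B A \<boxplus> zero_arr C B A) \<cdot> g"
    using assms B o by (intro comp_add(2)[symmetric]) simp_all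
  also have "\<dots> = ?z \<boxplus> zero_arr C (src C g) A" using assms B o by (simp del: comp_add)
  finally show "?z = zero_arr C (src C g) A" using add_arr_cancel(2)[of ?z _ ?z] assms B o by (metis comp_arr_simps zero_arr_simps src_obj tgt_obj)
qed

end

section \<open>Isomorphisms and biproducts\<close>

context linear_category begin

lemma isomorphic_iff:
  "isomorphic C A B \<longleftrightarrow> (\<exists>f\<in>Hom C A B. \<exists>g\<in>Hom C B A. g \<cdot> f = id_arr C A \<and> f \<cdot> g = id_arr C B)"
  unfolding isomorphic_def iso_arr_def by (auto simp: in_Hom)

lemma isomorphic_refl: "A \<in> obj C \<Longrightarrow> isomorphic C A A"
  unfolding isomorphic_iff by (rule bexI[of _ "id_arr C A"], rule bexI[of _ "id_arr C A"]) (auto simp: in_Hom)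

lemma isomorphic_sym: "isomorphic C A B \<Longrightarrow> isomorphic C B A"
  unfolding isomorphic_iff by blast

lemma isomorphic_trans:
  assumes "isomorphic C A B" "isomorphic C B D" shows "isomorphic C A D"
proof -
  obtain f g where 1: "f \<in> Hom C A B" "g \<in> Hom C B A" "g \<cdot> f = id_arr C A" "f \<cdot> g = id_arr C B"
    using assms(1) unfolding isomorphic_iff by blast
  obtain f' g' where 2: "f' \<in> Hom C B D" "g' \<in> Hom C D B" "g' \<cdot> f' = id_arr C B" "f' \<cdot> g' = id_arr C D"
    using assms(2) unfolding isomorphic_iff by blast
  have "(g \<cdot> g') \<cdot> (f' \<cdot> f) = id_arr C A" "(f' \<cdot> f) \<cdot> (g \<cdot> g') = id_arr C D"
    using 1 2 collapse[OF 1(3)] collapse[OF 1(4)] collapse[OF 2(3)] collapse[OF 2(4)]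
    by (auto simp: in_Hom)
  moreover have "f' \<cdot> f \<in> Hom C A D" "g \<cdot> g' \<in> Hom C D A" using 1 2 by (auto simp: in_Hom)
  ultimately show ?thesis unfolding isomorphic_iff by blast
qed

lemma isomorphic_obj: "isomorphic C A B \<Longrightarrow> A \<in> obj C \<and> B \<in> obj C"
  unfolding isomorphic_iff using Hom_obj by blast

lemma iso_class_self: "A \<in> obj C \<Longrightarrow> A \<in> iso_class C A"
  by (simp add: iso_class_def isomorphic_refl)

lemma iso_class_eq_iff:
  assumes "A \<in> obj C"
  shows "iso_class C A = iso_class C B \<longleftrightarrow> isomorphic C A B"
  using iso_class_self[OF assms] isomorphic_obj isomorphic_sym isomorphic_trans
  unfolding iso_class_def by blast

lemma iso_class_in_Iso: "A \<in> obj C \<Longrightarrow> iso_class C A \<in> Iso C"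
  by (simp add: Iso_def)

lemma rep_in:
  assumes "X \<in> Iso C" shows "rep X \<in> X"
proof -
  obtain A where "A \<in> obj C" "X = iso_class C A" using assms unfolding Iso_def by auto
  then show ?thesis using someI[of "\<lambda>B. B \<in> X", OF iso_class_self[of A, folded \<open>X = iso_class C A\<close>]]
    unfolding rep_def by simp
qed

lemma Iso_member: "X \<in> Iso C \<Longrightarrow> A \<in> X \<Longrightarrow> A \<in> obj C \<and> iso_class C A = X"
proof -
  assume "X \<in> Iso C" "A \<in> X"
  then obtain B where B: "B \<in> obj C" "X = iso_class C B" "A \<in> obj C" "isomorphic C B A"
    unfolding Iso_def iso_class_def by auto
  then show ?thesis using iso_class_eq_iff[of B A] by simp
qed

lemma rep_Iso:
  assumes "X \<in> Iso C" shows "rep X \<in> obj C" "iso_class C (rep X) = X"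
  using Iso_member[OF assms rep_in[OF assms]] by auto

lemma rep_iso_class: "A \<in> obj C \<Longrightarrow> isomorphic C (rep (iso_class C A)) A"
  using rep_Iso[OF iso_class_in_Iso] iso_class_eq_iff by simp

lemma zero_object_iff: "zero_object C Z \<longleftrightarrow> Z \<in> obj C \<and> id_arr C Z = zero_arr C Z Z"
proof
  assume "zero_object C Z"
  then show "Z \<in> obj C \<and> id_arr C Z = zero_arr C Z Z"
    unfolding zero_object_def by (metis id_in_Hom zero_arr_simps in_Hom)
next
  assume Z: "Z \<in> obj C \<and> id_arr C Z = zero_arr C Z Z"
  have 1: "f = zero_arr C A Z" if "f \<in> Hom C A Z" for f A
    using that Z comp_id_arr(2)[of f Z] comp_zero(2)[of f Z Z] by (auto simp: in_Hom)
  have 2: "f = zero_arr C Z A" if "f \<in> Hom C Z A" for f A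
    using that Z comp_id_arr(1)[of f Z] comp_zero(1)[of f Z Z] by (auto simp: in_Hom)
  show "zero_object C Z" unfolding zero_object_def
    using Z 1 2 by (metis in_Hom zero_arr_simps)
qed

lemma zero_object_arr:
  assumes "zero_object C Z"
  shows "f \<in> Hom C A Z \<Longrightarrow> f = zero_arr C A Z" "f \<in> Hom C Z A \<Longrightarrow> f = zero_arr C Z A"
  using assms unfolding zero_object_def by (metis Hom_obj in_Hom zero_arr_simps)+

lemma zero_object_iso: "zero_object C Z \<Longrightarrow> isomorphic C Z A \<longleftrightarrow> zero_object C A"
proof
  assume Z: "zero_object C Z" "isomorphic C Z A"
  then obtain f g where 1: "f \<in> Hom C Z A" "g \<in> Hom C A Z" "g \<cdot> f = id_arr C Z" "f \<cdot> g = id_arr C A"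
    unfolding isomorphic_iff by blast
  moreover have "f \<cdot> g = zero_arr C A A"
    using 1 zero_object_arr(2)[OF Z(1) 1(1)] Hom_obj[OF 1(1)] comp_zero(2)[of g A Z] by (auto simp: in_Hom)
  ultimately show "zero_object C A" using Hom_obj zero_object_iff by metis
next
  assume Z: "zero_object C Z" "zero_object C A"
  then have o: "Z \<in> obj C" "A \<in> obj C" and i: "id_arr C Z = zero_arr C Z Z" "id_arr C A = zero_arr C A A"
    unfolding zero_object_iff by auto
  then have "zero_arr C Z A \<in> Hom C Z A" "zero_arr C A Z \<in> Hom C A Z" 
    "zero_arr C A Z \<cdot> zero_arr C Z A = id_arr C Z" "zero_arr C Z A \<cdot> zero_arr C A Z = id_arr C A"
    by (auto simp: in_Hom)
  then show "isomorphic C Z A" unfolding isomorphic_iff by blast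
qed

lemma zero_objects_class: "zero_object C Z \<Longrightarrow> iso_class C Z = {Z. zero_object C Z}"
  using zero_object_iso unfolding iso_class_def by (auto simp: zero_object_def)

lemma biproductD:
  assumes "biproduct C M A B i1 i2 p1 p2"
  shows "i1 \<in> arr C" "i2 \<in> arr C" "p1 \<in> arr C" "p2 \<in> arr C"
    "src C i1 = A" "tgt C i1 = M" "src C i2 = B" "tgt C i2 = M"
    "src C p1 = M" "tgt C p1 = A" "src C p2 = M" "tgt C p2 = B"
    "p1 \<cdot> i1 = id_arr C A" "p2 \<cdot> i2 = id_arr C B" "p2 \<cdot> i1 = zero_arr C A B" "p1 \<cdot> i2 = zero_arr C B A"
    "i1 \<cdot> p1 \<boxplus> i2 \<cdot> p2 = id_arr C M" "M \<in> obj C" "A \<in> obj C" "B \<in> obj C"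
  using assms unfolding biproduct_def by (auto simp: in_Hom)

lemma biproduct_direct_sum: "biproduct C M A B i1 i2 p1 p2 \<Longrightarrow> direct_sum C M A B"
  unfolding direct_sum_def by (metis biproductD(18-20))

lemma biproduct_inj:
  assumes b: "biproduct C M A B i1 i2 p1 p2" and x: "x \<in> arr C" "tgt C x = A" and y: "y \<in> arr C" "tgt C y = B" "src C x = src C y"
  shows "p1 \<cdot> (i1 \<cdot> x \<boxplus> i2 \<cdot> y) = x" "p2 \<cdot> (i1 \<cdot> x \<boxplus> i2 \<cdot> y) = y"
proof -
  note B = biproductD[OF b]
  note c = collapse[OF B(13)] collapse[OF B(14)] collapse[OF B(15)] collapse[OF B(16)]
  show "p1 \<cdot> (i1 \<cdot> x \<boxplus> i2 \<cdot> y) = x" using B x y by (simp add: c)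
  show "p2 \<cdot> (i1 \<cdot> x \<boxplus> i2 \<cdot> y) = y" using B x y by (simp add: c)
qed

lemma biproduct_decompose:
  assumes b: "biproduct C M A B i1 i2 p1 p2" and g: "g \<in> arr C"
  shows "tgt C g = M \<Longrightarrow> i1 \<cdot> (p1 \<cdot> g) \<boxplus> i2 \<cdot> (p2 \<cdot> g) = g"
    "src C g = M \<Longrightarrow> (g \<cdot> i1) \<cdot> p1 \<boxplus> (g \<cdot> i2) \<cdot> p2 = g"
proof -
  note B = biproductD[OF b]
  { assume t: "tgt C g = M"
    have "(i1 \<cdot> p1 \<boxplus> i2 \<cdot> p2) \<cdot> g = i1 \<cdot> (p1 \<cdot> g) \<boxplus> i2 \<cdot> (p2 \<cdot> g)" using B(1-12,18-20) g t by simp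
    then show "i1 \<cdot> (p1 \<cdot> g) \<boxplus> i2 \<cdot> (p2 \<cdot> g) = g" using B g t by simp }
  { assume t: "src C g = M"
    have "g \<cdot> (i1 \<cdot> p1 \<boxplus> i2 \<cdot> p2) = (g \<cdot> i1) \<cdot> p1 \<boxplus> (g \<cdot> i2) \<cdot> p2" using B(1-12,18-20) g t by simp
    then show "(g \<cdot> i1) \<cdot> p1 \<boxplus> (g \<cdot> i2) \<cdot> p2 = g" using B g t by simp }
qed

lemma biproduct_bij:
  assumes b: "biproduct C M A B i1 i2 p1 p2"
  shows "bij_betw (\<lambda>g. (p1 \<cdot> g, p2 \<cdot> g)) (Hom C U M) (Hom C U A \<times> Hom C U B)"
proof (rule bij_betw_byWitness[where f' = "\<lambda>(x, y). i1 \<cdot> x \<boxplus> i2 \<cdot> y"])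
  note B = biproductD[OF b]
  show "\<forall>a\<in>Hom C U M. (case (p1 \<cdot> a, p2 \<cdot> a) of (x, y) \<Rightarrow> i1 \<cdot> x \<boxplus> i2 \<cdot> y) = a"
    using biproduct_decompose(1)[OF b] by (auto simp: in_Hom)
  show "\<forall>a'\<in>Hom C U A \<times> Hom C U B.
       (\<lambda>g. (p1 \<cdot> g, p2 \<cdot> g)) (case a' of (x, y) \<Rightarrow> i1 \<cdot> x \<boxplus> i2 \<cdot> y) = a'"
    using biproduct_inj[OF b] B(1-12) by (auto simp: in_Hom simp del: comp_add)
  show "(\<lambda>g. (p1 \<cdot> g, p2 \<cdot> g)) ` Hom C U M \<subseteq> Hom C U A \<times> Hom C U B"
    using B(1-12) by (auto simp: in_Hom)
  show "(\<lambda>(x, y). i1 \<cdot> x \<boxplus> i2 \<cdot> y) ` (Hom C U A \<times> Hom C U B) \<subseteq> Hom C U M"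
    using B(1-12) by (auto simp: in_Hom)
qed

definition retract :: "'o \<Rightarrow> 'o \<Rightarrow> 'm \<Rightarrow> 'm \<Rightarrow> bool" where
  "retract A M s r \<longleftrightarrow> s \<in> Hom C A M \<and> r \<in> Hom C M A \<and> r \<cdot> s = id_arr C A"

text \<open>
  The complement of a retract is obtained by splitting the idempotent \<open>id - s r\<close>.
\<close>

lemma retract_biproduct:
  assumes "idempotent_complete C" and "retract A M s r"
  obtains B i2 p2 where "biproduct C M A B s i2 r p2"
proof -
  have H: "s \<in> arr C" "r \<in> arr C" "src C s = A" "tgt C s = M" "src C r = M" "tgt C r = A"
    and rs: "r \<cdot> s = id_arr C A" using assms(2) by (auto simp: retract_def in_Hom)
  have obj: "A \<in> obj C" "M \<in> obj C" using H by auto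
  note rs' = collapse[OF rs]
  obtain e where e: "e \<in> Hom C M M" "s \<cdot> r \<boxplus> e = id_arr C M"
    using diff_arr_ex[of "s \<cdot> r" M M "id_arr C M"] H obj by (auto simp: in_Hom)
  have E: "e \<in> arr C" "src C e = M" "tgt C e = M" using e by (auto simp: in_Hom)
  have re: "r \<cdot> e = zero_arr C M A"
  proof -
    have "r \<cdot> (s \<cdot> r \<boxplus> e) = r" using e H obj by simp
    then have "r \<boxplus> r \<cdot> e = r" using H E obj by (simp add: rs')
    then have "r \<boxplus> r \<cdot> e = r \<boxplus> zero_arr C M A" using H E obj by simp
    then show ?thesis using add_arr_cancel(2)[of "r \<cdot> e" "zero_arr C M A" r] H E obj
      by (metis comp_arr_simps zero_arr_simps)
  qed
  have es: "e \<cdot> s = zero_arr C A M"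
  proof -
    have "(s \<cdot> r \<boxplus> e) \<cdot> s = s" using e H obj by simp
    then have "s \<boxplus> e \<cdot> s = s" using H E obj by (simp add: rs)
    then have "s \<boxplus> e \<cdot> s = s \<boxplus> zero_arr C A M" using H E obj by simp
    then show ?thesis using add_arr_cancel(2)[of "e \<cdot> s" "zero_arr C A M" s] H E obj
      by (metis comp_arr_simps zero_arr_simps)
  qed
  have ee: "e \<cdot> e = e"
  proof -
    have "e \<cdot> (s \<cdot> r \<boxplus> e) = e" using e E obj by simp
    moreover have "e \<cdot> (s \<cdot> r) = zero_arr C M M" using collapse[OF es] H E obj by simp
    ultimately show ?thesis using H E obj by simp
  qed
  obtain B r' s' where B: "B \<in> obj C" "r' \<in> Hom C M B" "s' \<in> Hom C B M" "s' \<cdot> r' = e" "r' \<cdot> s' = id_arr C B"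
    using assms(1) e(1) ee obj unfolding idempotent_complete_def by metis
  have B': "r' \<in> arr C" "s' \<in> arr C" "src C r' = M" "tgt C r' = B" "src C s' = B" "tgt C s' = M"
    using B by (auto simp: in_Hom)
  have es': "e \<cdot> s' = s'" "r' \<cdot> e = r'"
    using collapse[OF B(5)] B B' unfolding B(4)[symmetric] by simp_all
  have "r' \<cdot> s = (r' \<cdot> e) \<cdot> s" using es' by simp
  also have "\<dots> = zero_arr C A B" using es B B' E H obj by (simp del: es')
  finally have 1: "r' \<cdot> s = zero_arr C A B" .
  have "r \<cdot> s' = r \<cdot> (e \<cdot> s')" using es' by simp
  also have "\<dots> = zero_arr C B A" using collapse[OF re] B B' E H obj by (simp del: es')
  finally have 2: "r \<cdot> s' = zero_arr C B A" .
  show ?thesis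
    by (rule that[of B s' r']) (use 1 2 H B e rs in \<open>auto simp: biproduct_def in_Hom\<close>)
qed

lemma retract_trans:
  assumes "retract A M s r" "retract M N s' r'" shows "retract A N (s' \<cdot> s) (r \<cdot> r')"
proof -
  have "r' \<cdot> s' = id_arr C M" using assms unfolding retract_def by auto
  from collapse[OF this] show ?thesis
    using assms unfolding retract_def by (auto simp: in_Hom)
qed

lemma biproduct_retract:
  assumes "biproduct C M A B i1 i2 p1 p2"
  shows "retract A M i1 p1" "retract B M i2 p2"
  using biproductD[OF assms] by (auto simp: retract_def in_Hom)

lemma retract_obj: "retract A M s r \<Longrightarrow> A \<in> obj C \<and> M \<in> obj C"
  unfolding retract_def using Hom_obj by blast

end

section \<open>Finite Hom sets and local endomorphism rings\<close>

context linear_category begin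

text \<open>
  Over a finite field, adjoining one generator \<open>x\<close> to a finite submodule \<open>N\<close> gives the finite
  submodule of all \<open>c x + n\<close>.
\<close>

lemma finite_submodule_ex:
  assumes "finite (carrier K)" and o: "A \<in> obj C" "B \<in> obj C"
    and "finite S" "S \<subseteq> Hom C A B"
  shows "\<exists>N. finite N \<and> S \<subseteq> N \<and> submodule N K (hom_module C A B)"
  using assms(4,5)
proof (induction S)
  interpret M: module K "hom_module C A B" by (rule hom_module[OF o])
  case empty
  have "submodule {zero_arr C A B} K (hom_module C A B)"
  proof (rule M.submoduleI)
    show "\<And>a x. a \<in> carrier K \<Longrightarrow> x \<in> {zero_arr C A B} \<Longrightarrow> a \<odot>\<^bsub>hom_module C A B\<^esub> x \<in> {zero_arr C A B}"
      using M.smult_r_null by simp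
    show "\<And>a. a \<in> {zero_arr C A B} \<Longrightarrow> \<ominus>\<^bsub>hom_module C A B\<^esub> a \<in> {zero_arr C A B}"
      using M.l_zero[OF M.a_inv_closed[OF M.zero_closed]] M.r_neg[OF M.zero_closed] by simp
  qed (use o in \<open>auto simp: in_Hom\<close>)
  then show ?case by blast
next
  interpret M: module K "hom_module C A B" by (rule hom_module[OF o])
  case (insert x S)
  then obtain N where N: "finite N" "S \<subseteq> N" "submodule N K (hom_module C A B)" by auto
  note sm = M.submoduleE[OF N(3), simplified]
  have x: "x \<in> Hom C A B" using insert by simp
  have NH: "N \<subseteq> Hom C A B" by (rule sm(1))
  have z: "zero_arr C A B \<in> N"
  proof -
    obtain a where "a \<in> N" using sm(2) by blast
    then have "\<zero>\<^bsub>K\<^esub> \<odot>\<^bsub>hom_module C A B\<^esub> a \<in> N" using sm(4)[of "\<zero>\<^bsub>K\<^esub>" a] by simp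
    then show ?thesis using M.smult_l_null[of a] \<open>a \<in> N\<close> NH by auto
  qed
  let ?N = "(\<lambda>(c, n). scale_arr C c x \<boxplus> n) ` (carrier K \<times> N)"
  have scl: "\<And>c y. c \<in> carrier K \<Longrightarrow> y \<in> Hom C A B \<Longrightarrow> scale_arr C c y \<in> Hom C A B"
    using M.smult_closed by simp
  have "submodule ?N K (hom_module C A B)"
  proof (rule M.submoduleI)
    show "?N \<subseteq> carrier (hom_module C A B)"
      using M.a_closed x NH scl by (auto simp: subset_iff)
    show "\<zero>\<^bsub>hom_module C A B\<^esub> \<in> ?N"
    proof -
      have "zero_arr C A B = scale_arr C \<zero>\<^bsub>K\<^esub> x \<boxplus> zero_arr C A B"
        using M.smult_l_null[of x] x o by simp
      then show ?thesis using z by force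
    qed
    show "\<ominus>\<^bsub>hom_module C A B\<^esub> a \<in> ?N" if aN: "a \<in> ?N" for a
    proof -
      obtain c n where cn: "c \<in> carrier K" "n \<in> N" "a = scale_arr C c x \<boxplus> n" using aN by auto
      have nH: "n \<in> Hom C A B" using cn NH by auto
      have "\<ominus>\<^bsub>hom_module C A B\<^esub> a = scale_arr C (\<ominus>\<^bsub>K\<^esub> c) x \<boxplus> \<ominus>\<^bsub>hom_module C A B\<^esub> n"
        using M.minus_add[of "scale_arr C c x" n] M.smult_l_minus[of c x] cn x nH scl by simp
      moreover have "\<ominus>\<^bsub>hom_module C A B\<^esub> n \<in> N" using sm(3) cn by blast
      ultimately show ?thesis using cn by force
    qed
    show "a \<oplus>\<^bsub>hom_module C A B\<^esub> b \<in> ?N" if aN: "a \<in> ?N" and bN: "b \<in> ?N" for a b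
    proof -
      obtain c n where cn: "c \<in> carrier K" "n \<in> N" "a = scale_arr C c x \<boxplus> n" using aN by auto
      obtain d m where dm: "d \<in> carrier K" "m \<in> N" "b = scale_arr C d x \<boxplus> m" using bN by auto
      have nH: "n \<in> Hom C A B" "m \<in> Hom C A B" using cn dm NH by auto
      have "a \<boxplus> b = scale_arr C (c \<oplus>\<^bsub>K\<^esub> d) x \<boxplus> (n \<boxplus> m)"
        using M.smult_l_distr[of c d x] cn dm x nH scl M.a_closed[simplified] by (simp add: M.a_assoc[simplified] M.a_lcomm[simplified])
      moreover have "n \<boxplus> m \<in> N" using sm(5) cn dm by blast
      ultimately show ?thesis using cn dm by force
    qed
    show "c \<odot>\<^bsub>hom_module C A B\<^esub> a \<in> ?N" if that: "c \<in> carrier K" and aN: "a \<in> ?N" for c a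
    proof -
      obtain d n where cn: "d \<in> carrier K" "n \<in> N" "a = scale_arr C d x \<boxplus> n" using aN by auto
      have nH: "n \<in> Hom C A B" using cn NH by auto
      have "scale_arr C c a = scale_arr C (c \<otimes>\<^bsub>K\<^esub> d) x \<boxplus> scale_arr C c n"
        using M.smult_assoc1[of c d x] M.smult_r_distr[of c "scale_arr C d x" n] cn x nH scl that by simp
      moreover have "scale_arr C c n \<in> N" using sm(4) cn that by blast
      ultimately show ?thesis using cn that by force
    qed
  qed
  moreover have "finite ?N" using N(1) assms(1) by simp
  moreover have "insert x S \<subseteq> ?N"
  proof -
    have "x = scale_arr C \<one>\<^bsub>K\<^esub> x \<boxplus> zero_arr C A B"
      using M.smult_one[of x] x o by (simp add: in_Hom)
    then have "x \<in> ?N" using z M.one_closed by force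
    moreover have "s \<in> ?N" if "s \<in> S" for s
    proof -
      have "s \<in> N" using that N by auto
      then have "s \<in> Hom C A B" using NH by auto
      then have "s = scale_arr C \<zero>\<^bsub>K\<^esub> x \<boxplus> s" using M.smult_l_null[of x] x by (simp add: in_Hom)
      then show ?thesis using \<open>s \<in> N\<close> M.zero_closed by force
    qed
    ultimately show ?thesis by auto
  qed
  ultimately show ?case by blast
qed

lemma finite_Hom:
  assumes "finite (carrier K)" "hom_finite K C"
  shows "finite (Hom C A B)"
proof (cases "A \<in> obj C \<and> B \<in> obj C")
  case True
  then obtain S where S: "finite S" "S \<subseteq> Hom C A B"
    "\<forall>N. submodule N K (hom_module C A B) \<and> S \<subseteq> N \<longrightarrow> N = Hom C A B"
    using assms(2) unfolding hom_finite_def by meson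
  then show ?thesis using finite_submodule_ex[OF assms(1)] True by metis
next
  case False
  then have "Hom C A B = {}" using Hom_obj by auto
  then show ?thesis by simp
qed

end

locale finite_linear_category = linear_category K C
  for K :: "('k, 'x) ring_scheme" and C :: "('o, 'm, 'k) lincat" +
  assumes fin_Hom: "finite (Hom C A B)"
    and additive: "additive_category C"
    and idem: "idempotent_complete C"
begin

primrec arr_pow :: "'o \<Rightarrow> 'm \<Rightarrow> nat \<Rightarrow> 'm" where
  "arr_pow U g 0 = id_arr C U"
| "arr_pow U g (Suc n) = g \<cdot> arr_pow U g n"

lemma arr_pow_Hom [simp]:
  assumes "g \<in> arr C" "src C g = U" "tgt C g = U"
  shows "arr_pow U g n \<in> arr C" "src C (arr_pow U g n) = U" "tgt C (arr_pow U g n) = U"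
proof -
  have "U \<in> obj C" using assms by auto
  then have "arr_pow U g n \<in> arr C \<and> src C (arr_pow U g n) = U \<and> tgt C (arr_pow U g n) = U"
    using assms by (induction n) auto
  then show "arr_pow U g n \<in> arr C" "src C (arr_pow U g n) = U" "tgt C (arr_pow U g n) = U" by auto
qed

lemma arr_pow_add:
  assumes "g \<in> arr C" "src C g = U" "tgt C g = U"
  shows "arr_pow U g (m + n) = arr_pow U g m \<cdot> arr_pow U g n"
  using assms by (induction m) auto

lemma arr_pow_Suc2:
  assumes "g \<in> arr C" "src C g = U" "tgt C g = U"
  shows "arr_pow U g (Suc n) = arr_pow U g n \<cdot> g"
proof -
  have "U \<in> obj C" using assms by auto
  then show ?thesis using arr_pow_add[OF assms, of n 1] assms by simp
qed

text \<open>
  The powers of an element of a finite monoid are eventually periodic, and a positive multiple of the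
  period that lies in the periodic range is the exponent of an idempotent.
\<close>

lemma arr_pow_idempotent:
  assumes g: "g \<in> arr C" "src C g = U" "tgt C g = U"
  obtains n where "n > 0" "arr_pow U g n \<cdot> arr_pow U g n = arr_pow U g n"
proof -
  have "range (arr_pow U g) \<subseteq> Hom C U U" using g by (auto simp: in_Hom)
  then have "\<not> inj (arr_pow U g)" using fin_Hom finite_subset finite_imageD infinite_UNIV_nat by metis
  then obtain a b where ab: "a < b" "arr_pow U g a = arr_pow U g b"
    unfolding inj_def by (metis linorder_neqE_nat)
  define d where "d = b - a"
  have d: "d > 0" "b = d + a" using ab by (auto simp: d_def)
  have step: "arr_pow U g (m + d) = arr_pow U g m" if "m \<ge> a" for m
    using arr_pow_add[OF g, of "m - a" a] arr_pow_add[OF g, of "m - a" b] ab that d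
    by (metis add.assoc add.commute le_add_diff_inverse2)
  have steps: "arr_pow U g (m + k * d) = arr_pow U g m" if "m \<ge> a" for m k
  proof (induction k)
    case (Suc k)
    have "arr_pow U g (m + Suc k * d) = arr_pow U g (m + k * d + d)" by (simp add: algebra_simps)
    also have "\<dots> = arr_pow U g (m + k * d)" using step[of "m + k * d"] that by simp
    finally show ?case using Suc by simp
  qed simp
  (* a multiple of the period d that is at least a, and positive even if a = 0 *)
  let ?n = "(a + 1) * d"
  have "?n \<ge> a" using d by (metis Suc_eq_plus1 Suc_leI le_add1 le_trans mult_le_mono2 nat_mult_1_right One_nat_def)
  then have "arr_pow U g (?n + ?n) = arr_pow U g ?n" using steps by blast
  then show ?thesis using that[of ?n] arr_pow_add[OF g, of ?n ?n] d by simp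
qed

text \<open>
  The complement of the retract must vanish if the retract does not.
\<close>

lemma retract_indecomposable:
  assumes "indecomposable C U" "retract A U s r"
  shows "zero_object C A \<or> s \<cdot> r = id_arr C U"
proof -
  obtain B i2 p2 where b: "biproduct C U A B s i2 r p2" using retract_biproduct[OF idem assms(2)] .
  then have "zero_object C A \<or> zero_object C B"
    using assms(1) biproduct_direct_sum unfolding indecomposable_def by blast
  moreover have "s \<cdot> r = id_arr C U" if "zero_object C B"
  proof -
    note bb = biproductD[OF b]
    have "i2 = zero_arr C B U" using zero_object_arr(2)[OF that, of i2 U] bb by (simp add: in_Hom)
    then show ?thesis using bb(17) bb(1-12,18-20) by simp
  qed
  ultimately show ?thesis by blast
qed

text \<open>
  Fitting's lemma: some power of \<open>g\<close> is idempotent, and a retract of \<open>U\<close> is zero or all of \<open>U\<close>, so this power is zero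
  or the identity.
\<close>

lemma fitting:
  assumes U: "indecomposable C U" and g: "g \<in> Hom C U U"
  shows "iso_arr C g \<or> (\<exists>n. arr_pow U g n = zero_arr C U U)"
proof -
  have g': "g \<in> arr C" "src C g = U" "tgt C g = U" using g by (auto simp: in_Hom)
  have Uo: "U \<in> obj C" using U by (auto simp: indecomposable_def)
  obtain n where n: "n > 0" "arr_pow U g n \<cdot> arr_pow U g n = arr_pow U g n"
    using arr_pow_idempotent[OF g'] .
  obtain A r s where A: "r \<in> Hom C U A" "s \<in> Hom C A U" "s \<cdot> r = arr_pow U g n" "r \<cdot> s = id_arr C A"
    using idem n(2) Uo g' unfolding idempotent_complete_def
    by (metis arr_pow_Hom in_Hom)
  then have "retract A U s r" by (auto simp: retract_def)
  from retract_indecomposable[OF U this] show ?thesis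
  proof
    assume "zero_object C A"
    then have "s = zero_arr C A U" using zero_object_arr A by auto
    then show ?thesis using A Hom_obj[OF A(1)] by (auto simp: in_Hom)
  next
    assume "s \<cdot> r = id_arr C U"
    then have e: "arr_pow U g n = id_arr C U" using A by simp
    obtain m where m: "n = Suc m" using n(1) by (cases n) auto
    have "g \<cdot> arr_pow U g m = id_arr C U" "arr_pow U g m \<cdot> g = id_arr C U"
      using e m arr_pow_Suc2[OF g', of m] by simp_all
    then have "iso_arr C g" unfolding iso_arr_def using g' by (auto simp: in_Hom)
    then show ?thesis ..
  qed
qed

lemma indecomposable_obj: "indecomposable C U \<Longrightarrow> U \<in> obj C"
  and indecomposable_id: "indecomposable C U \<Longrightarrow> id_arr C U \<noteq> zero_arr C U U"
  by (auto simp: indecomposable_def zero_object_iff)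

lemma left_invertible_iso:
  assumes U: "indecomposable C U" and g: "y \<in> Hom C U U" "s \<in> Hom C U U" and sy: "s \<cdot> y = id_arr C U"
  shows "iso_arr C y"
proof (rule ccontr)
  assume "\<not> iso_arr C y"
  then obtain n where n: "arr_pow U y n = zero_arr C U U" using fitting[OF U g(1)] by auto
  have H: "y \<in> arr C" "src C y = U" "tgt C y = U" "s \<in> arr C" "src C s = U" "tgt C s = U"
    using g by (auto simp: in_Hom)
  (* all powers of y would be left invertible *)
  have "\<exists>t\<in>Hom C U U. t \<cdot> arr_pow U y m = id_arr C U" for m
  proof (induction m)
    case 0
    show ?case using indecomposable_obj[OF U] by (intro bexI[of _ "id_arr C U"]) (auto simp: in_Hom)
  next
    case (Suc m)
    then obtain t where t: "t \<in> arr C" "src C t = U" "tgt C t = U" "t \<cdot> arr_pow U y m = id_arr C U"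
      by (auto simp: in_Hom)
    have "(t \<cdot> s) \<cdot> arr_pow U y (Suc m) = id_arr C U"
      using H t collapse[OF sy] by simp
    then show ?case using H t by (intro bexI[of _ "t \<cdot> s"]) (auto simp: in_Hom)
  qed
  then obtain t where "t \<in> Hom C U U" "t \<cdot> zero_arr C U U = id_arr C U" using n by metis
  then show False using indecomposable_id[OF U] indecomposable_obj[OF U] by (auto simp: in_Hom)
qed

lemma iso_arr_inverse:
  assumes "iso_arr C f" "f \<in> Hom C A B"
  obtains g where "g \<in> Hom C B A" "g \<cdot> f = id_arr C A" "f \<cdot> g = id_arr C B"
  using assms unfolding iso_arr_def by (auto simp: in_Hom)

text \<open>
  The endomorphism ring of an indecomposable is local.  After normalising the sum to the identity, if
  the first summand is nilpotent, then a geometric series inverts the second one from the left.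
\<close>

lemma local_endo:
  assumes U: "indecomposable C U" and xy: "x \<in> Hom C U U" "y \<in> Hom C U U" "iso_arr C (x \<boxplus> y)"
  shows "iso_arr C x \<or> iso_arr C y"
proof (rule ccontr)
  assume neg: "\<not> ?thesis"
  have H: "x \<in> arr C" "src C x = U" "tgt C x = U" "y \<in> arr C" "src C y = U" "tgt C y = U"
    using xy by (auto simp: in_Hom)
  have Uo: "U \<in> obj C" using indecomposable_obj[OF U] .
  obtain c where c: "c \<in> Hom C U U" "c \<cdot> (x \<boxplus> y) = id_arr C U"
    using iso_arr_inverse[OF xy(3), of U U] H by (auto simp: in_Hom)
  have c': "c \<in> arr C" "src C c = U" "tgt C c = U" using c by (auto simp: in_Hom)
  have sum: "c \<cdot> x \<boxplus> c \<cdot> y = id_arr C U" using c(2) H c' by simp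
  have "\<not> iso_arr C (c \<cdot> x)"
  proof
    assume "iso_arr C (c \<cdot> x)"
    then obtain d where d: "d \<in> Hom C U U" "d \<cdot> (c \<cdot> x) = id_arr C U"
      using iso_arr_inverse[of "c \<cdot> x" U U] H c' by (auto simp: in_Hom)
    then have "(d \<cdot> c) \<cdot> x = id_arr C U" using H c' by (auto simp: in_Hom)
    then have "iso_arr C x" using left_invertible_iso[OF U xy(1), of "d \<cdot> c"] d c' by (auto simp: in_Hom)
    then show False using neg by simp
  qed
  then obtain n where n: "arr_pow U (c \<cdot> x) n = zero_arr C U U"
    using fitting[OF U, of "c \<cdot> x"] H c' by (auto simp: in_Hom)
  let ?x = "c \<cdot> x" and ?y = "c \<cdot> y"
  have H2: "?x \<in> arr C" "src C ?x = U" "tgt C ?x = U" "?y \<in> arr C" "src C ?y = U" "tgt C ?y = U"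
    using H c' by auto
  (* s is the partial geometric series 1 + x + ... + x^(m-1), where x and y are normalised to x + y = 1 *)
  have "\<exists>s\<in>Hom C U U. s \<cdot> ?y \<boxplus> arr_pow U ?x m = id_arr C U" for m
  proof (induction m)
    case 0
    show ?case using Uo H2 by (intro bexI[of _ "zero_arr C U U"]) (auto simp: in_Hom simp del: comp_arr_simps)
  next
    case (Suc m)
    then obtain s where s: "s \<in> arr C" "src C s = U" "tgt C s = U" "s \<cdot> ?y \<boxplus> arr_pow U ?x m = id_arr C U"
      by (auto simp: in_Hom)
    let ?p = "arr_pow U ?x m"
    have p: "?p \<in> arr C" "src C ?p = U" "tgt C ?p = U" by (rule arr_pow_Hom[OF H2(1-3)])+
    have "(s \<boxplus> ?p) \<cdot> ?y \<boxplus> arr_pow U ?x (Suc m) = (s \<cdot> ?y \<boxplus> ?p \<cdot> ?y) \<boxplus> ?p \<cdot> ?x"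
      using comp_add(2)[of s ?p ?y] s p H2 arr_pow_Suc2[OF H2(1-3)] by metis
    also have "\<dots> = s \<cdot> ?y \<boxplus> (?p \<cdot> ?y \<boxplus> ?p \<cdot> ?x)"
      using s p H2 by (intro add_arr_assoc) (simp_all only: comp_arr_simps)
    also have "?p \<cdot> ?y \<boxplus> ?p \<cdot> ?x = ?p \<cdot> (?x \<boxplus> ?y)"
      using comp_add(1)[of ?x ?y ?p] add_arr_comm[of "?p \<cdot> ?y" "?p \<cdot> ?x"] p H2 by (simp only: comp_arr_simps)
    also have "\<dots> = ?p" using sum p by simp
    finally show ?case using s p by (intro bexI[of _ "s \<boxplus> ?p"]) (auto simp: in_Hom)
  qed
  from this[of n] obtain s where s: "s \<in> Hom C U U" "s \<cdot> ?y \<boxplus> zero_arr C U U = id_arr C U" unfolding n by blast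
  then have "(s \<cdot> c) \<cdot> y = id_arr C U" using H c' by (auto simp: in_Hom)
  then have "iso_arr C y" using left_invertible_iso[OF U xy(2), of "s \<cdot> c"] s c' by (auto simp: in_Hom)
  then show False using neg by simp
qed

end

section \<open>Krull--Schmidt multiplicities by counting\<close>

context finite_linear_category begin

lemma card_Hom_pos:
  assumes "A \<in> obj C" "B \<in> obj C" shows "card (Hom C A B) > 0"
proof -
  have "zero_arr C A B \<in> Hom C A B" using assms by (simp add: in_Hom)
  then show ?thesis using fin_Hom[of A B] by (auto simp: card_gt_0_iff)
qed

lemma card_ge_2I: "finite S \<Longrightarrow> x \<in> S \<Longrightarrow> y \<in> S \<Longrightarrow> x \<noteq> y \<Longrightarrow> card S \<ge> 2"
  using card_mono[of S "{x, y}"] by simp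

text \<open>
  Counting replaces dimensions; logarithms turn these products into sums.
\<close>

lemma card_Hom_biproduct:
  assumes "direct_sum C M A B"
  shows "card (Hom C U M) = card (Hom C U A) * card (Hom C U B)"
proof -
  obtain i1 i2 p1 p2 where "biproduct C M A B i1 i2 p1 p2"
    using assms unfolding direct_sum_def by blast
  from bij_betw_same_card[OF biproduct_bij[OF this]] show ?thesis by (simp add: card_cartesian_product)
qed

definition log_card :: "'o \<Rightarrow> 'o \<Rightarrow> real" where
  "log_card U Y = ln (real (card (Hom C U Y)))"

lemma log_card_nonneg: "U \<in> obj C \<Longrightarrow> Y \<in> obj C \<Longrightarrow> log_card U Y \<ge> 0"
  using card_Hom_pos[of U Y] unfolding log_card_def by simp

lemma log_card_direct_sum:
  assumes "direct_sum C M A B" "U \<in> obj C"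
  shows "log_card U M = log_card U A + log_card U B"
  using card_Hom_biproduct[OF assms(1)] card_Hom_pos[of U A] card_Hom_pos[of U B] assms
  unfolding log_card_def direct_sum_def by (simp add: ln_mult)

definition radical :: "'o \<Rightarrow> 'o \<Rightarrow> 'm set" where
  "radical U Y = {g \<in> Hom C U Y. \<forall>h\<in>Hom C Y U. \<not> iso_arr C (h \<cdot> g)}"

text \<open>
  Closure of the radical under sums is locality of the endomorphism ring of \<open>U\<close>.
\<close>

lemma radical_biproduct_iff:
  assumes U: "indecomposable C U" and b: "biproduct C M A B i1 i2 p1 p2" and g: "g \<in> Hom C U M"
  shows "g \<in> radical U M \<longleftrightarrow> p1 \<cdot> g \<in> radical U A \<and> p2 \<cdot> g \<in> radical U B"
proof
  note B = biproductD[OF b]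
  assume r: "g \<in> radical U M"
  have "\<not> iso_arr C (h \<cdot> (p1 \<cdot> g))" if "h \<in> Hom C A U" for h
  proof -
    have "h \<cdot> p1 \<in> Hom C M U" using that B by (auto simp: in_Hom)
    then have "\<not> iso_arr C ((h \<cdot> p1) \<cdot> g)" using r unfolding radical_def by blast
    then show ?thesis using that B g by (simp add: in_Hom)
  qed
  moreover have "\<not> iso_arr C (h \<cdot> (p2 \<cdot> g))" if "h \<in> Hom C B U" for h
  proof -
    have "h \<cdot> p2 \<in> Hom C M U" using that B by (auto simp: in_Hom)
    then have "\<not> iso_arr C ((h \<cdot> p2) \<cdot> g)" using r unfolding radical_def by blast
    then show ?thesis using that B g by (simp add: in_Hom)
  qed
  ultimately show "p1 \<cdot> g \<in> radical U A \<and> p2 \<cdot> g \<in> radical U B"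
    unfolding radical_def using B g by (auto simp: in_Hom)
next
  note B = biproductD[OF b]
  assume r: "p1 \<cdot> g \<in> radical U A \<and> p2 \<cdot> g \<in> radical U B"
  have "\<not> iso_arr C (h \<cdot> g)" if h: "h \<in> Hom C M U" for h
  proof
    assume iso: "iso_arr C (h \<cdot> g)"
    have H: "h \<in> arr C" "src C h = M" "tgt C h = U" "g \<in> arr C" "src C g = U" "tgt C g = M"
      using h g by (auto simp: in_Hom)
    let ?x = "(h \<cdot> i1) \<cdot> (p1 \<cdot> g)" and ?y = "(h \<cdot> i2) \<cdot> (p2 \<cdot> g)"
    have "h \<cdot> g = h \<cdot> (i1 \<cdot> (p1 \<cdot> g) \<boxplus> i2 \<cdot> (p2 \<cdot> g))"
      using biproduct_decompose(1)[OF b H(4,6)] by simp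
    also have "\<dots> = ?x \<boxplus> ?y" using H B(1-12) by simp
    finally have "iso_arr C (?x \<boxplus> ?y)" using iso by simp
    then have "iso_arr C ?x \<or> iso_arr C ?y"
      using local_endo[OF U] H B(1-12) by (simp add: in_Hom)
    moreover have "h \<cdot> i1 \<in> Hom C A U" "h \<cdot> i2 \<in> Hom C B U" using H B by (auto simp: in_Hom)
    ultimately show False using r unfolding radical_def by blast
  qed
  then show "g \<in> radical U M" using g unfolding radical_def by auto
qed

lemma card_radical_biproduct:
  assumes U: "indecomposable C U" and "direct_sum C M A B"
  shows "card (radical U M) = card (radical U A) * card (radical U B)"
proof -
  obtain i1 i2 p1 p2 where b: "biproduct C M A B i1 i2 p1 p2"
    using assms unfolding direct_sum_def by blast
  let ?f = "\<lambda>g. (p1 \<cdot> g, p2 \<cdot> g)"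
  note bij = biproduct_bij[OF b, of U]
  have "?f ` radical U M = radical U A \<times> radical U B"
  proof (intro equalityI subsetI)
    fix z assume "z \<in> ?f ` radical U M"
    then show "z \<in> radical U A \<times> radical U B"
      using radical_biproduct_iff[OF U b] unfolding radical_def by blast
  next
    fix z assume z: "z \<in> radical U A \<times> radical U B"
    then have "z \<in> ?f ` Hom C U M" using bij unfolding bij_betw_def radical_def by blast
    then obtain g where "g \<in> Hom C U M" "z = ?f g" by blast
    then show "z \<in> ?f ` radical U M" using radical_biproduct_iff[OF U b, of g] z by auto
  qed
  then have "bij_betw ?f (radical U M) (radical U A \<times> radical U B)"
    using bij_betw_subset[OF bij, of "radical U M"] unfolding radical_def by blast
  from bij_betw_same_card[OF this] show ?thesis by (simp add: card_cartesian_product)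
qed

lemma zero_not_iso:
  assumes "indecomposable C U" shows "\<not> iso_arr C (zero_arr C U U)"
proof
  assume iso: "iso_arr C (zero_arr C U U)"
  have "zero_arr C U U \<in> Hom C U U" using indecomposable_obj[OF assms] by (simp add: in_Hom)
  from iso_arr_inverse[OF iso this] obtain g where "g \<in> Hom C U U" "g \<cdot> zero_arr C U U = id_arr C U" .
  then show False using indecomposable_id[OF assms] indecomposable_obj[OF assms] by (simp add: in_Hom)
qed

lemma card_radical_pos:
  assumes "indecomposable C U" "Y \<in> obj C" shows "card (radical U Y) > 0"
proof -
  have "zero_arr C U Y \<in> radical U Y"
    using assms indecomposable_obj[OF assms(1)] zero_not_iso[OF assms(1)]
    unfolding radical_def by (auto simp: in_Hom)
  moreover have "finite (radical U Y)" using fin_Hom unfolding radical_def by simp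
  ultimately show ?thesis by (auto simp: card_gt_0_iff)
qed

text \<open>
  For \<open>Y\<close> a direct sum of indecomposables this is a fixed positive number times the multiplicity of
  \<open>U\<close> in \<open>Y\<close>.
\<close>

definition hom_mod_radical :: "'o \<Rightarrow> 'o \<Rightarrow> real" where
  "hom_mod_radical U Y = ln (real (card (Hom C U Y))) - ln (real (card (radical U Y)))"

lemma hom_mod_radical_direct_sum:
  assumes U: "indecomposable C U" and M: "direct_sum C M A B"
  shows "hom_mod_radical U M = hom_mod_radical U A + hom_mod_radical U B"
proof -
  have o: "U \<in> obj C" "A \<in> obj C" "B \<in> obj C"
    using indecomposable_obj[OF U] M by (auto simp: direct_sum_def)
  have "real (card (Hom C U A)) > 0" "real (card (Hom C U B)) > 0"
    "real (card (radical U A)) > 0" "real (card (radical U B)) > 0"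
    using card_Hom_pos o card_radical_pos[OF U] by simp_all
  then show ?thesis
    unfolding hom_mod_radical_def card_Hom_biproduct[OF M] card_radical_biproduct[OF U M] of_nat_mult
    by (subst (1 2) ln_mult) simp_all
qed

lemma direct_sum_zero:
  assumes "zero_object C Z" "A \<in> obj C" shows "direct_sum C A A Z"
proof -
  have "biproduct C A A Z (id_arr C A) (zero_arr C Z A) (id_arr C A) (zero_arr C A Z)"
    using assms unfolding biproduct_def zero_object_iff by (auto simp: in_Hom)
  then show ?thesis by (rule biproduct_direct_sum)
qed

lemma direct_sum_unique:
  assumes "direct_sum C M A B" "direct_sum C N A' B'" "isomorphic C A A'" "isomorphic C B B'"
  shows "isomorphic C M N"
proof -
  have half: "\<exists>f\<in>Hom C M N. \<exists>g\<in>Hom C N M. f = i1' \<cdot> (a \<cdot> p1) \<boxplus> i2' \<cdot> (b \<cdot> p2) \<and> g = i1 \<cdot> (a' \<cdot> p1') \<boxplus> i2 \<cdot> (b' \<cdot> p2') \<and> g \<cdot> f = id_arr C M"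
    if b: "biproduct C M A B i1 i2 p1 p2" and b': "biproduct C N A' B' i1' i2' p1' p2'"
      and a: "a \<in> Hom C A A'" "a' \<in> Hom C A' A" "a' \<cdot> a = id_arr C A"
      and bb: "b \<in> Hom C B B'" "b' \<in> Hom C B' B" "b' \<cdot> b = id_arr C B"
    for M A B N A' B' i1 i2 p1 p2 i1' i2' p1' p2' a b a' b'
  proof -
    note B = biproductD[OF b] and B' = biproductD[OF b']
    have H: "a \<in> arr C" "src C a = A" "tgt C a = A'" "a' \<in> arr C" "src C a' = A'" "tgt C a' = A"
      "b \<in> arr C" "src C b = B" "tgt C b = B'" "b' \<in> arr C" "src C b' = B'" "tgt C b' = B"
      using a bb by (auto simp: in_Hom)
    let ?f = "i1' \<cdot> (a \<cdot> p1) \<boxplus> i2' \<cdot> (b \<cdot> p2)" and ?g = "i1 \<cdot> (a' \<cdot> p1') \<boxplus> i2 \<cdot> (b' \<cdot> p2')"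
    have f: "?f \<in> arr C" "src C ?f = M" "tgt C ?f = N" and g: "?g \<in> arr C" "src C ?g = N" "tgt C ?g = M"
      using B(1-12) B'(1-12) H by auto
    have pf: "p1' \<cdot> ?f = a \<cdot> p1" "p2' \<cdot> ?f = b \<cdot> p2"
      by (rule biproduct_inj[OF b']; use H B(1-12) in simp)+
    have "?g \<cdot> ?f = (i1 \<cdot> (a' \<cdot> p1')) \<cdot> ?f \<boxplus> (i2 \<cdot> (b' \<cdot> p2')) \<cdot> ?f"
      using f B(1-12) B'(1-12) H by (intro comp_add(2)) simp_all
    also have "(i1 \<cdot> (a' \<cdot> p1')) \<cdot> ?f = i1 \<cdot> (a' \<cdot> (p1' \<cdot> ?f))" using f B(1-12) B'(1-12) H by (simp del: comp_add)
    also have "\<dots> = i1 \<cdot> p1" using pf(1) collapse[OF a(3)] H B by simp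
    also have "(i2 \<cdot> (b' \<cdot> p2')) \<cdot> ?f = i2 \<cdot> (b' \<cdot> (p2' \<cdot> ?f))" using f B(1-12) B'(1-12) H by (simp del: comp_add)
    also have "\<dots> = i2 \<cdot> p2" using pf(2) collapse[OF bb(3)] H B by simp
    finally have "?g \<cdot> ?f = id_arr C M" using B by simp
    then show ?thesis using f g by (auto simp: in_Hom)
  qed
  obtain i1 i2 p1 p2 i1' i2' p1' p2' where b: "biproduct C M A B i1 i2 p1 p2" "biproduct C N A' B' i1' i2' p1' p2'"
    using assms unfolding direct_sum_def by blast
  obtain a a' where a: "a \<in> Hom C A A'" "a' \<in> Hom C A' A" "a' \<cdot> a = id_arr C A" "a \<cdot> a' = id_arr C A'"
    using assms(3) unfolding isomorphic_iff by blast
  obtain c c' where c: "c \<in> Hom C B B'" "c' \<in> Hom C B' B" "c' \<cdot> c = id_arr C B" "c \<cdot> c' = id_arr C B'"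
    using assms(4) unfolding isomorphic_iff by blast
  show ?thesis unfolding isomorphic_iff
    using half[OF b a(1-3) c(1-3)] half[OF b(2,1) a(2,1,4) c(2,1,4)] by blast
qed

lemma direct_sum_iso:
  assumes "direct_sum C M A B" "isomorphic C M N" shows "direct_sum C N A B"
proof -
  obtain i1 i2 p1 p2 where b: "biproduct C M A B i1 i2 p1 p2"
    using assms unfolding direct_sum_def by blast
  note B = biproductD[OF b]
  obtain f g where fg: "f \<in> arr C" "src C f = M" "tgt C f = N" "g \<in> arr C" "src C g = N" "tgt C g = M"
    "g \<cdot> f = id_arr C M" "f \<cdot> g = id_arr C N"
    using assms(2) unfolding isomorphic_iff by (auto simp: in_Hom)
  note c = collapse[OF fg(7)] collapse[OF fg(8)]
  have c17: "i1 \<cdot> (p1 \<cdot> g) \<boxplus> i2 \<cdot> (p2 \<cdot> g) = g"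
    by (rule biproduct_decompose(1)[OF b]) (use fg in auto)
  have "f \<cdot> (i1 \<cdot> (p1 \<cdot> g)) \<boxplus> f \<cdot> (i2 \<cdot> (p2 \<cdot> g)) = f \<cdot> (i1 \<cdot> (p1 \<cdot> g) \<boxplus> i2 \<cdot> (p2 \<cdot> g))"
    using B(1-12) fg by (intro comp_add(1)[symmetric]) simp_all
  also have "\<dots> = id_arr C N" unfolding c17 fg(8) ..
  finally have s: "f \<cdot> (i1 \<cdot> (p1 \<cdot> g)) \<boxplus> f \<cdot> (i2 \<cdot> (p2 \<cdot> g)) = id_arr C N" .
  have "biproduct C N A B (f \<cdot> i1) (f \<cdot> i2) (p1 \<cdot> g) (p2 \<cdot> g)"
    unfolding biproduct_def using B fg s by (simp add: in_Hom c)
  then show ?thesis by (rule biproduct_direct_sum)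
qed

lemma indecomposable_iso:
  assumes "indecomposable C A" "isomorphic C A B" shows "indecomposable C B"
  unfolding indecomposable_def
proof (intro conjI allI impI)
  show "B \<in> obj C" using isomorphic_obj[OF assms(2)] by simp
  show "\<not> zero_object C B"
    using assms zero_object_iso isomorphic_sym unfolding indecomposable_def by blast
  show "zero_object C X \<or> zero_object C Y" if "direct_sum C B X Y" for X Y
    using direct_sum_iso[OF that isomorphic_sym[OF assms(2)]] assms(1) unfolding indecomposable_def by blast
qed

lemma zero_object_ex: obtains Z where "zero_object C Z"
  using additive unfolding additive_category_def by blast

lemma additive_zero:
  fixes f :: "'o \<Rightarrow> real"
  assumes "\<And>M A B. direct_sum C M A B \<Longrightarrow> f M = f A + f B" "zero_object C Z"
  shows "f Z = 0"
  using assms(1)[OF direct_sum_zero[OF assms(2)], of Z] assms(2) by (simp add: zero_object_def)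

text \<open>
  An object isomorphic to \<open>A\<close> is a direct sum of \<open>A\<close> and a zero object.
\<close>

lemma additive_iso:
  fixes f :: "'o \<Rightarrow> real"
  assumes add: "\<And>M A B. direct_sum C M A B \<Longrightarrow> f M = f A + f B" and "isomorphic C A B"
  shows "f A = f B"
proof -
  obtain Z where Z: "zero_object C Z" using zero_object_ex .
  have "direct_sum C A A Z" using direct_sum_zero[OF Z] isomorphic_obj[OF assms(2)] by blast
  from add[OF direct_sum_iso[OF this assms(2)]] show ?thesis using additive_zero[of f, OF add Z] by simp
qed

lemma additive_list:
  fixes f :: "'o \<Rightarrow> real"
  assumes add: "\<And>M A B. direct_sum C M A B \<Longrightarrow> f M = f A + f B"
  shows "direct_sum_list C M Ms \<Longrightarrow> f M = (\<Sum>N\<leftarrow>Ms. f N)"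
  by (induction Ms arbitrary: M) (auto dest: add simp: additive_zero[of f, OF add])

lemma hom_mod_radical_self: "indecomposable C U \<Longrightarrow> hom_mod_radical U U > 0"
proof -
  assume U: "indecomposable C U"
  have Uo: "U \<in> obj C" by (rule indecomposable_obj[OF U])
  have "iso_arr C (id_arr C U)" unfolding iso_arr_def using Uo by (auto simp: in_Hom)
  moreover have "id_arr C U \<cdot> id_arr C U = id_arr C U" using Uo by simp
  ultimately have "id_arr C U \<in> Hom C U U - radical U U"
    using Uo id_in_Hom[OF Uo] unfolding radical_def by force
  moreover have "radical U U \<subseteq> Hom C U U" unfolding radical_def by auto
  ultimately have "card (radical U U) < card (Hom C U U)"
    using psubset_card_mono[OF fin_Hom, of "radical U U"] by blast
  then show ?thesis unfolding hom_mod_radical_def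
    using card_radical_pos[OF U Uo] by simp
qed

lemma hom_mod_radical_other:
  assumes U: "indecomposable C U" and V: "indecomposable C V" and "\<not> isomorphic C U V"
  shows "hom_mod_radical U V = 0"
proof -
  have "\<not> iso_arr C (h \<cdot> g)" if hg: "h \<in> Hom C V U" "g \<in> Hom C U V" for h g
  proof
    assume iso: "iso_arr C (h \<cdot> g)"
    have "h \<cdot> g \<in> Hom C U U" using hg by (simp add: in_Hom)
    from iso_arr_inverse[OF iso this] obtain c where c: "c \<in> Hom C U U" "c \<cdot> (h \<cdot> g) = id_arr C U" .
    have "(c \<cdot> h) \<cdot> g = id_arr C U" using c hg by (auto simp: in_Hom)
    moreover have "c \<cdot> h \<in> Hom C V U" using c hg by (auto simp: in_Hom)
    ultimately have r: "retract U V g (c \<cdot> h)" using hg unfolding retract_def by simp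
    have "\<not> zero_object C U" using U by (simp add: indecomposable_def)
    with retract_indecomposable[OF V r] have "isomorphic C U V"
      using r unfolding isomorphic_iff retract_def by blast
    then show False using assms(3) by simp
  qed
  then have "radical U V = Hom C U V" unfolding radical_def by auto
  then show ?thesis unfolding hom_mod_radical_def by simp
qed

lemma retract_refl: "A \<in> obj C \<Longrightarrow> retract A A (id_arr C A) (id_arr C A)"
  unfolding retract_def by (simp add: in_Hom)

lemma card_Hom_retract:
  assumes "retract A M s r" "\<not> zero_object C A" shows "card (Hom C M A) \<ge> 2"
proof -
  have H: "s \<in> arr C" "r \<in> arr C" "src C s = A" "tgt C s = M" "src C r = M" "tgt C r = A"
    "r \<cdot> s = id_arr C A" using assms(1) by (auto simp: retract_def in_Hom)
  have obj: "A \<in> obj C" "M \<in> obj C" using H by auto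
  have "r \<noteq> zero_arr C M A"
    using H obj assms(2) comp_zero(2)[of s A M] unfolding zero_object_iff by auto
  then show ?thesis
    using card_ge_2I[OF fin_Hom, of r M A "zero_arr C M A"] H obj by (auto simp: in_Hom)
qed

text \<open>
  A retract \<open>A\<close> of \<open>N\<close> that is nonzero and has the fewest maps from \<open>N\<close> is indecomposable; split it off and
  continue with its complement, which has fewer maps from the fixed object \<open>M\<close>.
\<close>

lemma decomposition_ex:
  assumes "M \<in> obj C"
  shows "\<exists>Ms. (\<forall>N\<in>set Ms. indecomposable C N) \<and> direct_sum_list C M Ms"
proof -
  have "retract N M s r \<Longrightarrow> \<exists>Ms. (\<forall>N\<in>set Ms. indecomposable C N) \<and> direct_sum_list C N Ms" for N s r
  proof (induction "card (Hom C M N)" arbitrary: N s r rule: less_induct)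
    case less
    have No: "N \<in> obj C" using retract_obj[OF less.prems] by simp
    show ?case
    proof (cases "zero_object C N")
      case True
      then show ?thesis by (intro exI[of _ "[]"]) simp
    next
      case nz: False
      (* nonzero retracts; one with the fewest maps from N is indecomposable *)
      define P where "P A \<longleftrightarrow> (\<exists>s r. retract A N s r) \<and> \<not> zero_object C A" for A
      have "P N" unfolding P_def using nz retract_refl[OF No] by blast
      then obtain A where A: "P A" and min: "\<And>A'. P A' \<Longrightarrow> card (Hom C N A) \<le> card (Hom C N A')"
        using ex_has_least_nat[of P N "\<lambda>A. card (Hom C N A)"] by blast
      obtain s' r' where sr: "retract A N s' r'" and Anz: "\<not> zero_object C A" using A P_def by blast
      have "indecomposable C A" unfolding indecomposable_def
      proof (intro conjI allI impI)
        show "A \<in> obj C" using retract_obj[OF sr] by simp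
        show "\<not> zero_object C A" by (rule Anz)
        fix A1 A2 assume ds: "direct_sum C A A1 A2"
        then obtain i1 i2 p1 p2 where b: "biproduct C A A1 A2 i1 i2 p1 p2" unfolding direct_sum_def by blast
        note r1 = retract_trans[OF biproduct_retract(1)[OF b] sr] and r2 = retract_trans[OF biproduct_retract(2)[OF b] sr]
        show "zero_object C A1 \<or> zero_object C A2"
        proof (rule ccontr)
          assume n: "\<not> ?thesis"
          then have "P A1" using r1 unfolding P_def by blast
          from min[OF this] have "card (Hom C N A1) * card (Hom C N A2) \<le> card (Hom C N A1)"
            using card_Hom_biproduct[OF ds] by simp
          moreover have "card (Hom C N A1) \<ge> 2" "card (Hom C N A2) \<ge> 2"
            using card_Hom_retract[OF r1] card_Hom_retract[OF r2] n by auto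
          ultimately show False using mult_le_mono2[of 2 "card (Hom C N A2)" "card (Hom C N A1)"] by linarith
        qed
      qed
      obtain B i2 p2 where b: "biproduct C N A B s' i2 r' p2" using retract_biproduct[OF idem sr] .
      note rB = retract_trans[OF biproduct_retract(2)[OF b] less.prems] and rA = retract_trans[OF sr less.prems]
      have "card (Hom C M N) = card (Hom C M A) * card (Hom C M B)"
        by (rule card_Hom_biproduct[OF biproduct_direct_sum[OF b]])
      moreover have "card (Hom C M A) \<ge> 2" by (rule card_Hom_retract[OF rA Anz])
      moreover have "card (Hom C M B) > 0" using card_Hom_pos[OF assms] retract_obj[OF rB] by simp
      ultimately have "card (Hom C M B) < card (Hom C M N)"
        using mult_le_mono1[of 2 "card (Hom C M A)" "card (Hom C M B)"] by linarith
      from less.hyps[OF this rB] obtain Bs where "\<forall>N\<in>set Bs. indecomposable C N" "direct_sum_list C B Bs" by blast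
      then show ?thesis using biproduct_direct_sum[OF b] \<open>indecomposable C A\<close>
        by (intro exI[of _ "A # Bs"]) auto
    qed
  qed
  then show ?thesis using retract_refl[OF assms] by blast
qed

lemma ind_rep:
  assumes "X \<in> ind C" shows "X \<in> Iso C" "indecomposable C (rep X)" "iso_class C (rep X) = X"
proof -
  obtain N where N: "indecomposable C N" "X = iso_class C N" using assms unfolding ind_def by auto
  then show X: "X \<in> Iso C" using indecomposable_obj iso_class_in_Iso by simp
  show "iso_class C (rep X) = X" by (rule rep_Iso(2)[OF X])
  show "indecomposable C (rep X)"
    using indecomposable_iso[OF N(1)] isomorphic_sym[OF rep_iso_class[OF indecomposable_obj[OF N(1)]]] N(2) by simp
qed

lemma iso_class_ind: "indecomposable C N \<Longrightarrow> iso_class C N \<in> ind C"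
  by (simp add: ind_def)

end

locale krull_schmidt = finite_linear_category K C
  for K :: "('k, 'x) ring_scheme" and C :: "('o, 'm, 'k) lincat" +
  assumes fin_ind: "finite (ind C)"
begin

text \<open>
  The additive extension of \<open>d\<close> in closed form.  It is manifestly well defined, which shows that the
  description in \<open>degree\<close> determines a value.
\<close>

definition weight :: "('o set \<Rightarrow> real) \<Rightarrow> 'o \<Rightarrow> real" where
  "weight d Y = (\<Sum>X\<in>ind C. d X * hom_mod_radical (rep X) Y / hom_mod_radical (rep X) (rep X))"

lemma weight_direct_sum:
  assumes "direct_sum C M A B" shows "weight d M = weight d A + weight d B"
  unfolding weight_def sum.distrib[symmetric]
  by (intro sum.cong refl) (simp add: hom_mod_radical_direct_sum[OF ind_rep(2) assms] algebra_simps add_divide_distrib)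

lemma weight_indecomposable:
  assumes N: "indecomposable C N" shows "weight d N = d (iso_class C N)"
proof -
  let ?X = "iso_class C N"
  have X: "?X \<in> ind C" by (rule iso_class_ind[OF N])
  have o: "N \<in> obj C" by (rule indecomposable_obj[OF N])
  have "weight d N = d ?X * hom_mod_radical (rep ?X) N / hom_mod_radical (rep ?X) (rep ?X)"
    unfolding weight_def
  proof (subst sum.remove[OF fin_ind X], subst sum.neutral)
    show "\<forall>Y\<in>ind C - {?X}. d Y * hom_mod_radical (rep Y) N / hom_mod_radical (rep Y) (rep Y) = 0"
    proof
      fix Y assume Y: "Y \<in> ind C - {?X}"
      then have "Y \<in> ind C" by simp
      note r = ind_rep[OF this]
      have "\<not> isomorphic C (rep Y) N"
        using iso_class_eq_iff[of "rep Y" N] r Y indecomposable_obj by auto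
      then show "d Y * hom_mod_radical (rep Y) N / hom_mod_radical (rep Y) (rep Y) = 0"
        using hom_mod_radical_other[OF r(2) N] by simp
    qed
  qed simp
  moreover have "hom_mod_radical (rep ?X) N = hom_mod_radical (rep ?X) (rep ?X)"
    by (rule additive_iso[OF hom_mod_radical_direct_sum[OF ind_rep(2)[OF X]] isomorphic_sym[OF rep_iso_class[OF o]]])
  moreover have "hom_mod_radical (rep ?X) (rep ?X) > 0" by (rule hom_mod_radical_self[OF ind_rep(2)[OF X]])
  ultimately show ?thesis by simp
qed

lemma weight_list:
  assumes "direct_sum_list C M Ms" "\<forall>N\<in>set Ms. indecomposable C N"
  shows "weight d M = (\<Sum>N\<leftarrow>Ms. d (iso_class C N))"
proof -
  have eq: "map (weight d) Ms = map (\<lambda>N. d (iso_class C N)) Ms"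
    using assms(2) weight_indecomposable by simp
  have "weight d M = sum_list (map (weight d) Ms)" by (rule additive_list[OF weight_direct_sum assms(1)])
  then show ?thesis unfolding eq .
qed

lemma weight_iso: "isomorphic C A B \<Longrightarrow> weight d A = weight d B"
  by (rule additive_iso[OF weight_direct_sum])

lemma degree_eq:
  assumes "A \<in> obj C" shows "degree C d (iso_class C A) = weight d A"
  unfolding degree_def
proof (rule the_equality)
  obtain Ms where "\<forall>N\<in>set Ms. indecomposable C N" "direct_sum_list C A Ms" using decomposition_ex[OF assms] by blast
  then show "\<exists>M\<in>iso_class C A. \<exists>Ms. (\<forall>N\<in>set Ms. indecomposable C N) \<and> direct_sum_list C M Ms \<and>
      weight d A = (\<Sum>N\<leftarrow>Ms. d (iso_class C N))"
    using weight_list iso_class_self[OF assms] by blast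
next
  fix r assume "\<exists>M\<in>iso_class C A. \<exists>Ms. (\<forall>N\<in>set Ms. indecomposable C N) \<and> direct_sum_list C M Ms \<and>
      r = (\<Sum>N\<leftarrow>Ms. d (iso_class C N))"
  then obtain M Ms where "isomorphic C A M" "\<forall>N\<in>set Ms. indecomposable C N" "direct_sum_list C M Ms"
      "r = (\<Sum>N\<leftarrow>Ms. d (iso_class C N))" unfolding iso_class_def by blast
  then show "r = weight d A" using weight_list weight_iso by metis
qed

text \<open>
  Every additive function is determined by its values on indecomposables.
\<close>

lemma additive_eq_weight:
  fixes f :: "'o \<Rightarrow> real"
  assumes add: "\<And>M A B. direct_sum C M A B \<Longrightarrow> f M = f A + f B"
    and d: "\<And>N. indecomposable C N \<Longrightarrow> d (iso_class C N) = f N" and "A \<in> obj C"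
  shows "f A = weight d A"
proof -
  obtain Ms where Ms: "\<forall>N\<in>set Ms. indecomposable C N" "direct_sum_list C A Ms" using decomposition_ex[OF assms(3)] by blast
  have eq: "map f Ms = map (\<lambda>N. d (iso_class C N)) Ms" using Ms(1) d by simp
  have "f A = sum_list (map f Ms)" by (rule additive_list[OF add Ms(2)])
  then show ?thesis unfolding eq weight_list[OF Ms(2,1), of d] .
qed

text \<open>
  A substitute for the length of an object: it is additive and bounds the number of indecomposable
  summands, so that only finitely many isomorphism classes lie below a given bound.
\<close>

definition total_log_card :: "'o \<Rightarrow> real" where
  "total_log_card Y = (\<Sum>X\<in>ind C. log_card (rep X) Y)"

lemma total_log_card_direct_sum:
  assumes "direct_sum C M A B" shows "total_log_card M = total_log_card A + total_log_card B"
  unfolding total_log_card_def sum.distrib[symmetric]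
  by (intro sum.cong refl) (simp add: log_card_direct_sum[OF assms indecomposable_obj[OF ind_rep(2)]])

lemma total_log_card_indecomposable:
  assumes N: "indecomposable C N" shows "total_log_card N \<ge> ln 2"
proof -
  let ?X = "iso_class C N"
  have X: "?X \<in> ind C" by (rule iso_class_ind[OF N])
  have o: "N \<in> obj C" by (rule indecomposable_obj[OF N])
  have ro: "rep ?X \<in> obj C" by (rule indecomposable_obj[OF ind_rep(2)[OF X]])
  obtain f g where fg: "f \<in> Hom C (rep ?X) N" "g \<in> Hom C N (rep ?X)" "f \<cdot> g = id_arr C N"
    using rep_iso_class[OF o] unfolding isomorphic_iff by blast
  then have "retract N (rep ?X) g f" unfolding retract_def by simp
  then have "card (Hom C (rep ?X) N) \<ge> 2"
    using card_Hom_retract N unfolding indecomposable_def by blast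
  then have "log_card (rep ?X) N \<ge> ln 2" unfolding log_card_def by simp
  also have "log_card (rep ?X) N \<le> total_log_card N" unfolding total_log_card_def
    by (rule member_le_sum[OF X _ fin_ind]) (simp add: log_card_nonneg o indecomposable_obj[OF ind_rep(2)])
  finally show ?thesis .
qed

lemma direct_sum_list_unique:
  "direct_sum_list C M Ms \<Longrightarrow> direct_sum_list C N Ns \<Longrightarrow> list_all2 (isomorphic C) Ms Ns \<Longrightarrow> isomorphic C M N"
proof (induction Ms arbitrary: M N Ns)
  case Nil
  then show ?case using zero_object_iso by auto
next
  case (Cons A As)
  then obtain B Bs where Ns: "Ns = B # Bs" by (cases Ns) auto
  then show ?case using Cons direct_sum_unique by fastforce
qed

lemma finite_bounded_log_card: "finite {X \<in> Iso C. total_log_card (rep X) \<le> b}" (is "finite ?S")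
proof -
  obtain k :: nat where k: "b / ln 2 \<le> real k" using real_arch_simple by blast
  have "\<exists>Ms. (\<forall>N\<in>set Ms. indecomposable C N) \<and> direct_sum_list C (rep X) Ms" if "X \<in> ?S" for X
    using decomposition_ex rep_Iso that by blast
  then obtain L where L: "\<And>X. X \<in> ?S \<Longrightarrow> (\<forall>N\<in>set (L X). indecomposable C N) \<and> direct_sum_list C (rep X) (L X)"
    by metis
  let ?f = "\<lambda>X. map (iso_class C) (L X)"
  have "?f ` ?S \<subseteq> {xs. set xs \<subseteq> ind C \<and> length xs \<le> k}"
  proof (clarify, intro conjI)
    fix X assume X: "X \<in> Iso C" "total_log_card (rep X) \<le> b"
    then have LX: "\<forall>N\<in>set (L X). indecomposable C N" "direct_sum_list C (rep X) (L X)" using L by auto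
    then show "set (?f X) \<subseteq> ind C" using iso_class_ind by auto
    have "real (length (L X)) * ln 2 \<le> (\<Sum>N\<leftarrow>L X. total_log_card N)"
      using sum_list_mono[of "L X" "\<lambda>_. ln 2" total_log_card] LX(1) total_log_card_indecomposable
      by (auto simp: sum_list_triv)
    also have "\<dots> \<le> b" using additive_list[of total_log_card, OF total_log_card_direct_sum LX(2)] X by simp
    finally have "real (length (L X)) \<le> b / ln 2" by (simp add: field_simps)
    then show "length (?f X) \<le> k" using k by simp
  qed
  then have "finite (?f ` ?S)" using finite_lists_length_le[OF fin_ind] finite_subset by blast
  moreover have "inj_on ?f ?S"
  proof (rule inj_onI)
    fix X Y assume X: "X \<in> ?S" and Y: "Y \<in> ?S" and eq: "?f X = ?f Y"
    note LX = L[OF X] and LY = L[OF Y]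
    have "list_all2 (isomorphic C) (L X) (L Y)"
      unfolding list_all2_conv_all_nth
    proof (intro conjI allI impI)
      show len: "length (L X) = length (L Y)" using eq by (metis length_map)
      fix i assume i: "i < length (L X)"
      then have "iso_class C (L X ! i) = iso_class C (L Y ! i)" using eq len by (metis nth_map)
      moreover have "L X ! i \<in> obj C" using LX i indecomposable_obj by auto
      ultimately show "isomorphic C (L X ! i) (L Y ! i)" using iso_class_eq_iff by blast
    qed
    then have "isomorphic C (rep X) (rep Y)" using direct_sum_list_unique LX LY by blast
    then show "X = Y" using iso_class_eq_iff[of "rep X" "rep Y"] rep_Iso X Y by auto
  qed
  ultimately show ?thesis by (rule finite_imageD)
qed

end

section \<open>Exact structures and the obscure axiom\<close>

context linear_category begin

lemma kernelD:
  assumes "is_kernel C i p"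
  shows "i \<in> arr C" "p \<in> arr C" "tgt C i = src C p" "p \<cdot> i = zero_arr C (src C i) (tgt C p)"
  using assms unfolding is_kernel_def by auto

lemma kernel_lift:
  assumes "is_kernel C i p" "f \<in> arr C" "tgt C f = src C p" "p \<cdot> f = zero_arr C (src C f) (tgt C p)"
  obtains g where "g \<in> arr C" "src C g = src C f" "tgt C g = src C i" "i \<cdot> g = f"
proof -
  have "\<exists>!g. g \<in> Hom C (src C f) (src C i) \<and> i \<cdot> g = f"
    using assms unfolding is_kernel_def by simp
  then obtain g where "g \<in> Hom C (src C f) (src C i)" "i \<cdot> g = f" by (elim ex1E conjE)
  then show ?thesis by (intro that[of g]) (simp_all add: in_Hom)
qed

lemma kernel_mono:
  assumes k: "is_kernel C i p" and x: "x \<in> arr C" "y \<in> arr C" "src C x = src C y" "tgt C x = src C i" "tgt C y = src C i"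
    and eq: "i \<cdot> x = i \<cdot> y"
  shows "x = y"
proof -
  note K = kernelD[OF k]
  have f: "i \<cdot> x \<in> arr C" "tgt C (i \<cdot> x) = src C p" "p \<cdot> (i \<cdot> x) = zero_arr C (src C (i \<cdot> x)) (tgt C p)"
    using collapse[OF K(4)] K x by simp_all
  have "\<forall>f\<in>arr C. tgt C f = src C p \<and> p \<cdot> f = zero_arr C (src C f) (tgt C p) \<longrightarrow>
      (\<exists>!g. g \<in> Hom C (src C f) (src C i) \<and> i \<cdot> g = f)"
    using k unfolding is_kernel_def by (elim conjE)
  then have "\<exists>!g. g \<in> Hom C (src C (i \<cdot> x)) (src C i) \<and> i \<cdot> g = i \<cdot> x" using f by blast
  moreover have "x \<in> Hom C (src C (i \<cdot> x)) (src C i)" "y \<in> Hom C (src C (i \<cdot> x)) (src C i)"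
    using x K by (simp_all add: in_Hom)
  ultimately show ?thesis using eq by metis
qed

lemma cokernelD:
  assumes "is_cokernel C p i"
  shows "i \<in> arr C" "p \<in> arr C" "tgt C i = src C p" "p \<cdot> i = zero_arr C (src C i) (tgt C p)"
  using assms unfolding is_cokernel_def by auto

lemma cokernel_desc:
  assumes "is_cokernel C p i" "f \<in> arr C" "src C f = src C p" "f \<cdot> i = zero_arr C (src C i) (tgt C f)"
  obtains g where "g \<in> arr C" "src C g = tgt C p" "tgt C g = tgt C f" "g \<cdot> p = f"
proof -
  have "\<exists>!g. g \<in> Hom C (tgt C p) (tgt C f) \<and> g \<cdot> p = f"
    using assms unfolding is_cokernel_def by simp
  then obtain g where "g \<in> Hom C (tgt C p) (tgt C f)" "g \<cdot> p = f" by (elim ex1E conjE)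
  then show ?thesis by (intro that[of g]) (simp_all add: in_Hom)
qed

lemma cokernel_epi:
  assumes k: "is_cokernel C p i" and x: "x \<in> arr C" "y \<in> arr C" "tgt C x = tgt C y" "src C x = tgt C p" "src C y = tgt C p"
    and eq: "x \<cdot> p = y \<cdot> p"
  shows "x = y"
proof -
  note K = cokernelD[OF k]
  have f: "x \<cdot> p \<in> arr C" "src C (x \<cdot> p) = tgt C i" "(x \<cdot> p) \<cdot> i = zero_arr C (src C i) (tgt C (x \<cdot> p))"
    using K x by simp_all
  have "\<forall>f\<in>arr C. src C f = tgt C i \<and> f \<cdot> i = zero_arr C (src C i) (tgt C f) \<longrightarrow>
      (\<exists>!g. g \<in> Hom C (tgt C p) (tgt C f) \<and> g \<cdot> p = f)"
    using k unfolding is_cokernel_def by (elim conjE)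
  then have "\<exists>!g. g \<in> Hom C (tgt C p) (tgt C (x \<cdot> p)) \<and> g \<cdot> p = x \<cdot> p" using f by blast
  moreover have "x \<in> Hom C (tgt C p) (tgt C (x \<cdot> p))" "y \<in> Hom C (tgt C p) (tgt C (x \<cdot> p))"
    using x K by (simp_all add: in_Hom)
  ultimately show ?thesis using eq by metis
qed

lemma cokernel_of_other_kernel:
  assumes "is_kernel C i p" "is_kernel C i' p" "is_cokernel C p i"
  shows "is_cokernel C p i'"
proof -
  note K = kernelD[OF assms(1)] and K' = kernelD[OF assms(2)]
  obtain a where a: "a \<in> arr C" "src C a = src C i" "tgt C a = src C i'" "i' \<cdot> a = i"
    using kernel_lift[OF assms(2) K(1,3,4)] .
  have "\<exists>!g. g \<in> Hom C (tgt C p) (tgt C f) \<and> g \<cdot> p = f"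
    if f: "f \<in> arr C" "src C f = tgt C i'" "f \<cdot> i' = zero_arr C (src C i') (tgt C f)" for f
  proof -
    have "f \<cdot> i = zero_arr C (src C i) (tgt C f)"
      using collapse[OF f(3), of a] f K' a by simp
    then show ?thesis using assms(3) f K K' unfolding is_cokernel_def by simp
  qed
  then show ?thesis unfolding is_cokernel_def using K' by blast
qed

text \<open>
  Conflations may be transported to isomorphic end terms, in particular to the chosen
  representatives of the isomorphism classes.
\<close>

lemma kcp_iso_ends:
  assumes k: "kernel_cokernel_pair C i p"
    and a: "a \<in> arr C" "a' \<in> arr C" "src C a' = src C i" "tgt C a' = src C a" "tgt C a = src C i"
      "a \<cdot> a' = id_arr C (src C i)" "a' \<cdot> a = id_arr C (src C a)"
    and c: "c \<in> arr C" "c' \<in> arr C" "src C c = tgt C p" "tgt C c = src C c'" "tgt C c' = tgt C p"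
      "c' \<cdot> c = id_arr C (tgt C p)" "c \<cdot> c' = id_arr C (src C c')"
  shows "kernel_cokernel_pair C (i \<cdot> a) (c \<cdot> p)"
proof -
  have ker: "is_kernel C i p" and cok: "is_cokernel C p i" using k unfolding kernel_cokernel_pair_def by auto
  note K = kernelD[OF ker]
  have z: "(c \<cdot> p) \<cdot> (i \<cdot> a) = zero_arr C (src C (i \<cdot> a)) (tgt C (c \<cdot> p))"
    using collapse[OF K(4), of a] K a c by simp
  have "is_kernel C (i \<cdot> a) (c \<cdot> p)" unfolding is_kernel_def
  proof (intro conjI ballI impI)
    fix f assume f: "f \<in> arr C" "tgt C f = src C (c \<cdot> p) \<and> (c \<cdot> p) \<cdot> f = zero_arr C (src C f) (tgt C (c \<cdot> p))"
    then have f2: "tgt C f = src C p" "c \<cdot> (p \<cdot> f) = zero_arr C (src C f) (tgt C c)" using K c by auto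
    have "p \<cdot> f = c' \<cdot> (c \<cdot> (p \<cdot> f))" using collapse[OF c(6), of "p \<cdot> f"] K c f f2 by simp
    also have "\<dots> = zero_arr C (src C f) (tgt C p)" unfolding f2(2) using K c f f2 by simp
    finally obtain g where g: "g \<in> arr C" "src C g = src C f" "tgt C g = src C i" "i \<cdot> g = f"
      using kernel_lift[OF ker f(1) f2(1)] by metis
    show "\<exists>!g. g \<in> Hom C (src C f) (src C (i \<cdot> a)) \<and> (i \<cdot> a) \<cdot> g = f"
    proof (rule ex1I[of _ "a' \<cdot> g"])
      show "a' \<cdot> g \<in> Hom C (src C f) (src C (i \<cdot> a)) \<and> (i \<cdot> a) \<cdot> (a' \<cdot> g) = f"
        using g a K collapse[OF a(6), of g] by (simp add: in_Hom)
      fix h assume h: "h \<in> Hom C (src C f) (src C (i \<cdot> a)) \<and> (i \<cdot> a) \<cdot> h = f"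
      then have h': "h \<in> arr C" "src C h = src C f" "tgt C h = src C a" "i \<cdot> (a \<cdot> h) = i \<cdot> g"
        using g a K by (auto simp: in_Hom)
      have "a \<cdot> h = g" by (rule kernel_mono[OF ker]) (use h' g a in auto)
      then show "h = a' \<cdot> g" using collapse[OF a(7), of h] h' a by auto
    qed
  qed (use z K a c in auto)
  moreover have "is_cokernel C (c \<cdot> p) (i \<cdot> a)" unfolding is_cokernel_def
  proof (intro conjI ballI impI)
    fix f assume f: "f \<in> arr C" "src C f = tgt C (i \<cdot> a) \<and> f \<cdot> (i \<cdot> a) = zero_arr C (src C (i \<cdot> a)) (tgt C f)"
    then have f2: "src C f = src C p" "(f \<cdot> i) \<cdot> a = zero_arr C (src C a) (tgt C f)" using K a by auto
    have "f \<cdot> i = ((f \<cdot> i) \<cdot> a) \<cdot> a'" using K a f(1) f2(1) by simp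
    also have "\<dots> = zero_arr C (src C i) (tgt C f)" unfolding f2(2) using K a f(1) f2(1) by simp
    finally obtain g where g: "g \<in> arr C" "src C g = tgt C p" "tgt C g = tgt C f" "g \<cdot> p = f"
      using cokernel_desc[OF cok f(1) f2(1)] by metis
    show "\<exists>!g. g \<in> Hom C (tgt C (c \<cdot> p)) (tgt C f) \<and> g \<cdot> (c \<cdot> p) = f"
    proof (rule ex1I[of _ "g \<cdot> c'"])
      show "g \<cdot> c' \<in> Hom C (tgt C (c \<cdot> p)) (tgt C f) \<and> (g \<cdot> c') \<cdot> (c \<cdot> p) = f"
        using g c K collapse[OF c(6), of p] by (simp add: in_Hom)
      fix h assume h: "h \<in> Hom C (tgt C (c \<cdot> p)) (tgt C f) \<and> h \<cdot> (c \<cdot> p) = f"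
      then have h': "h \<in> arr C" "src C h = tgt C c" "tgt C h = tgt C f" "(h \<cdot> c) \<cdot> p = g \<cdot> p"
        using g c K by (auto simp: in_Hom)
      have "h \<cdot> c = g" by (rule cokernel_epi[OF cok]) (use h' g c in auto)
      then have "g \<cdot> c' = h \<cdot> (c \<cdot> c')" using h' c by auto
      then show "h = g \<cdot> c'" using h' c by simp
    qed
  qed (use z K a c in auto)
  ultimately show ?thesis unfolding kernel_cokernel_pair_def by simp
qed

lemma kcp_biproduct:
  assumes b: "biproduct C M A B i1 i2 p1 p2"
  shows "kernel_cokernel_pair C i1 p2"
proof -
  note B = biproductD[OF b]
  have "is_kernel C i1 p2" unfolding is_kernel_def
  proof (intro conjI ballI impI)
    fix f assume f: "f \<in> arr C" "tgt C f = src C p2 \<and> p2 \<cdot> f = zero_arr C (src C f) (tgt C p2)"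
    show "\<exists>!g. g \<in> Hom C (src C f) (src C i1) \<and> i1 \<cdot> g = f"
    proof (rule ex1I[of _ "p1 \<cdot> f"])
      show "p1 \<cdot> f \<in> Hom C (src C f) (src C i1) \<and> i1 \<cdot> (p1 \<cdot> f) = f"
        using biproduct_decompose(1)[OF b, of f] f B by (simp add: in_Hom)
      show "g = p1 \<cdot> f" if "g \<in> Hom C (src C f) (src C i1) \<and> i1 \<cdot> g = f" for g
        using collapse[OF B(13), of g] that B by (auto simp: in_Hom)
    qed
  qed (use B in auto)
  moreover have "is_cokernel C p2 i1" unfolding is_cokernel_def
  proof (intro conjI ballI impI)
    fix f assume f: "f \<in> arr C" "src C f = tgt C i1 \<and> f \<cdot> i1 = zero_arr C (src C i1) (tgt C f)"
    show "\<exists>!g. g \<in> Hom C (tgt C p2) (tgt C f) \<and> g \<cdot> p2 = f"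
    proof (rule ex1I[of _ "f \<cdot> i2"])
      have "(f \<cdot> i1) \<cdot> p1 \<boxplus> (f \<cdot> i2) \<cdot> p2 = f" by (rule biproduct_decompose(2)[OF b]) (use f B in auto)
      moreover have "(f \<cdot> i1) \<cdot> p1 = zero_arr C M (tgt C f)" using f B by simp
      ultimately show "f \<cdot> i2 \<in> Hom C (tgt C p2) (tgt C f) \<and> (f \<cdot> i2) \<cdot> p2 = f"
        using f B by (simp add: in_Hom)
      show "g = f \<cdot> i2" if "g \<in> Hom C (tgt C p2) (tgt C f) \<and> g \<cdot> p2 = f" for g
        using that B by (auto simp: in_Hom)
    qed
  qed (use B in auto)
  ultimately show ?thesis unfolding kernel_cokernel_pair_def by simp
qed

lemma biproduct_swap:
  assumes "biproduct C M A B i1 i2 p1 p2" shows "biproduct C M B A i2 i1 p2 p1"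
  using biproductD[OF assms] add_arr_comm[of "i1 \<cdot> p1" "i2 \<cdot> p2"] unfolding biproduct_def by (simp add: in_Hom)

lemma pullbackD:
  assumes "pullback_square C p f p' f'"
  shows "p \<in> arr C" "f \<in> arr C" "p' \<in> arr C" "f' \<in> arr C" "tgt C p = tgt C f" "tgt C p' = src C f"
    "tgt C f' = src C p" "src C p' = src C f'" "p \<cdot> f' = f \<cdot> p'"
  using assms unfolding pullback_square_def by auto

lemma pullback_univ:
  assumes "pullback_square C p f p' f'" "g \<in> arr C" "h \<in> arr C" "tgt C g = src C f" "tgt C h = src C p"
    "src C g = src C h" "p \<cdot> h = f \<cdot> g"
  shows "\<exists>!u. u \<in> Hom C (src C g) (src C p') \<and> p' \<cdot> u = g \<and> f' \<cdot> u = h"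
proof -
  have "\<forall>g\<in>arr C. \<forall>h\<in>arr C. tgt C g = src C f \<and> tgt C h = src C p \<and> src C g = src C h \<and>
      p \<cdot> h = f \<cdot> g \<longrightarrow> (\<exists>!u. u \<in> Hom C (src C g) (src C p') \<and> p' \<cdot> u = g \<and> f' \<cdot> u = h)"
    using assms(1) unfolding pullback_square_def by (elim conjE)
  then show ?thesis using assms(2-7) by blast
qed

lemma pullback_lift:
  assumes "pullback_square C p f p' f'" "g \<in> arr C" "h \<in> arr C" "tgt C g = src C f" "tgt C h = src C p"
    "src C g = src C h" "p \<cdot> h = f \<cdot> g"
  obtains u where "u \<in> arr C" "src C u = src C g" "tgt C u = src C p'" "p' \<cdot> u = g" "f' \<cdot> u = h"
proof -
  obtain u where "u \<in> Hom C (src C g) (src C p')" "p' \<cdot> u = g" "f' \<cdot> u = h"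
    using pullback_univ[OF assms] by (elim ex1E conjE)
  then show ?thesis by (intro that[of u]) (simp_all add: in_Hom)
qed

lemma pullback_joint_mono:
  assumes P: "pullback_square C p f p' f'" and u: "u \<in> arr C" "v \<in> arr C" "src C u = src C v"
    "tgt C u = src C p'" "tgt C v = src C p'" and eq: "p' \<cdot> u = p' \<cdot> v" "f' \<cdot> u = f' \<cdot> v"
  shows "u = v"
proof -
  note D = pullbackD[OF P]
  have c: "p \<cdot> (f' \<cdot> u) = f \<cdot> (p' \<cdot> u)" using collapse[OF D(9), of u] D u by simp
  have "\<exists>!w. w \<in> Hom C (src C (p' \<cdot> u)) (src C p') \<and> p' \<cdot> w = p' \<cdot> u \<and> f' \<cdot> w = f' \<cdot> u"
    by (rule pullback_univ[OF P]) (use D u c in simp_all)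
  moreover have "u \<in> Hom C (src C (p' \<cdot> u)) (src C p')" "v \<in> Hom C (src C (p' \<cdot> u)) (src C p')"
    using D u by (simp_all add: in_Hom)
  ultimately show ?thesis using eq by metis
qed

lemma pushoutD:
  assumes "pushout_square C i f i' f'"
  shows "i \<in> arr C" "f \<in> arr C" "i' \<in> arr C" "f' \<in> arr C" "src C i = src C f" "src C i' = tgt C f"
    "src C f' = tgt C i" "tgt C i' = tgt C f'" "f' \<cdot> i = i' \<cdot> f"
  using assms unfolding pushout_square_def by auto

lemma pushout_univ:
  assumes "pushout_square C i f i' f'" "g \<in> arr C" "h \<in> arr C" "src C g = tgt C f" "src C h = tgt C i"
    "tgt C g = tgt C h" "h \<cdot> i = g \<cdot> f"
  shows "\<exists>!u. u \<in> Hom C (tgt C i') (tgt C g) \<and> u \<cdot> i' = g \<and> u \<cdot> f' = h"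
proof -
  have "\<forall>g\<in>arr C. \<forall>h\<in>arr C. src C g = tgt C f \<and> src C h = tgt C i \<and> tgt C g = tgt C h \<and>
      h \<cdot> i = g \<cdot> f \<longrightarrow> (\<exists>!u. u \<in> Hom C (tgt C i') (tgt C g) \<and> u \<cdot> i' = g \<and> u \<cdot> f' = h)"
    using assms(1) unfolding pushout_square_def by (elim conjE)
  then show ?thesis using assms(2-7) by blast
qed

lemma pushout_desc:
  assumes "pushout_square C i f i' f'" "g \<in> arr C" "h \<in> arr C" "src C g = tgt C f" "src C h = tgt C i"
    "tgt C g = tgt C h" "h \<cdot> i = g \<cdot> f"
  obtains u where "u \<in> arr C" "src C u = tgt C i'" "tgt C u = tgt C g" "u \<cdot> i' = g" "u \<cdot> f' = h"
proof -
  obtain u where "u \<in> Hom C (tgt C i') (tgt C g)" "u \<cdot> i' = g" "u \<cdot> f' = h"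
    using pushout_univ[OF assms] by (elim ex1E conjE)
  then show ?thesis by (intro that[of u]) (simp_all add: in_Hom)
qed

lemma pushout_joint_epi:
  assumes P: "pushout_square C i f i' f'" and u: "u \<in> arr C" "v \<in> arr C" "tgt C u = tgt C v"
    "src C u = tgt C i'" "src C v = tgt C i'" and eq: "u \<cdot> i' = v \<cdot> i'" "u \<cdot> f' = v \<cdot> f'"
  shows "u = v"
proof -
  note D = pushoutD[OF P]
  have c: "(u \<cdot> f') \<cdot> i = (u \<cdot> i') \<cdot> f" using D u by simp
  have "\<exists>!w. w \<in> Hom C (tgt C i') (tgt C (u \<cdot> i')) \<and> w \<cdot> i' = u \<cdot> i' \<and> w \<cdot> f' = u \<cdot> f'"
    by (rule pushout_univ[OF P]) (use D u c in simp_all)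
  moreover have "u \<in> Hom C (tgt C i') (tgt C (u \<cdot> i'))" "v \<in> Hom C (tgt C i') (tgt C (u \<cdot> i'))"
    using D u by (simp_all add: in_Hom)
  ultimately show ?thesis using eq by metis
qed

lemma iso_arrI:
  assumes "f \<in> arr C" "g \<in> arr C" "src C g = tgt C f" "tgt C g = src C f"
    "g \<cdot> f = id_arr C (src C f)" "f \<cdot> g = id_arr C (tgt C f)"
  shows "iso_arr C f"
  unfolding iso_arr_def using assms by (auto simp: in_Hom)

end

locale exact_category = finite_linear_category K C
  for K :: "('k, 'x) ring_scheme" and C :: "('o, 'm, 'k) lincat" and E :: "('m \<times> 'm) set" +
  assumes exact: "exact_structure C E"
begin

lemma conflation_kcp: "(i, p) \<in> E \<Longrightarrow> kernel_cokernel_pair C i p"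
proof -
  have "\<forall>(i, p)\<in>E. kernel_cokernel_pair C i p"
    using exact unfolding exact_structure_def by (elim conjE)
  then show "(i, p) \<in> E \<Longrightarrow> kernel_cokernel_pair C i p" by blast
qed

lemma conflation_kernel: "(i, p) \<in> E \<Longrightarrow> is_kernel C i p" and conflation_cokernel: "(i, p) \<in> E \<Longrightarrow> is_cokernel C p i"
  using conflation_kcp unfolding kernel_cokernel_pair_def by auto

lemma conflation_iso:
  assumes "(i, p) \<in> E" "kernel_cokernel_pair C i' p'" "pair_isomorphic C (i, p) (i', p')"
  shows "(i', p') \<in> E"
proof -
  have "\<forall>(i, p)\<in>E. \<forall>i' p'. kernel_cokernel_pair C i' p' \<and> pair_isomorphic C (i, p) (i', p') \<longrightarrow> (i', p') \<in> E"
    using exact unfolding exact_structure_def by (elim conjE)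
  then show ?thesis using assms by blast
qed

lemma inflation_id: "A \<in> obj C \<Longrightarrow> inflation E (id_arr C A)" and deflation_id: "A \<in> obj C \<Longrightarrow> deflation E (id_arr C A)"
proof -
  have "\<forall>A\<in>obj C. inflation E (id_arr C A) \<and> deflation E (id_arr C A)"
    using exact unfolding exact_structure_def by (elim conjE)
  then show "A \<in> obj C \<Longrightarrow> inflation E (id_arr C A)" "A \<in> obj C \<Longrightarrow> deflation E (id_arr C A)" by blast+
qed

lemma deflation_comp: "deflation E p \<Longrightarrow> deflation E q \<Longrightarrow> tgt C p = src C q \<Longrightarrow> deflation E (q \<cdot> p)"
proof -
  have "\<forall>p q. deflation E p \<and> deflation E q \<and> tgt C p = src C q \<longrightarrow> deflation E (q \<cdot> p)"
    using exact unfolding exact_structure_def by (elim conjE)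
  then show "deflation E p \<Longrightarrow> deflation E q \<Longrightarrow> tgt C p = src C q \<Longrightarrow> deflation E (q \<cdot> p)" by blast
qed

lemma pushout_ex:
  assumes "inflation E i" "f \<in> arr C" "src C f = src C i"
  obtains i' f' where "pushout_square C i f i' f'" "inflation E i'"
proof -
  have "\<forall>i f. inflation E i \<and> f \<in> arr C \<and> src C f = src C i \<longrightarrow>
      (\<exists>i' f'. pushout_square C i f i' f' \<and> inflation E i')"
    using exact unfolding exact_structure_def by (elim conjE)
  then show ?thesis using assms that by blast
qed

lemma pullback_ex:
  assumes "deflation E p" "f \<in> arr C" "tgt C f = tgt C p"
  obtains p' f' where "pullback_square C p f p' f'" "deflation E p'"
proof -
  have "\<forall>p f. deflation E p \<and> f \<in> arr C \<and> tgt C f = tgt C p \<longrightarrow>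
      (\<exists>p' f'. pullback_square C p f p' f' \<and> deflation E p')"
    using exact unfolding exact_structure_def by (elim conjE)
  then show ?thesis using assms that by blast
qed

lemma deflation_arr: "deflation E p \<Longrightarrow> p \<in> arr C"
  unfolding deflation_def using kernelD(2)[OF conflation_kernel] by blast

lemma deflation_epi:
  assumes "deflation E p" "x \<in> arr C" "y \<in> arr C" "tgt C x = tgt C y" "src C x = tgt C p" "src C y = tgt C p" "x \<cdot> p = y \<cdot> p"
  shows "x = y"
  using assms(1) cokernel_epi[OF conflation_cokernel assms(2-7)] unfolding deflation_def by blast

text \<open>
  An isomorphism of the right-hand squares induces one of the kernels.
\<close>

lemma conflation_iso_right:
  assumes E: "(i, p) \<in> E" and k: "kernel_cokernel_pair C i' p'"
    and b: "b \<in> arr C" "b' \<in> arr C" "src C b = tgt C i" "tgt C b = tgt C i'" "src C b' = tgt C i'" "tgt C b' = tgt C i"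
      "b' \<cdot> b = id_arr C (tgt C i)" "b \<cdot> b' = id_arr C (tgt C i')"
    and c: "c \<in> arr C" "c' \<in> arr C" "src C c = tgt C p" "tgt C c = tgt C p'" "src C c' = tgt C p'" "tgt C c' = tgt C p"
      "c' \<cdot> c = id_arr C (tgt C p)" "c \<cdot> c' = id_arr C (tgt C p')"
    and sq: "c \<cdot> p = p' \<cdot> b"
  shows "(i', p') \<in> E"
proof -
  have ker: "is_kernel C i p" by (rule conflation_kernel[OF E])
  have ker': "is_kernel C i' p'" using k unfolding kernel_cokernel_pair_def by auto
  note K = kernelD[OF ker] and K' = kernelD[OF ker']
  have "p' \<cdot> (b \<cdot> i) = c \<cdot> (p \<cdot> i)" using collapse[OF sq[symmetric], of i] K K' b c by simp
  also have "\<dots> = zero_arr C (src C (b \<cdot> i)) (tgt C p')" using K b c by simp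
  finally obtain a where a: "a \<in> arr C" "src C a = src C (b \<cdot> i)" "tgt C a = src C i'" "i' \<cdot> a = b \<cdot> i"
    using kernel_lift[OF ker', of "b \<cdot> i"] K K' b by auto
  have "p \<cdot> (b' \<cdot> i') = c' \<cdot> ((c \<cdot> p) \<cdot> (b' \<cdot> i'))" using collapse[OF c(7), of "p \<cdot> (b' \<cdot> i')"] K K' b c by simp
  also have "(c \<cdot> p) \<cdot> (b' \<cdot> i') = p' \<cdot> i'"
    unfolding sq using collapse[OF b(8), of i'] K K' b by simp
  also have "c' \<cdot> (p' \<cdot> i') = zero_arr C (src C (b' \<cdot> i')) (tgt C p)" using K' b c by simp
  finally obtain a' where a': "a' \<in> arr C" "src C a' = src C (b' \<cdot> i')" "tgt C a' = src C i" "i \<cdot> a' = b' \<cdot> i'"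
    using kernel_lift[OF ker, of "b' \<cdot> i'"] K K' b by auto
  have s: "src C a = src C i" "src C a' = src C i'" using a a' K K' b by auto
  have "i \<cdot> (a' \<cdot> a) = b' \<cdot> (i' \<cdot> a)" using collapse[OF a'(4), of a] a a' K K' b s by simp
  also have "\<dots> = i" unfolding a(4) using collapse[OF b(7), of i] K K' b by simp
  finally have e1: "i \<cdot> (a' \<cdot> a) = i" .
  have 1: "a' \<cdot> a = id_arr C (src C i)"
    by (rule kernel_mono[OF ker]) (use e1 a(1,3) a'(1,3) K s in simp_all)
  have "i' \<cdot> (a \<cdot> a') = b \<cdot> (i \<cdot> a')" using collapse[OF a(4), of a'] a a' K K' b s by simp
  also have "\<dots> = i'" unfolding a'(4) using collapse[OF b(8), of i'] K K' b by simp
  finally have e2: "i' \<cdot> (a \<cdot> a') = i'" .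
  have 2: "a \<cdot> a' = id_arr C (src C i')"
    by (rule kernel_mono[OF ker']) (use e2 a(1,3) a'(1,3) K' s in simp_all)
  have "iso_arr C a" by (rule iso_arrI[of _ a']) (use a a' s 1 2 in auto)
  moreover have "iso_arr C b" by (rule iso_arrI[of _ b']) (use b in auto)
  moreover have "iso_arr C c" by (rule iso_arrI[of _ c']) (use c in auto)
  ultimately have "pair_isomorphic C (i, p) (i', p')"
    unfolding pair_isomorphic_def using a b c s sq by (force simp: in_Hom)
  then show ?thesis by (rule conflation_iso[OF E k])
qed

text \<open>
  An isomorphism of the middle terms compatible with the inflations induces one of the cokernels.
\<close>

lemma conflation_iso_left:
  assumes E: "(i, p) \<in> E" and k: "kernel_cokernel_pair C i' p'"
    and b: "b \<in> arr C" "b' \<in> arr C" "src C b = tgt C i" "tgt C b = tgt C i'" "src C b' = tgt C i'" "tgt C b' = tgt C i"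
      "b' \<cdot> b = id_arr C (tgt C i)" "b \<cdot> b' = id_arr C (tgt C i')"
    and s: "src C i = src C i'" and sq: "b \<cdot> i = i'"
  shows "(i', p') \<in> E"
proof -
  have cok: "is_cokernel C p i" by (rule conflation_cokernel[OF E])
  have cok': "is_cokernel C p' i'" using k unfolding kernel_cokernel_pair_def by auto
  note K = cokernelD[OF cok] and K' = cokernelD[OF cok']
  have sq': "b' \<cdot> i' = i" unfolding sq[symmetric] using collapse[OF b(7), of i] K b by simp
  have "(p' \<cdot> b) \<cdot> i = zero_arr C (src C i) (tgt C (p' \<cdot> b))" using sq K K' b s by simp
  then obtain c where c: "c \<in> arr C" "src C c = tgt C p" "tgt C c = tgt C (p' \<cdot> b)" "c \<cdot> p = p' \<cdot> b"
    using cokernel_desc[OF cok, of "p' \<cdot> b"] K K' b by auto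
  have "(p \<cdot> b') \<cdot> i' = zero_arr C (src C i') (tgt C (p \<cdot> b'))" using sq' K K' b s by simp
  then obtain c' where c': "c' \<in> arr C" "src C c' = tgt C p'" "tgt C c' = tgt C (p \<cdot> b')" "c' \<cdot> p' = p \<cdot> b'"
    using cokernel_desc[OF cok', of "p \<cdot> b'"] K K' b by auto
  have t: "tgt C c = tgt C p'" "tgt C c' = tgt C p" using c c' K K' b by auto
  have "(c' \<cdot> c) \<cdot> p = c' \<cdot> (p' \<cdot> b)" using c c'(1,2) K K' b t by simp
  also have "\<dots> = p" using collapse[OF c'(4), of b] c'(1,2) b K K' by simp
  finally have e1: "(c' \<cdot> c) \<cdot> p = p" .
  have 1: "c' \<cdot> c = id_arr C (tgt C p)"
    by (rule cokernel_epi[OF cok]) (use e1 c(1,2) c'(1,2) K t in simp_all)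
  have "(c \<cdot> c') \<cdot> p' = c \<cdot> (p \<cdot> b')" using c(1,2) c' K K' b t by simp
  also have "\<dots> = p'" using collapse[OF c(4), of b'] c(1,2) b K K' by simp
  finally have e2: "(c \<cdot> c') \<cdot> p' = p'" .
  have 2: "c \<cdot> c' = id_arr C (tgt C p')"
    by (rule cokernel_epi[OF cok']) (use e2 c(1,2) c'(1,2) K' t in simp_all)
  show ?thesis
    by (rule conflation_iso_right[OF E k b c(1) c'(1)]) (use c c' t 1 2 in auto)
qed

text \<open>
  A biproduct projection is the pullback of a deflation onto a zero object, hence a deflation.
\<close>

lemma split_conflation:
  assumes b: "biproduct C M A B i1 i2 p1 p2" shows "(i1, p2) \<in> E"
proof -
  note B = biproductD[OF b]
  (* the cokernel of the identity of A is a deflation onto a zero object *)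
  obtain q where q: "(id_arr C A, q) \<in> E" using inflation_id B unfolding inflation_def by blast
  note Q = cokernelD[OF conflation_cokernel[OF q]]
  let ?Q = "tgt C q"
  have q0: "src C q = A" "q = zero_arr C A ?Q" using Q B(18-20) by auto
  have Qo: "?Q \<in> obj C" using Q by simp
  have all0: "x \<cdot> q = y \<cdot> q" if "x \<in> arr C" "y \<in> arr C" "src C x = ?Q" "src C y = ?Q" "tgt C x = tgt C y" for x y
    using q0(2) that B(18-20) Qo by (metis comp_zero(1))
  have zq: "id_arr C ?Q = zero_arr C ?Q ?Q"
    by (rule cokernel_epi[OF conflation_cokernel[OF q]]) (use Qo all0[of "id_arr C ?Q" "zero_arr C ?Q ?Q"] in auto)
  then have ZQ: "zero_object C ?Q" using Qo by (simp add: zero_object_iff)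
  have dq: "deflation E q" using q unfolding deflation_def by blast
  obtain p' f' where P: "pullback_square C q (zero_arr C B ?Q) p' f'" "deflation E p'"
    using pullback_ex[OF dq, of "zero_arr C B ?Q"] B(18-20) Qo by auto
  note D = pullbackD[OF P(1)]
  have D': "tgt C p' = B" "tgt C f' = A" using D q0 B(18-20) Qo by auto
  have "q \<cdot> p1 = zero_arr C B ?Q \<cdot> p2"
  proof -
    have "q \<cdot> p1 = zero_arr C M ?Q" using zero_object_arr(1)[OF ZQ, of "q \<cdot> p1" M] B Q q0 by (simp add: in_Hom)
    then show ?thesis using B Qo by simp
  qed
  then obtain u where u: "u \<in> arr C" "src C u = M" "tgt C u = src C p'" "p' \<cdot> u = p2" "f' \<cdot> u = p1"
    using pullback_lift[OF P(1), of p2 p1] B Q q0 Qo by auto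
  define w where "w = i1 \<cdot> f' \<boxplus> i2 \<cdot> p'"
  have w: "w \<in> arr C" "src C w = src C p'" "tgt C w = M" unfolding w_def using B(1-12) D(3,4,8) D' by simp_all
  have pw: "p1 \<cdot> w = f'" "p2 \<cdot> w = p'" unfolding w_def by (rule biproduct_inj[OF b]; use D(3,4,8) D' in simp)+
  have wu: "w \<cdot> u = id_arr C M"
  proof -
    have "w \<cdot> u = (i1 \<cdot> f') \<cdot> u \<boxplus> (i2 \<cdot> p') \<cdot> u"
      unfolding w_def by (rule comp_add(2)) (use B(1-12) D D' u in simp_all)
    then show ?thesis using B D D' u by simp
  qed
  have uw: "u \<cdot> w = id_arr C (src C p')"
  proof (rule pullback_joint_mono[OF P(1)])
    show "p' \<cdot> (u \<cdot> w) = p' \<cdot> id_arr C (src C p')" using collapse[OF u(4), of w] pw u w D(3,4,6-8) D' by simp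
    show "f' \<cdot> (u \<cdot> w) = f' \<cdot> id_arr C (src C p')" using collapse[OF u(5), of w] pw u w D(3,4,6-8) D' by simp
  qed (use u w D(3,4,6-8) D' in simp_all)
  obtain j where j: "(j, p') \<in> E" using P(2) unfolding deflation_def by blast
  have tj: "tgt C j = src C p'" using kernelD(3)[OF conflation_kernel[OF j]] .
  show ?thesis
    by (rule conflation_iso_right[OF j kcp_biproduct[OF b], of w u "id_arr C B" "id_arr C B"])
      (use w u wu uw tj B D(3,4,6-8) D' pw in simp_all)
qed

lemma split_epi_deflation:
  assumes "retract V P s f" shows "deflation E f"
proof -
  obtain B i2 p2 where "biproduct C P V B s i2 f p2" using retract_biproduct[OF idem assms] .
  from split_conflation[OF biproduct_swap[OF this]] show ?thesis unfolding deflation_def by blast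
qed

lemma split_structure_subset: "split_structure C \<subseteq> E"
  unfolding split_structure_def using split_conflation by blast

text \<open>
  Quillen's obscure axiom.  Pulling back \<open>v\<close> along \<open>p\<close> gives a deflation \<open>p'\<close> such that \<open>p p'\<close> is also a
  deflation, because the other projection is a split epimorphism.  Then \<open>i\<close> is the pushout of the kernel of
  \<open>p p'\<close> along the pullback of \<open>p'\<close> to the source of \<open>i\<close>.
\<close>

lemma conflation_if_factor_deflation:
  assumes k: "kernel_cokernel_pair C i p" and v: "deflation E v" and w: "w \<in> arr C" "src C w = src C v" "tgt C w = src C p"
    and vw: "p \<cdot> w = v"
  shows "(i, p) \<in> E"
proof -
  have ker: "is_kernel C i p" using k unfolding kernel_cokernel_pair_def by auto
  note K = kernelD[OF ker]
  have V: "v \<in> arr C" "tgt C v = tgt C p" using deflation_arr[OF v] vw K w by auto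
  obtain p' f' where P: "pullback_square C v p p' f'" "deflation E p'" using pullback_ex[OF v, of p] K V by auto
  note D = pullbackD[OF P(1)]
  have pre: "w \<in> arr C" "id_arr C (src C v) \<in> arr C" "tgt C w = src C p" "tgt C (id_arr C (src C v)) = src C v"
    "src C w = src C (id_arr C (src C v))" "v \<cdot> id_arr C (src C v) = p \<cdot> w"
    using w V vw by simp_all
  obtain s where s: "s \<in> arr C" "src C s = src C w" "tgt C s = src C p'" "p' \<cdot> s = w" "f' \<cdot> s = id_arr C (src C v)"
    using pullback_lift[OF P(1) pre] .
  have "retract (src C v) (src C f') s f'" unfolding retract_def using s D w by (auto simp: in_Hom)
  then have "deflation E f'" by (rule split_epi_deflation)
  then have "deflation E (v \<cdot> f')" by (rule deflation_comp[OF _ v]) (use D in simp)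
  then have pp': "deflation E (p \<cdot> p')" using D(9) by simp
  (* k is the kernel of p p', and i is its pushout along l *)
  obtain l k where L: "pullback_square C p' i l k" "deflation E l" using pullback_ex[OF P(2), of i] K D by auto
  note F = pullbackD[OF L(1)]
  have kk: "is_kernel C k (p \<cdot> p')" unfolding is_kernel_def
  proof (intro conjI ballI impI)
    have "p \<cdot> (p' \<cdot> k) = p \<cdot> (i \<cdot> l)" using F by simp
    also have "\<dots> = zero_arr C (src C l) (tgt C p)" using collapse[OF K(4), of l] F K by simp
    finally show "(p \<cdot> p') \<cdot> k = zero_arr C (src C k) (tgt C (p \<cdot> p'))" using F K D by simp
    fix f assume f: "f \<in> arr C" "tgt C f = src C (p \<cdot> p') \<and> (p \<cdot> p') \<cdot> f = zero_arr C (src C f) (tgt C (p \<cdot> p'))"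
    then have f': "tgt C f = src C p'" "p \<cdot> (p' \<cdot> f) = zero_arr C (src C (p' \<cdot> f)) (tgt C p)" using D K by auto
    obtain g where g: "g \<in> arr C" "src C g = src C (p' \<cdot> f)" "tgt C g = src C i" "i \<cdot> g = p' \<cdot> f"
      using kernel_lift[OF ker _ _ f'(2)] f f' D by auto
    have pre: "g \<in> arr C" "f \<in> arr C" "tgt C g = src C i" "tgt C f = src C p'" "src C g = src C f" "p' \<cdot> f = i \<cdot> g"
      using g f f' D(1-8) by simp_all
    obtain u where u: "u \<in> arr C" "src C u = src C g" "tgt C u = src C l" "l \<cdot> u = g" "k \<cdot> u = f"
      using pullback_lift[OF L(1) pre] .
    show "\<exists>!g. g \<in> Hom C (src C f) (src C k) \<and> k \<cdot> g = f"
    proof (rule ex1I[of _ u])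
      show "u \<in> Hom C (src C f) (src C k) \<and> k \<cdot> u = f" using u pre(5) F(8) by (simp add: in_Hom)
      fix u' assume u': "u' \<in> Hom C (src C f) (src C k) \<and> k \<cdot> u' = f"
      have U': "u' \<in> arr C" "src C u' = src C u" "tgt C u' = src C l" "k \<cdot> u' = k \<cdot> u"
        using u u' pre(5) F(8) by (simp_all add: in_Hom)
      have "i \<cdot> (l \<cdot> u') = i \<cdot> (l \<cdot> u)"
        using collapse[OF F(9), of u'] collapse[OF F(9), of u] U' u F by simp
      then have "l \<cdot> u' = l \<cdot> u" by (rule kernel_mono[OF ker, rotated 5]) (use U' u F g(1,3) in simp_all)
      then show "u' = u" by (rule pullback_joint_mono[OF L(1), rotated 5]) (use U' u g(1,3) in simp_all)
    qed
  qed (use F D K in auto)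
  obtain k0 where k0: "(k0, p \<cdot> p') \<in> E" using pp' unfolding deflation_def by blast
  note kk0 = conflation_kernel[OF k0]
  have "kernel_cokernel_pair C k (p \<cdot> p')"
    using kk cokernel_of_other_kernel[OF kk0 kk conflation_cokernel[OF k0]] unfolding kernel_cokernel_pair_def by simp
  then have "(k, p \<cdot> p') \<in> E"
    by (rule conflation_iso_right[OF k0, of _ _ "id_arr C (src C p')" "id_arr C (src C p')" "id_arr C (tgt C p)" "id_arr C (tgt C p)"])
      (use kernelD[OF kk0] K D F in simp_all)
  then have "inflation E k" unfolding inflation_def by blast
  then obtain i' f'' where O: "pushout_square C k l i' f''" "inflation E i'"
    using pushout_ex[of k l] F by auto
  note G = pushoutD[OF O(1)]
  have pre: "i \<in> arr C" "p' \<in> arr C" "src C i = tgt C l" "src C p' = tgt C k" "tgt C i = tgt C p'" "p' \<cdot> k = i \<cdot> l"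
    using K D(3,7,8) D(6) F by simp_all
  (* the comparison map from the pushout; its inverse t exists because f'' kills the kernel n of p' *)
  obtain u where u: "u \<in> arr C" "src C u = tgt C i'" "tgt C u = tgt C i" "u \<cdot> i' = i" "u \<cdot> f'' = p'"
    using pushout_desc[OF O(1) pre] .
  obtain n where n: "(n, p') \<in> E" using P(2) unfolding deflation_def by blast
  note N = kernelD[OF conflation_kernel[OF n]]
  define Z Y X Y' L Q M where defs: "Z = src C i" "Y = src C p" "X = tgt C p" "Y' = src C p'" "L = src C l" "Q = tgt C i'" "M = src C n"
  have H: "src C i = Z" "tgt C i = Y" "src C p = Y" "tgt C p = X" "src C p' = Y'" "tgt C p' = Y" "src C l = L" "tgt C l = Z"
    "src C k = L" "tgt C k = Y'" "src C i' = Z" "tgt C i' = Q" "src C f'' = Y'" "tgt C f'' = Q"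
    "src C n = M" "tgt C n = Y'" "src C u = Q" "tgt C u = Y"
    unfolding defs by (simp_all only: K(3) D(6) F(6,7) G(5-8) N(3) u(2,3))
  have A: "i \<in> arr C" "p \<in> arr C" "p' \<in> arr C" "l \<in> arr C" "k \<in> arr C" "i' \<in> arr C" "f'' \<in> arr C" "n \<in> arr C" "u \<in> arr C"
    by (rule K(1) K(2) D(3) F(3) F(4) G(3) G(4) N(1) u(1))+
  have R: "p' \<cdot> k = i \<cdot> l" "f'' \<cdot> k = i' \<cdot> l" "u \<cdot> i' = i" "u \<cdot> f'' = p'"
    by (rule F(9) G(9) u(4) u(5))+
  have obs: "Z \<in> obj C" "Y \<in> obj C" "Y' \<in> obj C" "X \<in> obj C" "M \<in> obj C" "Q \<in> obj C" unfolding defs using A by simp_all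
  have pn: "p' \<cdot> n = zero_arr C M Y" using N(4) H by simp
  have ppn: "(p \<cdot> p') \<cdot> n = zero_arr C (src C n) (tgt C (p \<cdot> p'))"
    using pn H A obs by simp
  have tn: "tgt C n = src C (p \<cdot> p')" using H A by simp
  obtain n' where n': "n' \<in> arr C" "src C n' = src C n" "tgt C n' = src C k" "k \<cdot> n' = n"
    using kernel_lift[OF kk A(8) tn ppn] .
  have H': "src C n' = M" "tgt C n' = L" using n' H by simp_all
  have "i \<cdot> (l \<cdot> n') = p' \<cdot> n" using collapse[OF R(1), of n'] n'(1,4) H H' A by simp
  also have "\<dots> = i \<cdot> zero_arr C M Z" using pn H A obs by simp
  finally have ln: "l \<cdot> n' = zero_arr C M Z"
    by (rule kernel_mono[OF ker, rotated 5]) (use n'(1) H H' A obs in simp_all)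
  have fn: "f'' \<cdot> n = zero_arr C (src C n) (tgt C f'')"
    using collapse[OF R(2), of n'] n'(1,4) ln H H' A obs by simp
  have sf: "src C f'' = src C p'" using H by simp
  obtain t where t: "t \<in> arr C" "src C t = tgt C p'" "tgt C t = tgt C f''" "t \<cdot> p' = f''"
    using cokernel_desc[OF conflation_cokernel[OF n] A(7) sf fn] .
  have T: "src C t = Y" "tgt C t = Q" using t H by simp_all
  have "(u \<cdot> t) \<cdot> p' = id_arr C Y \<cdot> p'" using t(1,4) R(4) T H A by simp
  then have ut: "u \<cdot> t = id_arr C Y" by (rule deflation_epi[OF P(2), rotated 5]) (use t(1) T H A obs in simp_all)
  have "(t \<cdot> i) \<cdot> l = t \<cdot> (p' \<cdot> k)" using R(1) t(1) T H A by simp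
  also have "\<dots> = i' \<cdot> l" using collapse[OF t(4), of k] t(1) R(2) T H A by simp
  finally have ti: "t \<cdot> i = i'" by (rule deflation_epi[OF L(2), rotated 5]) (use t(1) T H A in simp_all)
  have tu: "t \<cdot> u = id_arr C Q"
    by (rule pushout_joint_epi[OF O(1)]) (use t(1,4) R ti T H A obs in simp_all)
  obtain q where q: "(i', q) \<in> E" using O(2) unfolding inflation_def by blast
  show ?thesis
    by (rule conflation_iso_left[OF q k, of u t]) (use t(1) R tu ut T H A in simp_all)
qed

end

section \<open>Relative projectives detect missing conflations\<close>

context exact_category begin

text \<open>
  Lifting through \<open>p\<close> after a cover of the source, where the deflations are the covers.
\<close>

definition locally_lifts :: "'m \<Rightarrow> 'm \<Rightarrow> bool" where
  "locally_lifts p f \<longleftrightarrow> (\<exists>v w. deflation E v \<and> tgt C v = src C f \<and>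
     w \<in> arr C \<and> src C w = src C v \<and> tgt C w = src C p \<and> f \<cdot> v = p \<cdot> w)"

lemma locally_lifts_deflation:
  assumes v: "deflation E v" "tgt C v = src C f" and f: "f \<in> arr C" and l: "locally_lifts p (f \<cdot> v)"
  shows "locally_lifts p f"
proof -
  have V: "v \<in> arr C" by (rule deflation_arr[OF v(1)])
  obtain v' w where w: "deflation E v'" "tgt C v' = src C (f \<cdot> v)" "w \<in> arr C" "src C w = src C v'" "tgt C w = src C p"
    "(f \<cdot> v) \<cdot> v' = p \<cdot> w" using l unfolding locally_lifts_def by blast
  have V': "v' \<in> arr C" by (rule deflation_arr[OF w(1)])
  have t: "tgt C v' = src C v" using w(2) V f v by simp
  have "deflation E (v \<cdot> v')" by (rule deflation_comp[OF w(1) v(1) t])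
  moreover have "f \<cdot> (v \<cdot> v') = p \<cdot> w" using w(6) V V' f t v(2) by simp
  ultimately show ?thesis unfolding locally_lifts_def
    using w V V' t v(2) by (intro exI[of _ "v \<cdot> v'"] exI[of _ w]) simp
qed

lemma locally_lifts_lift:
  assumes "f \<in> arr C" "w \<in> arr C" "src C w = src C f" "tgt C w = src C p" "p \<cdot> w = f"
  shows "locally_lifts p f"
  unfolding locally_lifts_def using deflation_id[of "src C f"] assms
  by (intro exI[of _ "id_arr C (src C f)"] exI[of _ w]) simp

lemma locally_lifts_zero:
  assumes "p \<in> arr C" "U \<in> obj C" shows "locally_lifts p (zero_arr C U (tgt C p))"
  by (rule locally_lifts_lift[of _ "zero_arr C U (src C p)"]) (use assms in simp_all)

text \<open>
  The two local lifts are glued over a common refinement of the two covers, which is an iterated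
  pullback.
\<close>

lemma locally_lifts_sum:
  assumes b: "biproduct C U A B i1 i2 p1 p2" and f: "f \<in> arr C" "src C f = U" "tgt C f = tgt C p" and p: "p \<in> arr C"
    and l: "locally_lifts p (f \<cdot> i1)" "locally_lifts p (f \<cdot> i2)"
  shows "locally_lifts p f"
proof -
  note B = biproductD[OF b]
  obtain v1 w1 where 1: "deflation E v1" "tgt C v1 = src C (f \<cdot> i1)" "w1 \<in> arr C" "src C w1 = src C v1" "tgt C w1 = src C p"
    "(f \<cdot> i1) \<cdot> v1 = p \<cdot> w1" using l(1) unfolding locally_lifts_def by blast
  obtain v2 w2 where 2: "deflation E v2" "tgt C v2 = src C (f \<cdot> i2)" "w2 \<in> arr C" "src C w2 = src C v2" "tgt C w2 = src C p"
    "(f \<cdot> i2) \<cdot> v2 = p \<cdot> w2" using l(2) unfolding locally_lifts_def by blast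
  have V: "v1 \<in> arr C" "v2 \<in> arr C" using 1 2 deflation_arr by auto
  have t1: "tgt C v1 = A" using 1(2) f B by simp
  have t2: "tgt C v2 = B" using 2(2) f B by simp
  have fv1: "f \<cdot> (i1 \<cdot> v1) = p \<cdot> w1" and fv2: "f \<cdot> (i2 \<cdot> v2) = p \<cdot> w2"
    using 1(6) 2(6) V t1 t2 B(1-12) f by simp_all
  have "tgt C p1 = tgt C v1" using B t1 by simp
  from pullback_ex[OF 1(1) B(3) this] obtain s a where P1: "pullback_square C v1 p1 s a" "deflation E s" .
  note D1 = pullbackD[OF P1(1)]
  have S: "s \<in> arr C" "a \<in> arr C" "tgt C s = U" "tgt C a = src C v1" "src C s = src C a" "v1 \<cdot> a = p1 \<cdot> s"
    using D1 B by simp_all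
  have "p2 \<cdot> s \<in> arr C" "tgt C (p2 \<cdot> s) = tgt C v2" using S B t2 by simp_all
  from pullback_ex[OF 2(1) this] obtain t c where P2: "pullback_square C v2 (p2 \<cdot> s) t c" "deflation E t" .
  note D2 = pullbackD[OF P2(1)]
  have T: "t \<in> arr C" "c \<in> arr C" "tgt C t = src C a" "tgt C c = src C v2" "src C t = src C c" "v2 \<cdot> c = (p2 \<cdot> s) \<cdot> t"
    using D2 S B by simp_all
  have d: "deflation E (s \<cdot> t)" by (rule deflation_comp[OF P2(2) P1(2)]) (use T S in simp)
  let ?w = "w1 \<cdot> (a \<cdot> t) \<boxplus> w2 \<cdot> c"
  have W: "?w \<in> arr C" "src C ?w = src C c" "tgt C ?w = src C p" using 1(3-5) 2(3-5) S(1-5) T(1-5) by simp_all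
  have st: "i1 \<cdot> (p1 \<cdot> (s \<cdot> t)) \<boxplus> i2 \<cdot> (p2 \<cdot> (s \<cdot> t)) = s \<cdot> t"
    by (rule biproduct_decompose(1)[OF b]) (use S T in simp_all)
  have "f \<cdot> (s \<cdot> t) = f \<cdot> (i1 \<cdot> (p1 \<cdot> (s \<cdot> t)) \<boxplus> i2 \<cdot> (p2 \<cdot> (s \<cdot> t)))" unfolding st ..
  also have "\<dots> = f \<cdot> (i1 \<cdot> (p1 \<cdot> (s \<cdot> t))) \<boxplus> f \<cdot> (i2 \<cdot> (p2 \<cdot> (s \<cdot> t)))"
    by (rule comp_add(1)) (use B(1-12) S(1-5) T(1-5) f in simp_all)
  also have "p1 \<cdot> (s \<cdot> t) = v1 \<cdot> (a \<cdot> t)" using collapse[OF S(6)[symmetric], of t] S(1-5) T(1-5) B(1-12) V t1 by simp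
  also have "p2 \<cdot> (s \<cdot> t) = v2 \<cdot> c" using T(6) S(1-5) T(1-5) B(1-12) by simp
  also have "f \<cdot> (i1 \<cdot> (v1 \<cdot> (a \<cdot> t))) = p \<cdot> (w1 \<cdot> (a \<cdot> t))"
    using collapse[OF fv1, of "a \<cdot> t"] S(1-5) T(1-5) B(1-12) V t1 f 1(3-5) p by simp
  also have "f \<cdot> (i2 \<cdot> (v2 \<cdot> c)) = p \<cdot> (w2 \<cdot> c)"
    using collapse[OF fv2, of c] S(1-5) T(1-5) B(1-12) V t2 f 2(3-5) p by simp
  also have "p \<cdot> (w1 \<cdot> (a \<cdot> t)) \<boxplus> p \<cdot> (w2 \<cdot> c) = p \<cdot> ?w"
    by (rule comp_add(1)[symmetric]) (use 1(3-5) 2(3-5) S(1-5) T(1-5) p in simp_all)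
  finally have eq: "f \<cdot> (s \<cdot> t) = p \<cdot> ?w" .
  show ?thesis unfolding locally_lifts_def
    by (rule exI[of _ "s \<cdot> t"], rule exI[of _ ?w]) (use d W eq S(1-5) T(1-5) f in \<open>simp del: comp_add\<close>)
qed

lemma not_locally_lifts_summand:
  assumes "direct_sum_list C U Us" "f \<in> arr C" "src C f = U" "tgt C f = tgt C p" "p \<in> arr C"
    and "\<not> locally_lifts p f"
  shows "\<exists>N\<in>set Us. \<exists>s\<in>Hom C N U. \<not> locally_lifts p (f \<cdot> s)"
  using assms
proof (induction Us arbitrary: U f)
  case Nil
  then have Z: "zero_object C U" by simp
  then have "f = zero_arr C U (tgt C p)" using zero_object_arr(2)[OF Z, of f "tgt C p"] Nil by (simp add: in_Hom)
  then show ?case using locally_lifts_zero[of p U] Nil Z by (simp add: zero_object_def)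
next
  case (Cons A As)
  then obtain N where N: "direct_sum C U A N" "direct_sum_list C N As" by auto
  then obtain i1 i2 p1 p2 where b: "biproduct C U A N i1 i2 p1 p2" unfolding direct_sum_def by blast
  note B = biproductD[OF b]
  show ?case
  proof (cases "locally_lifts p (f \<cdot> i1)")
    case False
    moreover have "i1 \<in> Hom C A U" using B by (simp add: in_Hom)
    ultimately show ?thesis by auto
  next
    case True
    then have n: "\<not> locally_lifts p (f \<cdot> i2)"
      using locally_lifts_sum[OF b Cons.prems(2-5)] Cons.prems(6) by blast
    have "\<exists>M\<in>set As. \<exists>s\<in>Hom C M N. \<not> locally_lifts p ((f \<cdot> i2) \<cdot> s)"
      by (rule Cons.IH[OF N(2) _ _ _ Cons.prems(5) n]) (use B Cons.prems in simp_all)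
    then obtain M s where M: "M \<in> set As" "s \<in> Hom C M N" "\<not> locally_lifts p ((f \<cdot> i2) \<cdot> s)" by blast
    have "(f \<cdot> i2) \<cdot> s = f \<cdot> (i2 \<cdot> s)" using M(2) B(1-12) Cons.prems(2,3) by (simp add: in_Hom)
    moreover have "i2 \<cdot> s \<in> Hom C M U" using M(2) B(1-12) by (simp add: in_Hom)
    ultimately show ?thesis using M by auto
  qed
qed

definition projective :: "'o \<Rightarrow> bool" where
  "projective U \<longleftrightarrow> U \<in> obj C \<and> (\<forall>v. deflation E v \<and> tgt C v = U \<longrightarrow> (\<exists>s\<in>Hom C U (src C v). v \<cdot> s = id_arr C U))"

lemma projective_lift:
  assumes U: "projective U" and d: "deflation E p" and g: "g \<in> Hom C U (tgt C p)"
  shows "\<exists>w\<in>Hom C U (src C p). p \<cdot> w = g"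
proof -
  have G: "g \<in> arr C" "src C g = U" "tgt C g = tgt C p" using g by (auto simp: in_Hom)
  obtain p' f' where P: "pullback_square C p g p' f'" "deflation E p'" using pullback_ex[OF d G(1,3)] .
  note D = pullbackD[OF P(1)]
  obtain s where s: "s \<in> Hom C U (src C p')" "p' \<cdot> s = id_arr C U"
    using U P(2) D(6) G(2) unfolding projective_def by metis
  have S: "s \<in> arr C" "src C s = U" "tgt C s = src C p'" using s(1) by (auto simp: in_Hom)
  have "p \<cdot> (f' \<cdot> s) = g \<cdot> (p' \<cdot> s)" using collapse[OF D(9), of s] D(1-8) S G by simp
  then have "p \<cdot> (f' \<cdot> s) = g" using s(2) G by simp
  moreover have "f' \<cdot> s \<in> Hom C U (src C p)" using S D(3,4,7,8) by (simp add: in_Hom)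
  ultimately show ?thesis by blast
qed

text \<open>
  The fibres of composition with \<open>p\<close> are cosets of the maps that factor through the kernel.
\<close>

lemma card_Hom_left_exact:
  assumes k: "is_kernel C i p" and U: "U \<in> obj C"
  shows "card (Hom C U (src C p)) = card (Hom C U (src C i)) * card ((\<lambda>g. p \<cdot> g) ` Hom C U (src C p))"
proof -
  note K = kernelD[OF k]
  let ?Y = "Hom C U (src C p)"
  have fib: "card {g \<in> ?Y. p \<cdot> g = h} = card (Hom C U (src C i))" if hh: "h \<in> (\<lambda>g. p \<cdot> g) ` ?Y" for h
  proof -
    obtain g where g: "g \<in> ?Y" "h = p \<cdot> g" using hh by blast
    have G: "g \<in> arr C" "src C g = U" "tgt C g = src C p" using g(1) by (auto simp: in_Hom)
    have "bij_betw (\<lambda>x. g \<boxplus> i \<cdot> x) (Hom C U (src C i)) {g' \<in> ?Y. p \<cdot> g' = h}"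
      unfolding bij_betw_def
    proof (intro conjI equalityI subsetI inj_onI)
      fix x y assume x: "x \<in> Hom C U (src C i)" and y: "y \<in> Hom C U (src C i)" and e: "g \<boxplus> i \<cdot> x = g \<boxplus> i \<cdot> y"
      have X: "x \<in> arr C" "src C x = U" "tgt C x = src C i" "y \<in> arr C" "src C y = U" "tgt C y = src C i"
        using x y by (auto simp: in_Hom)
      have "i \<cdot> x = i \<cdot> y"
        using iffD1[OF add_arr_cancel(2)[of "i \<cdot> x" "i \<cdot> y" g]] e X G K(1-3) by simp
      then show "x = y" by (rule kernel_mono[OF k, rotated 5]) (use X in simp_all)
    next
      fix g' assume "g' \<in> (\<lambda>x. g \<boxplus> i \<cdot> x) ` Hom C U (src C i)"
      then obtain x where x: "x \<in> Hom C U (src C i)" "g' = g \<boxplus> i \<cdot> x" by blast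
      have X: "x \<in> arr C" "src C x = U" "tgt C x = src C i" using x by (auto simp: in_Hom)
      show "g' \<in> {g' \<in> ?Y. p \<cdot> g' = h}"
        using X G K x(2) g(2) collapse[OF K(4), of x] by (simp add: in_Hom)
    next
      fix g' assume g': "g' \<in> {g' \<in> ?Y. p \<cdot> g' = h}"
      then obtain x where x: "x \<in> ?Y" "g \<boxplus> x = g'" using diff_arr_ex[OF g(1), of g'] by blast
      have X: "x \<in> arr C" "src C x = U" "tgt C x = src C p" using x(1) by (auto simp: in_Hom)
      have "p \<cdot> (g \<boxplus> x) = p \<cdot> g" unfolding x(2) using g' g(2) by simp
      then have "p \<cdot> g \<boxplus> p \<cdot> x = p \<cdot> g \<boxplus> zero_arr C U (tgt C p)" using X G K by simp
      moreover have "p \<cdot> x \<in> arr C" "zero_arr C U (tgt C p) \<in> arr C" "p \<cdot> g \<in> arr C"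
        "src C (p \<cdot> x) = src C (p \<cdot> g)" "tgt C (p \<cdot> x) = tgt C (p \<cdot> g)"
        "src C (zero_arr C U (tgt C p)) = src C (p \<cdot> g)" "tgt C (zero_arr C U (tgt C p)) = tgt C (p \<cdot> g)"
        using X G K(2) U by simp_all
      ultimately have "p \<cdot> x = zero_arr C U (tgt C p)"
        using add_arr_cancel(2)[of "p \<cdot> x" "zero_arr C U (tgt C p)" "p \<cdot> g"] by blast
      then have px: "p \<cdot> x = zero_arr C (src C x) (tgt C p)" using X(2) by simp
      obtain y where y: "y \<in> arr C" "src C y = src C x" "tgt C y = src C i" "i \<cdot> y = x"
        using kernel_lift[OF k X(1,3) px] .
      have "g' = g \<boxplus> i \<cdot> y" unfolding y(4) x(2) ..
      moreover have "y \<in> Hom C U (src C i)" using y(1-3) X(2) by (simp add: in_Hom)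
      ultimately show "g' \<in> (\<lambda>x. g \<boxplus> i \<cdot> x) ` Hom C U (src C i)" by blast
    qed
    from bij_betw_same_card[OF this] show ?thesis by simp
  qed
  have "?Y = (\<Union>h\<in>(\<lambda>g. p \<cdot> g) ` ?Y. {g \<in> ?Y. p \<cdot> g = h})" by blast
  then have "card ?Y = card (\<Union>h\<in>(\<lambda>g. p \<cdot> g) ` ?Y. {g \<in> ?Y. p \<cdot> g = h})" by simp
  also have "\<dots> = (\<Sum>h\<in>(\<lambda>g. p \<cdot> g) ` ?Y. card {g \<in> ?Y. p \<cdot> g = h})"
    by (rule card_UN_disjoint) (use fin_Hom in auto)
  also have "\<dots> = (\<Sum>h\<in>(\<lambda>g. p \<cdot> g) ` ?Y. card (Hom C U (src C i)))"
    by (rule sum.cong[OF refl fib])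
  finally show ?thesis by (simp add: mult.commute)
qed

lemma card_image_comp_pos:
  assumes "p \<in> arr C" "U \<in> obj C" shows "card ((\<lambda>g. p \<cdot> g) ` Hom C U (src C p)) > 0"
  using fin_Hom[of U "src C p"] card_Hom_pos[of U "src C p"] assms by (simp add: card_gt_0_iff)

lemma log_card_left_exact:
  assumes k: "is_kernel C i p" and U: "U \<in> obj C"
  shows "log_card U (src C p) = log_card U (src C i) + ln (real (card ((\<lambda>g. p \<cdot> g) ` Hom C U (src C p))))"
proof -
  note K = kernelD[OF k]
  have "card (Hom C U (src C i)) > 0" "card ((\<lambda>g. p \<cdot> g) ` Hom C U (src C p)) > 0"
    using card_Hom_pos U K card_image_comp_pos by simp_all
  then show ?thesis unfolding log_card_def card_Hom_left_exact[OF assms] of_nat_mult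
    by (subst ln_mult) simp_all
qed

lemma log_card_subadditive:
  assumes k: "is_kernel C i p" and U: "U \<in> obj C"
  shows "log_card U (src C p) \<le> log_card U (src C i) + log_card U (tgt C p)"
proof -
  note K = kernelD[OF k]
  have "(\<lambda>g. p \<cdot> g) ` Hom C U (src C p) \<subseteq> Hom C U (tgt C p)" using K(2) by (auto simp: in_Hom)
  then have "card ((\<lambda>g. p \<cdot> g) ` Hom C U (src C p)) \<le> card (Hom C U (tgt C p))" by (rule card_mono[OF fin_Hom])
  then show ?thesis using card_image_comp_pos[OF K(2) U] unfolding log_card_left_exact[OF assms] log_card_def[of U "tgt C p"] by simp
qed

text \<open>
  For projective \<open>U\<close>, \<open>log_card U\<close> is additive on the conflations of \<open>E\<close>; by \<open>log_card_strict\<close> it fails to be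
  additive on a kernel-cokernel pair along which some map from \<open>U\<close> does not lift.
\<close>

lemma log_card_projective:
  assumes U: "projective U" and E: "(i, p) \<in> E"
  shows "log_card U (src C p) = log_card U (src C i) + log_card U (tgt C p)"
proof -
  have Uo: "U \<in> obj C" using U by (simp add: projective_def)
  note K = kernelD[OF conflation_kernel[OF E]]
  have d: "deflation E p" using E unfolding deflation_def by blast
  have "(\<lambda>g. p \<cdot> g) ` Hom C U (src C p) = Hom C U (tgt C p)"
  proof (intro equalityI subsetI)
    fix x assume "x \<in> Hom C U (tgt C p)"
    from projective_lift[OF U d this] show "x \<in> (\<lambda>g. p \<cdot> g) ` Hom C U (src C p)" by auto
  qed (use K(2) in \<open>auto simp: in_Hom\<close>)
  then show ?thesis using log_card_left_exact[OF conflation_kernel[OF E] Uo] unfolding log_card_def[of U "tgt C p"] by simp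
qed

lemma log_card_strict:
  assumes k: "is_kernel C i p" and U: "U \<in> obj C"
    and f: "f \<in> Hom C U (tgt C p)" "\<not> (\<exists>w\<in>Hom C U (src C p). p \<cdot> w = f)"
  shows "log_card U (src C p) < log_card U (src C i) + log_card U (tgt C p)"
proof -
  note K = kernelD[OF k]
  have "(\<lambda>g. p \<cdot> g) ` Hom C U (src C p) \<subseteq> Hom C U (tgt C p)" using K(2) by (auto simp: in_Hom)
  moreover have "f \<notin> (\<lambda>g. p \<cdot> g) ` Hom C U (src C p)" using f(2) by blast
  ultimately have "(\<lambda>g. p \<cdot> g) ` Hom C U (src C p) \<subset> Hom C U (tgt C p)" using f(1) by blast
  then have "card ((\<lambda>g. p \<cdot> g) ` Hom C U (src C p)) < card (Hom C U (tgt C p))" by (rule psubset_card_mono[OF fin_Hom])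
  then show ?thesis using card_image_comp_pos[OF K(2) U] unfolding log_card_left_exact[OF assms(1,2)] log_card_def[of U "tgt C p"] by simp
qed

end

locale exact_krull_schmidt = krull_schmidt K C + exact_category K C E
  for K :: "('k, 'x) ring_scheme" and C :: "('o, 'm, 'k) lincat" and E :: "('m \<times> 'm) set"
begin

text \<open>
  A map that does not lift locally and is minimal for the number of its multiples has a projective
  source.
\<close>

lemma projective_detects:
  assumes k: "kernel_cokernel_pair C i p" and nE: "(i, p) \<notin> E"
  shows "\<exists>U f. projective U \<and> f \<in> Hom C U (tgt C p) \<and> \<not> (\<exists>w\<in>Hom C U (src C p). p \<cdot> w = f)"
proof -
  have ker: "is_kernel C i p" using k unfolding kernel_cokernel_pair_def by simp
  note K = kernelD[OF ker]
  let ?X = "tgt C p"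
  define bad where "bad U f \<longleftrightarrow> indecomposable C U \<and> f \<in> Hom C U ?X \<and> \<not> locally_lifts p f" for U f
  (* the number of multiples of f, counted on representatives of the indecomposables *)
  define size where "size = (\<lambda>(U, f). \<Sum>W\<in>ind C. card ((\<lambda>g. f \<cdot> g) ` Hom C (rep W) U))"
  have bad_below: "\<exists>N s. s \<in> Hom C N V \<and> bad N (f \<cdot> s)"
    if f: "f \<in> Hom C V ?X" "\<not> locally_lifts p f" for V f
  proof -
    have F: "f \<in> arr C" "src C f = V" "tgt C f = ?X" using f by (auto simp: in_Hom)
    obtain Ns where Ns: "\<forall>N\<in>set Ns. indecomposable C N" "direct_sum_list C V Ns"
      using decomposition_ex[of V] F by auto
    obtain N s where "N \<in> set Ns" "s \<in> Hom C N V" "\<not> locally_lifts p (f \<cdot> s)"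
      using not_locally_lifts_summand[OF Ns(2) F K(2) f(2)] by blast
    then show ?thesis unfolding bad_def using Ns(1) comp_in_Hom[OF _ f(1)] by blast
  qed
  have "\<not> locally_lifts p (id_arr C ?X)"
  proof
    assume "locally_lifts p (id_arr C ?X)"
    then obtain v w where vw: "deflation E v" "tgt C v = src C (id_arr C ?X)" "w \<in> arr C" "src C w = src C v" "tgt C w = src C p"
      "id_arr C ?X \<cdot> v = p \<cdot> w" unfolding locally_lifts_def by blast
    have "p \<cdot> w = v" using vw(2,6) deflation_arr[OF vw(1)] K(2) by simp
    from conflation_if_factor_deflation[OF k vw(1,3-5) this] nE show False by simp
  qed
  then obtain N s where "bad N (id_arr C ?X \<cdot> s)" using bad_below[of "id_arr C ?X" ?X] id_in_Hom[of ?X] K(2) by auto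
  then have "\<exists>z. case z of (U, f) \<Rightarrow> bad U f" by auto
  then obtain z where z: "case z of (U, f) \<Rightarrow> bad U f" "\<And>z'. (case z' of (U, f) \<Rightarrow> bad U f) \<Longrightarrow> size z \<le> size z'"
    using ex_has_least_nat[of "\<lambda>z. case z of (U, f) \<Rightarrow> bad U f" _ size] by blast
  obtain U f where zz: "z = (U, f)" by (cases z)
  have bad: "bad U f" and min: "\<And>U' f'. bad U' f' \<Longrightarrow> size (U, f) \<le> size (U', f')"
    using z unfolding zz by auto
  have U: "indecomposable C U" and f: "f \<in> Hom C U ?X" and nl: "\<not> locally_lifts p f" using bad unfolding bad_def by auto
  have Uo: "U \<in> obj C" by (rule indecomposable_obj[OF U])
  have F: "f \<in> arr C" "src C f = U" "tgt C f = ?X" using f by (auto simp: in_Hom)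
  have "projective U" unfolding projective_def
  proof (intro conjI allI impI Uo)
    fix v assume v: "deflation E v \<and> tgt C v = U"
    have V: "v \<in> arr C" "tgt C v = U" using v deflation_arr by auto
    show "\<exists>s\<in>Hom C U (src C v). v \<cdot> s = id_arr C U"
    proof (rule ccontr)
      assume nsplit: "\<not> ?thesis"
      have "\<not> locally_lifts p (f \<cdot> v)" using locally_lifts_deflation[of v f p] v F nl by auto
      moreover have "f \<cdot> v \<in> Hom C (src C v) ?X" using V F by (simp add: in_Hom)
      ultimately obtain N s where s: "s \<in> Hom C N (src C v)" "bad N ((f \<cdot> v) \<cdot> s)" using bad_below by blast
      have S: "s \<in> arr C" "src C s = N" "tgt C s = src C v" using s(1) by (auto simp: in_Hom)
      define h where "h = v \<cdot> s"
      have H: "h \<in> arr C" "src C h = N" "tgt C h = U" unfolding h_def using S V by simp_all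
      have fh: "(f \<cdot> v) \<cdot> s = f \<cdot> h" unfolding h_def using S V F by simp
      have sub: "(\<lambda>g. (f \<cdot> h) \<cdot> g) ` Hom C W N \<subseteq> (\<lambda>g. f \<cdot> g) ` Hom C W U" for W
      proof
        fix x assume "x \<in> (\<lambda>g. (f \<cdot> h) \<cdot> g) ` Hom C W N"
        then obtain g where g: "g \<in> Hom C W N" "x = (f \<cdot> h) \<cdot> g" by blast
        have "x = f \<cdot> (h \<cdot> g)" "h \<cdot> g \<in> Hom C W U" using g H F by (auto simp: in_Hom)
        then show "x \<in> (\<lambda>g. f \<cdot> g) ` Hom C W U" by blast
      qed
      have le: "card ((\<lambda>g. (f \<cdot> h) \<cdot> g) ` Hom C W N) \<le> card ((\<lambda>g. f \<cdot> g) ` Hom C W U)" for W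
        by (rule card_mono[OF finite_imageI[OF fin_Hom] sub])
      have "size (U, f) \<le> size (N, f \<cdot> h)" using min[OF s(2)] unfolding fh .
      then have sum_eq: "(\<Sum>W\<in>ind C. card ((\<lambda>g. (f \<cdot> h) \<cdot> g) ` Hom C (rep W) N)) = (\<Sum>W\<in>ind C. card ((\<lambda>g. f \<cdot> g) ` Hom C (rep W) U))"
        unfolding size_def using sum_mono[of "ind C", OF le] by (intro antisym) auto
      let ?W = "rep (iso_class C U)"
      have "iso_class C U \<in> ind C" by (rule iso_class_ind[OF U])
      from sum_mono_inv[OF sum_eq le this fin_ind]
      have "card ((\<lambda>g. (f \<cdot> h) \<cdot> g) ` Hom C ?W N) = card ((\<lambda>g. f \<cdot> g) ` Hom C ?W U)" .
      then have img: "(\<lambda>g. (f \<cdot> h) \<cdot> g) ` Hom C ?W N = (\<lambda>g. f \<cdot> g) ` Hom C ?W U"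
        by (rule card_subset_eq[OF finite_imageI[OF fin_Hom] sub])
      obtain a b where ab: "a \<in> Hom C ?W U" "b \<in> Hom C U ?W" "a \<cdot> b = id_arr C U"
        using rep_iso_class[OF Uo] unfolding isomorphic_iff by blast
      then have "f \<cdot> a \<in> (\<lambda>g. (f \<cdot> h) \<cdot> g) ` Hom C ?W N" unfolding img by blast
      then obtain g where g: "g \<in> Hom C ?W N" "f \<cdot> a = (f \<cdot> h) \<cdot> g" by blast
      have AB: "a \<in> arr C" "src C a = ?W" "tgt C a = U" "b \<in> arr C" "src C b = U" "tgt C b = ?W"
        "g \<in> arr C" "src C g = ?W" "tgt C g = N" using ab(1,2) g(1) by (auto simp: in_Hom)
      (* as the multiples of f h exhaust those of f, the map f is fixed by the endomorphism e of U *)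
      define e where "e = h \<cdot> (g \<cdot> b)"
      have e: "e \<in> arr C" "src C e = U" "tgt C e = U" unfolding e_def using H AB by simp_all
      have "f \<cdot> e = ((f \<cdot> h) \<cdot> g) \<cdot> b" unfolding e_def using H AB F by simp
      also have "\<dots> = f \<cdot> (a \<cdot> b)" unfolding g(2)[symmetric] using AB F by simp
      finally have fe: "f \<cdot> e = f" using ab(3) F by simp
      have "\<not> iso_arr C e"
      proof
        assume iso: "iso_arr C e"
        have eH: "e \<in> Hom C U U" using e by (simp add: in_Hom)
        obtain c where c: "c \<in> Hom C U U" "e \<cdot> c = id_arr C U" using iso_arr_inverse[OF iso eH] by metis
        have Cc: "c \<in> arr C" "src C c = U" "tgt C c = U" using c(1) by (auto simp: in_Hom)
        have "v \<cdot> (s \<cdot> (g \<cdot> (b \<cdot> c))) = id_arr C U" using c(2) Cc AB S V unfolding e_def h_def by simp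
        moreover have "s \<cdot> (g \<cdot> (b \<cdot> c)) \<in> Hom C U (src C v)" using Cc AB S by (simp add: in_Hom)
        ultimately show False using nsplit by blast
      qed
      then obtain n where n: "arr_pow U e n = zero_arr C U U" using fitting[OF U, of e] e by (auto simp: in_Hom)
      have "f \<cdot> arr_pow U e m = f" for m
      proof (induction m)
        case (Suc m)
        then show ?case using collapse[OF fe, of "arr_pow U e m"] F e by simp
      qed (use F Uo in simp)
      from this[of n] have "f = zero_arr C U ?X" unfolding n using F Uo by simp
      then show False using nl locally_lifts_zero[OF K(2) Uo] by simp
    qed
  qed
  moreover have "\<not> (\<exists>w\<in>Hom C U (src C p). p \<cdot> w = f)"
  proof
    assume "\<exists>w\<in>Hom C U (src C p). p \<cdot> w = f"
    then obtain w where w: "w \<in> arr C" "src C w = U" "tgt C w = src C p" "p \<cdot> w = f" by (auto simp: in_Hom)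
    have "locally_lifts p f" by (rule locally_lifts_lift[OF F(1) w(1) _ w(3,4)]) (use w F in simp)
    then show False using nl by simp
  qed
  ultimately show ?thesis using f by blast
qed

end

section \<open>Functionals on real tensor products\<close>

abbreviation keys where "keys \<equiv> Poly_Mapping.keys"
abbreviation lookup where "lookup \<equiv> Poly_Mapping.lookup"
abbreviation single where "single \<equiv> Poly_Mapping.single"

text \<open>
  The homomorphism to the reals from the free abelian group that extends a function on the basis.
\<close>

definition frag_eval :: "('a \<Rightarrow> real) \<Rightarrow> ('a \<Rightarrow>\<^sub>0 int) \<Rightarrow> real" where
  "frag_eval f x = (\<Sum>k\<in>keys x. of_int (lookup x k) * f k)"

lemma frag_eval_superset:
  assumes "finite S" "keys x \<subseteq> S"
  shows "frag_eval f x = (\<Sum>k\<in>S. of_int (lookup x k) * f k)"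
  unfolding frag_eval_def by (rule sum.mono_neutral_left[OF assms]) (simp add: in_keys_iff)

lemma frag_eval_zero [simp]: "frag_eval f 0 = 0" by (simp add: frag_eval_def)

lemma frag_eval_of [simp]: "frag_eval f (frag_of k) = f k" by (simp add: frag_eval_def)

lemma frag_eval_add: "frag_eval f (x + y) = frag_eval f x + frag_eval f y"
proof -
  let ?S = "keys x \<union> keys y"
  have S: "finite ?S" "keys (x + y) \<subseteq> ?S" using keys_add[of x y] by auto
  show ?thesis
    unfolding frag_eval_superset[OF S] frag_eval_superset[OF S(1), of x, OF Un_upper1] frag_eval_superset[OF S(1), of y, OF Un_upper2]
    by (simp add: lookup_add algebra_simps sum.distrib)
qed

lemma frag_eval_minus: "frag_eval f (- x) = - frag_eval f x"
  using frag_eval_add[of f x "- x"] by simp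

lemma frag_eval_diff: "frag_eval f (x - y) = frag_eval f x - frag_eval f y"
  using frag_eval_add[of f x "- y"] frag_eval_minus[of f y] by simp

lemma frag_eval_extend: "frag_eval f (frag_extend g x) = frag_eval (\<lambda>k. frag_eval f (g k)) x"
  by (rule frag_induction[of x UNIV]) (simp_all add: frag_extend_diff frag_eval_diff)

lemma frag_eval_cong: "(\<And>k. k \<in> keys x \<Longrightarrow> f k = g k) \<Longrightarrow> frag_eval f x = frag_eval g x"
  unfolding frag_eval_def by simp

lemma frag_eval_generate:
  assumes "x \<in> generate (free_Abelian_group T) S" "S \<subseteq> carrier (free_Abelian_group T)"
    and "\<And>s. s \<in> S \<Longrightarrow> frag_eval f s = 0"
  shows "frag_eval f x = 0"
  using assms(1)
proof induction
  case (inv h)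
  then have "inv\<^bsub>free_Abelian_group T\<^esub> h = - h" using assms(2) by auto
  then show ?case using assms(3) inv by (simp add: frag_eval_minus)
qed (use assms in \<open>auto simp: frag_eval_add\<close>)

lemma frag_extend_generate:
  assumes "x \<in> generate (free_Abelian_group T) S" "S \<subseteq> carrier (free_Abelian_group T)"
    and N: "subgroup N (free_Abelian_group T')" and "\<And>s. s \<in> S \<Longrightarrow> frag_extend g s \<in> N"
  shows "frag_extend g x \<in> N"
proof -
  have neg: "- n \<in> N" if "n \<in> N" for n
    using subgroup.m_inv_closed[OF N that] subgroup.mem_carrier[OF N that] by simp
  show ?thesis using assms(1)
  proof induction
    case one
    then show ?case using subgroup.one_closed[OF N] by simp
  next
    case (incl h) then show ?case by (rule assms(4))
  next
    case (inv h)
    then have "inv\<^bsub>free_Abelian_group T\<^esub> h = - h" using assms(2) by auto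
    then show ?case using neg[OF assms(4)[OF inv]] by (simp add: frag_extend_minus)
  next
    case (eng a b)
    then show ?case using subgroup.m_closed[OF N] by (simp add: frag_extend_add)
  qed
qed

text \<open>
  Cosets in free abelian groups, written without reference to the ambient basis.
\<close>

definition fcoset :: "('a \<Rightarrow>\<^sub>0 int) set \<Rightarrow> ('a \<Rightarrow>\<^sub>0 int) \<Rightarrow> ('a \<Rightarrow>\<^sub>0 int) set" where
  "fcoset N x = (\<lambda>n. n + x) ` N"

lemma r_coset_free: "N #>\<^bsub>free_Abelian_group T\<^esub> x = fcoset N x"
  by (auto simp: r_coset_def fcoset_def)

lemma set_mult_free: "A <#>\<^bsub>free_Abelian_group T\<^esub> B = {a + b | a b. a \<in> A \<and> b \<in> B}"
  by (auto simp: set_mult_def)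

locale free_subgroup =
  fixes T :: "'a set" and N :: "('a \<Rightarrow>\<^sub>0 int) set"
  assumes N: "subgroup N (free_Abelian_group T)"
begin

lemma zero: "0 \<in> N" using subgroup.one_closed[OF N] by simp
lemma add: "x \<in> N \<Longrightarrow> y \<in> N \<Longrightarrow> x + y \<in> N" using subgroup.m_closed[OF N] by simp
lemma neg: "x \<in> N \<Longrightarrow> - x \<in> N" using subgroup.m_inv_closed[OF N] subgroup.mem_carrier[OF N] by fastforce

lemma fcoset_self: "x \<in> fcoset N x" using zero unfolding fcoset_def by force

lemma fcoset_zero: "fcoset N 0 = N" unfolding fcoset_def by simp

lemma fcoset_eq: "x - y \<in> N \<Longrightarrow> fcoset N x = fcoset N y"
proof -
  assume d: "x - y \<in> N"
  have "fcoset N x \<subseteq> fcoset N y" if "x - y \<in> N" for x y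
  proof
    fix z assume "z \<in> fcoset N x"
    then obtain n where "n \<in> N" "z = n + x" unfolding fcoset_def by auto
    then have "z = (n + (x - y)) + y" "n + (x - y) \<in> N" using add that by auto
    then show "z \<in> fcoset N y" unfolding fcoset_def by blast
  qed
  from this[OF d] this[of y x] neg[OF d] show ?thesis by auto
qed

lemma carrier_Mod: "carrier (free_Abelian_group T Mod N) = fcoset N ` {x. keys x \<subseteq> T}"
  by (auto simp: FactGroup_def RCOSETS_def r_coset_free)

lemma one_Mod: "\<one>\<^bsub>free_Abelian_group T Mod N\<^esub> = N"
  by (simp add: FactGroup_def)

lemma mult_Mod: "fcoset N x \<otimes>\<^bsub>free_Abelian_group T Mod N\<^esub> fcoset N y = fcoset N (x + y)"
proof -
  have "fcoset N x <#>\<^bsub>free_Abelian_group T\<^esub> fcoset N y = fcoset N (x + y)"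
  proof (intro equalityI subsetI)
    fix z assume "z \<in> fcoset N x <#>\<^bsub>free_Abelian_group T\<^esub> fcoset N y"
    then obtain n m where "n \<in> N" "m \<in> N" "z = (n + x) + (m + y)" unfolding set_mult_free fcoset_def by auto
    then have "z = (n + m) + (x + y)" "n + m \<in> N" using add by (auto simp: algebra_simps)
    then show "z \<in> fcoset N (x + y)" unfolding fcoset_def by blast
  next
    fix z assume "z \<in> fcoset N (x + y)"
    then obtain n where "n \<in> N" "z = (n + x) + (0 + y)" unfolding fcoset_def by (auto simp: algebra_simps)
    then show "z \<in> fcoset N x <#>\<^bsub>free_Abelian_group T\<^esub> fcoset N y"
      unfolding set_mult_free fcoset_def using zero by blast
  qed
  then show ?thesis by (simp add: FactGroup_def)
qed

lemma group_Mod: "group (free_Abelian_group T Mod N)"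
proof -
  interpret comm_group "free_Abelian_group T" by (rule abelian_free_Abelian_group)
  have "N \<lhd> free_Abelian_group T" using normal_iff_subgroup N by simp
  then show ?thesis by (rule normal.factorgroup_is_group)
qed

lemma inv_Mod:
  assumes "keys x \<subseteq> T"
  shows "inv\<^bsub>free_Abelian_group T Mod N\<^esub> fcoset N x = fcoset N (- x)"
proof (rule group.inv_equality[OF group_Mod])
  show "fcoset N (- x) \<otimes>\<^bsub>free_Abelian_group T Mod N\<^esub> fcoset N x = \<one>\<^bsub>free_Abelian_group T Mod N\<^esub>"
    unfolding mult_Mod one_Mod using fcoset_zero by simp
qed (use assms in \<open>auto simp: carrier_Mod\<close>)

text \<open>
  The maps induced on quotients are defined by \<open>N <#> h ` U\<close>; here they are computed on representatives.
\<close>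

lemma image_coset:
  assumes "\<And>n. n \<in> N' \<Longrightarrow> frag_extend g n \<in> N" "0 \<in> N'"
  shows "N <#>\<^bsub>free_Abelian_group T\<^esub> (frag_extend g ` fcoset N' x) = fcoset N (frag_extend g x)"
proof (intro equalityI subsetI)
  fix z assume "z \<in> N <#>\<^bsub>free_Abelian_group T\<^esub> (frag_extend g ` fcoset N' x)"
  then obtain n n' where n: "n \<in> N" "n' \<in> N'" "z = n + frag_extend g (n' + x)"
    unfolding set_mult_free fcoset_def by auto
  then have "z = (n + frag_extend g n') + frag_extend g x" by (simp add: frag_extend_add)
  then show "z \<in> fcoset N (frag_extend g x)" using add n(1) assms(1)[OF n(2)] unfolding fcoset_def by blast
next
  fix z assume "z \<in> fcoset N (frag_extend g x)"
  then obtain n where "n \<in> N" "z = n + frag_extend g (0 + x)" unfolding fcoset_def by auto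
  then show "z \<in> N <#>\<^bsub>free_Abelian_group T\<^esub> (frag_extend g ` fcoset N' x)"
    unfolding set_mult_free fcoset_def using assms(2) by blast
qed

end

text \<open>
  The value on any representative; it is meaningful if \<open>f\<close> vanishes on the subgroup.
\<close>

definition coset_eval :: "('a \<Rightarrow> real) \<Rightarrow> ('a \<Rightarrow>\<^sub>0 int) set \<Rightarrow> real" where
  "coset_eval f U = frag_eval f (SOME x. x \<in> U)"

lemma (in free_subgroup) coset_eval:
  assumes "\<And>n. n \<in> N \<Longrightarrow> frag_eval f n = 0"
  shows "coset_eval f (fcoset N x) = frag_eval f x"
proof -
  have "(SOME y. y \<in> fcoset N x) \<in> fcoset N x" using fcoset_self by (rule someI)
  then obtain n where n: "n \<in> N" "(SOME y. y \<in> fcoset N x) = n + x" unfolding fcoset_def by blast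
  then show ?thesis unfolding coset_eval_def n(2) frag_eval_add assms[OF n(1)] by simp
qed

text \<open>
  The real tensor product of an abelian group \<open>G\<close>, whose linear functionals are the additive functions
  on \<open>G\<close>.
\<close>

locale tensor =
  fixes G :: "('a, 'b) monoid_scheme"
  assumes closed: "g \<in> carrier G \<Longrightarrow> h \<in> carrier G \<Longrightarrow> g \<otimes>\<^bsub>G\<^esub> h \<in> carrier G"
begin

abbreviation "gens \<equiv> carrier G \<times> (UNIV :: real set)"

definition rel_gens :: "('a \<times> real \<Rightarrow>\<^sub>0 int) set" where
  "rel_gens = {frag_of (g \<otimes>\<^bsub>G\<^esub> h, r) - frag_of (g, r) - frag_of (h, r) | g h r.
        g \<in> carrier G \<and> h \<in> carrier G} \<union>
     {frag_of (g, r + s) - frag_of (g, r) - frag_of (g, s) | g r s. g \<in> carrier G}"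

lemma tensor_relations_gens: "tensor_relations G = generate (free_Abelian_group gens) rel_gens"
  unfolding tensor_relations_def rel_gens_def ..

lemma rel_gens_carrier: "rel_gens \<subseteq> carrier (free_Abelian_group gens)"
proof
  fix x assume "x \<in> rel_gens"
  then obtain a b c where x: "x = frag_of a - frag_of b - frag_of c" "a \<in> gens" "b \<in> gens" "c \<in> gens"
    unfolding rel_gens_def using closed by fast
  have "keys x \<subseteq> {a} \<union> {b} \<union> {c}"
    unfolding x(1) using keys_diff[of "frag_of a - frag_of b" "frag_of c"] keys_diff[of "frag_of a" "frag_of b"]
    by (auto simp: keys_frag_of)
  then show "x \<in> carrier (free_Abelian_group gens)" using x by auto
qed

sublocale free_subgroup gens "tensor_relations G"
  by (rule free_subgroup.intro)
    (simp only: tensor_relations_gens group.generate_is_subgroup[OF group_free_Abelian_group rel_gens_carrier])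

abbreviation tclass where "tclass \<equiv> fcoset (tensor_relations G)"

lemma carrier_tensor: "carrier (real_tensor G) = tclass ` {x. keys x \<subseteq> gens}"
  unfolding real_tensor_def by (rule carrier_Mod)

lemma tensor_mult: "tclass x \<otimes>\<^bsub>real_tensor G\<^esub> tclass y = tclass (x + y)"
  unfolding real_tensor_def by (rule mult_Mod)

lemma tensor_one: "\<one>\<^bsub>real_tensor G\<^esub> = tclass 0"
  unfolding real_tensor_def one_Mod fcoset_zero ..

lemma pure_tensor_class: "pure_tensor G g r = tclass (frag_of (g, r))"
  unfolding pure_tensor_def r_coset_free ..

lemma pure_tensor_carrier: "g \<in> carrier G \<Longrightarrow> pure_tensor G g r \<in> carrier (real_tensor G)"
  unfolding pure_tensor_class carrier_tensor by (intro imageI) simp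

lemma rel_gens_in: "x \<in> rel_gens \<Longrightarrow> x \<in> tensor_relations G"
  unfolding tensor_relations_gens by (rule generate.incl)

lemma relation_add:
  assumes "g \<in> carrier G" "h \<in> carrier G"
  shows "frag_of (g \<otimes>\<^bsub>G\<^esub> h, r) - frag_of (g, r) - frag_of (h, r) \<in> tensor_relations G"
  by (rule rel_gens_in) (use assms in \<open>unfold rel_gens_def, blast\<close>)

lemma relation_scalar_add:
  assumes "g \<in> carrier G"
  shows "frag_of (g, r + s) - frag_of (g, r) - frag_of (g, s) \<in> tensor_relations G"
  by (rule rel_gens_in) (use assms in \<open>unfold rel_gens_def, blast\<close>)

lemma real_scale_class: "real_scale G c (tclass x) = tclass (frag_extend (\<lambda>(g, r). frag_of (g, c * r)) x)"
  unfolding real_scale_def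
proof (rule image_coset)
  fix n assume n: "n \<in> tensor_relations G"
  show "frag_extend (\<lambda>(g, r). frag_of (g, c * r)) n \<in> tensor_relations G"
  proof (rule frag_extend_generate[OF n[unfolded tensor_relations_gens] rel_gens_carrier N])
    fix s assume "s \<in> rel_gens"
    then consider g h r where "s = frag_of (g \<otimes>\<^bsub>G\<^esub> h, r) - frag_of (g, r) - frag_of (h, r)" "g \<in> carrier G" "h \<in> carrier G"
      | g r t where "s = frag_of (g, r + t) - frag_of (g, r) - frag_of (g, t)" "g \<in> carrier G"
      unfolding rel_gens_def by blast
    then show "frag_extend (\<lambda>(g, r). frag_of (g, c * r)) s \<in> tensor_relations G"
      by cases (simp_all add: frag_extend_diff distrib_left relation_add relation_scalar_add)
  qed
qed (rule zero)

lemma tensor_map_class: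
  assumes "tensor H" and f: "\<And>g. g \<in> carrier G \<Longrightarrow> f g \<in> carrier H"
    and hom: "\<And>g h. g \<in> carrier G \<Longrightarrow> h \<in> carrier G \<Longrightarrow> f (g \<otimes>\<^bsub>G\<^esub> h) = f g \<otimes>\<^bsub>H\<^esub> f h"
  shows "real_tensor_map H f (tclass x) = fcoset (tensor_relations H) (frag_extend (\<lambda>(g, r). frag_of (f g, r)) x)"
proof -
  interpret H: tensor H by fact
  show ?thesis unfolding real_tensor_map_def
  proof (rule H.image_coset)
    fix n assume n: "n \<in> tensor_relations G"
    show "frag_extend (\<lambda>(g, r). frag_of (f g, r)) n \<in> tensor_relations H"
    proof (rule frag_extend_generate[OF n[unfolded tensor_relations_gens] rel_gens_carrier H.N])
      fix s assume "s \<in> rel_gens"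
      then consider g h r where "s = frag_of (g \<otimes>\<^bsub>G\<^esub> h, r) - frag_of (g, r) - frag_of (h, r)" "g \<in> carrier G" "h \<in> carrier G"
        | g r t where "s = frag_of (g, r + t) - frag_of (g, r) - frag_of (g, t)" "g \<in> carrier G"
        unfolding rel_gens_def by blast
      then show "frag_extend (\<lambda>(g, r). frag_of (f g, r)) s \<in> tensor_relations H"
        by cases (simp_all add: frag_extend_diff f hom H.relation_add H.relation_scalar_add)
    qed
  qed (rule zero)
qed

text \<open>
  The linear functional on the tensor product that extends an additive function on the group.
\<close>

definition functional :: "('a \<Rightarrow> real) \<Rightarrow> ('a \<times> real \<Rightarrow>\<^sub>0 int) set \<Rightarrow> real" where
  "functional f = (\<lambda>U\<in>carrier (real_tensor G). coset_eval (\<lambda>(g, r). r * f g) U)"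

lemma functional_class:
  assumes f: "\<And>g h. g \<in> carrier G \<Longrightarrow> h \<in> carrier G \<Longrightarrow> f (g \<otimes>\<^bsub>G\<^esub> h) = f g + f h"
    and x: "keys x \<subseteq> gens"
  shows "functional f (tclass x) = frag_eval (\<lambda>(g, r). r * f g) x"
proof -
  have "frag_eval (\<lambda>(g, r). r * f g) n = 0" if n: "n \<in> tensor_relations G" for n
  proof (rule frag_eval_generate[OF n[unfolded tensor_relations_gens] rel_gens_carrier])
    fix s assume "s \<in> rel_gens"
    then consider g h r where "s = frag_of (g \<otimes>\<^bsub>G\<^esub> h, r) - frag_of (g, r) - frag_of (h, r)" "g \<in> carrier G" "h \<in> carrier G"
      | g r t where "s = frag_of (g, r + t) - frag_of (g, r) - frag_of (g, t)" "g \<in> carrier G"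
      unfolding rel_gens_def by blast
    then show "frag_eval (\<lambda>(g, r). r * f g) s = 0"
      by cases (simp_all add: f frag_eval_diff distrib_left distrib_right)
  qed
  from coset_eval[of "\<lambda>(g, r). r * f g", OF this] show ?thesis
    unfolding functional_def using x by (simp add: carrier_tensor)
qed

lemma keys_scale:
  assumes "keys x \<subseteq> gens" shows "keys (frag_extend (\<lambda>(g, r). frag_of (g, c * r)) x) \<subseteq> gens"
  using keys_frag_extend[of "\<lambda>(g, r). frag_of (g, c * r)" x] assms by (fastforce simp: keys_frag_of split: prod.splits)

lemma frag_eval_scale: "frag_eval (\<lambda>(g, r). r * f g) (frag_extend (\<lambda>(g, r). frag_of (g, c * r)) x) = c * frag_eval (\<lambda>(g, r). r * f g) x"
  unfolding frag_eval_extend unfolding frag_eval_def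
  by (simp add: sum_distrib_left case_prod_unfold) (simp add: algebra_simps)

lemma functional_dual:
  assumes f: "\<And>g h. g \<in> carrier G \<Longrightarrow> h \<in> carrier G \<Longrightarrow> f (g \<otimes>\<^bsub>G\<^esub> h) = f g + f h"
  shows "functional f \<in> dual_space G"
  unfolding dual_space_def
proof (intro CollectI conjI ballI allI)
  show "functional f \<in> extensional (carrier (real_tensor G))" unfolding functional_def by simp
  fix U assume "U \<in> carrier (real_tensor G)"
  then obtain x where x: "U = tclass x" "keys x \<subseteq> gens" unfolding carrier_tensor by auto
  { fix V assume "V \<in> carrier (real_tensor G)"
    then obtain y where y: "V = tclass y" "keys y \<subseteq> gens" unfolding carrier_tensor by auto
    have "keys (x + y) \<subseteq> gens" using keys_add[of x y] x y by blast
    then show "functional f (U \<otimes>\<^bsub>real_tensor G\<^esub> V) = functional f U + functional f V"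
      unfolding x(1) y(1) tensor_mult using functional_class[OF f] x y by (simp add: frag_eval_add) }
  { fix c show "functional f (real_scale G c U) = c * functional f U"
      unfolding x(1) real_scale_class using functional_class[OF f] x(2) keys_scale[OF x(2)]
      by (simp add: frag_eval_scale) }
qed

lemma dual_additive:
  assumes phi: "\<phi> \<in> dual_space G" and g: "g \<in> carrier G" "h \<in> carrier G"
  shows "\<phi> (pure_tensor G (g \<otimes>\<^bsub>G\<^esub> h) 1) = \<phi> (pure_tensor G g 1) + \<phi> (pure_tensor G h 1)"
proof -
  have "frag_of (g \<otimes>\<^bsub>G\<^esub> h, 1) - (frag_of (g, 1) + frag_of (h, 1)) \<in> tensor_relations G"
    using relation_add[OF g, of 1] by (simp add: algebra_simps)
  then have "tclass (frag_of (g \<otimes>\<^bsub>G\<^esub> h, 1)) = tclass (frag_of (g, 1) + frag_of (h, 1))" by (rule fcoset_eq)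
  then have "pure_tensor G (g \<otimes>\<^bsub>G\<^esub> h) 1 = pure_tensor G g 1 \<otimes>\<^bsub>real_tensor G\<^esub> pure_tensor G h 1"
    unfolding pure_tensor_class tensor_mult .
  then show ?thesis using phi pure_tensor_carrier g unfolding dual_space_def by simp
qed

text \<open>
  Pure tensors with scalar 1 span, so they determine a linear functional.
\<close>

lemma dual_class:
  assumes phi: "\<phi> \<in> dual_space G" and x: "keys x \<subseteq> gens"
  shows "\<phi> (tclass x) = frag_eval (\<lambda>(g, r). r * \<phi> (pure_tensor G g 1)) x"
proof -
  have add: "\<phi> (tclass (x + y)) = \<phi> (tclass x) + \<phi> (tclass y)"
    if "keys x \<subseteq> gens" "keys y \<subseteq> gens" for x y
  proof -
    have "tclass x \<in> carrier (real_tensor G)" "tclass y \<in> carrier (real_tensor G)"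
      using that unfolding carrier_tensor by auto
    then show ?thesis using phi unfolding dual_space_def tensor_mult[symmetric] by simp
  qed
  show ?thesis
  proof (rule free_Abelian_group_induct[OF x, where P = "\<lambda>x. \<phi> (tclass x) = frag_eval (\<lambda>(g, r). r * \<phi> (pure_tensor G g 1)) x"])
    show "\<phi> (tclass 0) = frag_eval (\<lambda>(g, r). r * \<phi> (pure_tensor G g 1)) 0" using add[of 0 0] by simp
  next
    fix x y assume "keys x \<subseteq> gens" and y: "keys y \<subseteq> gens"
      "\<phi> (tclass x) = frag_eval (\<lambda>(g, r). r * \<phi> (pure_tensor G g 1)) x" "\<phi> (tclass y) = frag_eval (\<lambda>(g, r). r * \<phi> (pure_tensor G g 1)) y"
    then have "keys (x - y) \<subseteq> gens" using keys_diff[of x y] by blast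
    then show "\<phi> (tclass (x - y)) = frag_eval (\<lambda>(g, r). r * \<phi> (pure_tensor G g 1)) (x - y)"
      using add[of "x - y" y] y by (simp add: frag_eval_diff)
  next
    fix a assume "a \<in> gens"
    moreover obtain g r where a: "a = (g, r)" by (cases a)
    ultimately have g: "g \<in> carrier G" by simp
    have "tclass (frag_of (g, r)) = real_scale G r (pure_tensor G g 1)"
      unfolding pure_tensor_class real_scale_class by simp
    then show "\<phi> (tclass (frag_of a)) = frag_eval (\<lambda>(g, r). r * \<phi> (pure_tensor G g 1)) (frag_of a)"
      using phi pure_tensor_carrier[OF g] unfolding dual_space_def a by simp
  qed
qed

lemma dual_eqI:
  assumes "\<phi> \<in> dual_space G" "\<psi> \<in> dual_space G"
    and eq: "\<And>g. g \<in> carrier G \<Longrightarrow> \<phi> (pure_tensor G g 1) = \<psi> (pure_tensor G g 1)"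
  shows "\<phi> = \<psi>"
proof (rule extensionalityI)
  show "\<phi> \<in> extensional (carrier (real_tensor G))" "\<psi> \<in> extensional (carrier (real_tensor G))"
    using assms unfolding dual_space_def by auto
  fix U assume "U \<in> carrier (real_tensor G)"
  then obtain x where x: "U = tclass x" "keys x \<subseteq> gens" unfolding carrier_tensor by auto
  show "\<phi> U = \<psi> U" unfolding x(1) dual_class[OF assms(1) x(2)] dual_class[OF assms(2) x(2)]
    by (rule frag_eval_cong) (use x(2) eq in auto)
qed

lemma functional_pure:
  assumes f: "\<And>g h. g \<in> carrier G \<Longrightarrow> h \<in> carrier G \<Longrightarrow> f (g \<otimes>\<^bsub>G\<^esub> h) = f g + f h" and g: "g \<in> carrier G"
  shows "functional f (pure_tensor G g 1) = f g"
  unfolding pure_tensor_class by (subst functional_class[OF f]) (use g in auto)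

text \<open>
  Pulling back a linear functional along an induced map is pulling back the additive function that
  it comes from.
\<close>

lemma dual_tensor_map:
  assumes H: "tensor H" and f: "\<And>g. g \<in> carrier G \<Longrightarrow> f g \<in> carrier H"
    and hom: "\<And>g h. g \<in> carrier G \<Longrightarrow> h \<in> carrier G \<Longrightarrow> f (g \<otimes>\<^bsub>G\<^esub> h) = f g \<otimes>\<^bsub>H\<^esub> f h"
    and phi: "\<phi> \<in> dual_space H" and U: "U \<in> carrier (real_tensor G)"
  shows "\<phi> (real_tensor_map H f U) = functional (\<lambda>g. \<phi> (pure_tensor H (f g) 1)) U"
proof -
  interpret H: tensor H by fact
  obtain x where x: "U = tclass x" "keys x \<subseteq> gens" using U unfolding carrier_tensor by auto
  have k: "keys (frag_extend (\<lambda>(g, r). frag_of (f g, r)) x) \<subseteq> H.gens"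
    using keys_frag_extend[of "\<lambda>(g, r). frag_of (f g, r)" x] x(2) f by (fastforce simp: keys_frag_of split: prod.splits)
  have m: "real_tensor_map H f (tclass x) = fcoset (tensor_relations H) (frag_extend (\<lambda>(g, r). frag_of (f g, r)) x)"
    by (rule tensor_map_class[OF H]) (use f hom in auto)
  have "\<phi> (real_tensor_map H f U) = frag_eval (\<lambda>(g, r). r * \<phi> (pure_tensor H g 1)) (frag_extend (\<lambda>(g, r). frag_of (f g, r)) x)"
    unfolding x(1) m by (rule H.dual_class[OF phi k])
  also have "\<dots> = frag_eval (\<lambda>(g, r). r * \<phi> (pure_tensor H (f g) 1)) x"
    unfolding frag_eval_extend by (simp add: case_prod_unfold)
  also have "\<dots> = functional (\<lambda>g. \<phi> (pure_tensor H (f g) 1)) U"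
    unfolding x(1) by (rule functional_class[symmetric, OF _ x(2)]) (simp add: hom H.dual_additive[OF phi] f)
  finally show ?thesis .
qed

lemma cone_carrier:
  assumes S: "S \<subseteq> carrier (real_tensor G)" and x: "x \<in> cone_generated G S"
  shows "x \<in> carrier (real_tensor G)"
  using x
proof induction
  case zero
  show ?case unfolding tensor_one carrier_tensor by (intro imageI) simp
next
  case (add_multiple x s c)
  obtain y z where y: "x = tclass y" "keys y \<subseteq> gens" "s = tclass z" "keys z \<subseteq> gens"
    using add_multiple S unfolding carrier_tensor by blast
  have "keys (y + frag_extend (\<lambda>(g, r). frag_of (g, c * r)) z) \<subseteq> gens"
    using keys_add[of y "frag_extend (\<lambda>(g, r). frag_of (g, c * r)) z"] keys_scale[OF y(4), of c] y(2) by blast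
  then show ?case unfolding y(1,3) real_scale_class tensor_mult carrier_tensor by blast
qed

lemma scale_carrier:
  assumes "s \<in> carrier (real_tensor G)" shows "real_scale G c s \<in> carrier (real_tensor G)"
proof -
  obtain z where "s = tclass z" "keys z \<subseteq> gens" using assms unfolding carrier_tensor by blast
  then show ?thesis using keys_scale[of z c] unfolding real_scale_class carrier_tensor by (simp add: real_scale_class)
qed

lemma scale_zero:
  assumes "g \<in> carrier G" shows "real_scale G 0 (pure_tensor G g 1) = \<one>\<^bsub>real_tensor G\<^esub>"
proof -
  have "- frag_of (g, 0) \<in> tensor_relations G"
    using relation_scalar_add[OF assms, of 0 0] by simp
  then have "frag_of (g, 0) \<in> tensor_relations G" using neg[of "- frag_of (g, 0)"] by simp
  then have "tclass (frag_of (g, 0)) = tclass 0" by (intro fcoset_eq) simp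
  then show ?thesis unfolding pure_tensor_class real_scale_class tensor_one by simp
qed

lemma dual_one: "\<phi> \<in> dual_space G \<Longrightarrow> \<phi> \<one>\<^bsub>real_tensor G\<^esub> = 0"
  unfolding tensor_one using dual_class[of \<phi> 0] by simp

lemma tensor_mult_one: "x \<in> carrier (real_tensor G) \<Longrightarrow> x \<otimes>\<^bsub>real_tensor G\<^esub> \<one>\<^bsub>real_tensor G\<^esub> = x"
  unfolding tensor_one carrier_tensor by (auto simp: tensor_mult)

lemma cone_zero:
  assumes phi: "\<phi> \<in> dual_space G" and S: "S \<subseteq> carrier (real_tensor G)" and z: "\<And>s. s \<in> S \<Longrightarrow> \<phi> s = 0"
    and x: "x \<in> cone_generated G S"
  shows "\<phi> x = 0"
  using x
proof induction
  case zero
  show ?case by (rule dual_one[OF phi])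
next
  case (add_multiple x s c)
  have "x \<in> carrier (real_tensor G)" "s \<in> carrier (real_tensor G)" "real_scale G c s \<in> carrier (real_tensor G)"
    using add_multiple cone_carrier[OF S] S scale_carrier by auto
  then show ?case using phi add_multiple z unfolding dual_space_def by simp
qed

lemma cone_positive:
  assumes phi: "\<phi> \<in> dual_space G" and T: "T \<subseteq> carrier G"
    and pos: "\<And>g. g \<in> T \<Longrightarrow> \<phi> (pure_tensor G g 1) > 0"
    and x: "x \<in> cone_generated G ((\<lambda>g. pure_tensor G g 1) ` T)" and "x \<noteq> \<one>\<^bsub>real_tensor G\<^esub>"
  shows "\<phi> x > 0"
proof -
  let ?S = "(\<lambda>g. pure_tensor G g 1) ` T"
  have S: "?S \<subseteq> carrier (real_tensor G)" using T pure_tensor_carrier by blast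
  have "x = \<one>\<^bsub>real_tensor G\<^esub> \<or> \<phi> x > 0" using x
  proof induction
    case (add_multiple x s c)
    have c: "x \<in> carrier (real_tensor G)" "s \<in> carrier (real_tensor G)" "real_scale G c s \<in> carrier (real_tensor G)"
      using add_multiple cone_carrier[OF S] S scale_carrier by auto
    have eq: "\<phi> (x \<otimes>\<^bsub>real_tensor G\<^esub> real_scale G c s) = \<phi> x + c * \<phi> s"
      using phi c unfolding dual_space_def by simp
    show ?case
    proof (cases "c = 0")
      case True
      then have "real_scale G c s = \<one>\<^bsub>real_tensor G\<^esub>" using add_multiple T scale_zero by auto
      then show ?thesis using add_multiple tensor_mult_one[OF c(1)] by simp
    next
      case False
      then have "c * \<phi> s > 0" using add_multiple pos by auto
      moreover have "\<phi> x \<ge> 0" using add_multiple dual_one[OF phi] by auto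
      ultimately show ?thesis using eq by simp
    qed
  qed simp
  then show ?thesis using assms(5) by simp
qed

end

section \<open>Functionals on Grothendieck groups and the cone\<close>

context linear_category begin

definition euler_elt :: "'m \<times> 'm \<Rightarrow> 'o set \<Rightarrow>\<^sub>0 int" where
  "euler_elt = (\<lambda>(i, p). frag_of (iso_class C (src C i)) - frag_of (iso_class C (tgt C i)) + frag_of (iso_class C (tgt C p)))"

lemma keys_euler_elt:
  assumes "i \<in> arr C" "p \<in> arr C"
  shows "keys (euler_elt (i, p)) \<subseteq> Iso C"
proof -
  have "keys (euler_elt (i, p)) \<subseteq> {iso_class C (src C i)} \<union> {iso_class C (tgt C i)} \<union> {iso_class C (tgt C p)}"
    unfolding euler_elt_def
    using keys_add[of "frag_of (iso_class C (src C i)) - frag_of (iso_class C (tgt C i))" "frag_of (iso_class C (tgt C p))"]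
      keys_diff[of "frag_of (iso_class C (src C i))" "frag_of (iso_class C (tgt C i))"]
    by (auto simp: keys_frag_of)
  also have "\<dots> \<subseteq> Iso C" using assms iso_class_in_Iso by auto
  finally show ?thesis .
qed

end

text \<open>
  The common ground of exact structures and the split structure: each has a Grothendieck group.
\<close>

locale conflation_class = linear_category K C
  for K :: "('k, 'x) ring_scheme" and C :: "('o, 'm, 'k) lincat" and E :: "('m \<times> 'm) set" +
  assumes conflation_arr: "(i, p) \<in> E \<Longrightarrow> i \<in> arr C \<and> p \<in> arr C \<and> tgt C i = src C p"
begin

lemma K0_relations_euler: "K0_relations C E = generate (free_Abelian_group (Iso C)) ((\<lambda>x. - euler_elt x) ` E)"
proof -
  have "{frag_of (iso_class C (tgt C i)) - frag_of (iso_class C (src C i)) - frag_of (iso_class C (tgt C p)) | i p. (i, p) \<in> E}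
      = (\<lambda>x. - euler_elt x) ` E"
    unfolding euler_elt_def by (force simp: image_iff algebra_simps)
  then show ?thesis unfolding K0_relations_def by simp
qed

lemma euler_elts_carrier: "(\<lambda>x. - euler_elt x) ` E \<subseteq> carrier (free_Abelian_group (Iso C))"
  using keys_euler_elt conflation_arr by (auto simp: keys_minus)

sublocale K0: free_subgroup "Iso C" "K0_relations C E"
  by (rule free_subgroup.intro)
    (simp only: K0_relations_euler group.generate_is_subgroup[OF group_free_Abelian_group euler_elts_carrier])

lemma euler_elt_relation: "x \<in> E \<Longrightarrow> euler_elt x \<in> K0_relations C E"
  using K0.neg[of "- euler_elt x"] generate.incl[of "- euler_elt x" "(\<lambda>x. - euler_elt x) ` E" "free_Abelian_group (Iso C)"]
  unfolding K0_relations_euler by simp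

abbreviation K0_coset where "K0_coset \<equiv> fcoset (K0_relations C E)"

lemma carrier_K0: "carrier (K0 C E) = K0_coset ` {x. keys x \<subseteq> Iso C}"
  unfolding K0_def by (rule K0.carrier_Mod)

lemma mult_K0: "K0_coset x \<otimes>\<^bsub>K0 C E\<^esub> K0_coset y = K0_coset (x + y)"
  unfolding K0_def by (rule K0.mult_Mod)

lemma K0_coset_carrier: "keys x \<subseteq> Iso C \<Longrightarrow> K0_coset x \<in> carrier (K0 C E)"
  unfolding carrier_K0 by simp

lemma K0_class_coset: "K0_class C E X = K0_coset (frag_of X)"
  unfolding K0_class_def r_coset_free ..

sublocale tensor_K0: tensor "K0 C E"
proof
  fix g h assume "g \<in> carrier (K0 C E)" "h \<in> carrier (K0 C E)"
  then obtain x y where "g = K0_coset x" "h = K0_coset y" "keys x \<subseteq> Iso C" "keys y \<subseteq> Iso C"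
    unfolding carrier_K0 by blast
  then show "g \<otimes>\<^bsub>K0 C E\<^esub> h \<in> carrier (K0 C E)" using keys_add[of x y] by (auto simp: mult_K0 intro!: K0_coset_carrier)
qed

lemma euler_class_coset:
  assumes "i \<in> arr C" "p \<in> arr C"
  shows "euler_class C E (i, p) = K0_coset (euler_elt (i, p))"
proof -
  have "inv\<^bsub>K0 C E\<^esub> K0_coset (frag_of (iso_class C (tgt C i))) = K0_coset (- frag_of (iso_class C (tgt C i)))"
    unfolding K0_def by (rule K0.inv_Mod) (use assms in \<open>simp add: iso_class_in_Iso\<close>)
  then show ?thesis unfolding euler_class_def K0_class_coset by (simp add: mult_K0 euler_elt_def)
qed

text \<open>
  The condition under which \<open>a\<close> factors through the Grothendieck group.
\<close>

definition conflation_additive :: "('o set \<Rightarrow> real) \<Rightarrow> bool" where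
  "conflation_additive a \<longleftrightarrow> (\<forall>x\<in>E. frag_eval a (euler_elt x) = 0)"

lemma frag_eval_relations:
  assumes "conflation_additive a" "n \<in> K0_relations C E" shows "frag_eval a n = 0"
  by (rule frag_eval_generate[OF assms(2)[unfolded K0_relations_euler] euler_elts_carrier])
    (use assms(1) in \<open>auto simp: conflation_additive_def frag_eval_minus\<close>)

lemma coset_eval_K0: "conflation_additive a \<Longrightarrow> coset_eval a (K0_coset x) = frag_eval a x"
  by (rule K0.coset_eval) (rule frag_eval_relations)

lemma coset_eval_additive:
  assumes a: "conflation_additive a" and "g \<in> carrier (K0 C E)" "h \<in> carrier (K0 C E)"
  shows "coset_eval a (g \<otimes>\<^bsub>K0 C E\<^esub> h) = coset_eval a g + coset_eval a h"
  using assms(2,3) unfolding carrier_K0 by (auto simp: mult_K0 coset_eval_K0[OF a] frag_eval_add)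

definition functional_of :: "('o set \<Rightarrow> real) \<Rightarrow> (('o set \<Rightarrow>\<^sub>0 int) set \<times> real \<Rightarrow>\<^sub>0 int) set \<Rightarrow> real" where
  "functional_of a = tensor_K0.functional (coset_eval a)"

definition values_of :: "((('o set \<Rightarrow>\<^sub>0 int) set \<times> real \<Rightarrow>\<^sub>0 int) set \<Rightarrow> real) \<Rightarrow> 'o set \<Rightarrow> real" where
  "values_of \<phi> X = \<phi> (pure_tensor (K0 C E) (K0_class C E X) 1)"

lemma functional_of_dual: "conflation_additive a \<Longrightarrow> functional_of a \<in> dual_space (K0 C E)"
  unfolding functional_of_def by (rule tensor_K0.functional_dual[OF coset_eval_additive])

lemma functional_of_pure:
  "conflation_additive a \<Longrightarrow> keys x \<subseteq> Iso C \<Longrightarrow>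
    functional_of a (pure_tensor (K0 C E) (K0_coset x) 1) = frag_eval a x"
  unfolding functional_of_def
  by (subst tensor_K0.functional_pure[OF coset_eval_additive]) (auto simp: K0_coset_carrier coset_eval_K0)

lemma values_functional_of:
  "conflation_additive a \<Longrightarrow> X \<in> Iso C \<Longrightarrow> values_of (functional_of a) X = a X"
  unfolding values_of_def K0_class_coset by (subst functional_of_pure) auto

lemma dual_pure_coset:
  assumes phi: "\<phi> \<in> dual_space (K0 C E)" and x: "keys x \<subseteq> Iso C"
  shows "\<phi> (pure_tensor (K0 C E) (K0_coset x) 1) = frag_eval (values_of \<phi>) x"
proof -
  let ?g = "\<lambda>x. \<phi> (pure_tensor (K0 C E) (K0_coset x) 1)"
  have add: "?g (x + y) = ?g x + ?g y" if "keys x \<subseteq> Iso C" "keys y \<subseteq> Iso C" for x y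
    using tensor_K0.dual_additive[OF phi K0_coset_carrier[OF that(1)] K0_coset_carrier[OF that(2)]] by (simp add: mult_K0)
  show ?thesis
  proof (rule free_Abelian_group_induct[OF x, where P = "\<lambda>x. ?g x = frag_eval (values_of \<phi>) x"])
    show "?g 0 = frag_eval (values_of \<phi>) 0" using add[of 0 0] by simp
  next
    fix x y assume "keys x \<subseteq> Iso C" and y: "keys y \<subseteq> Iso C"
      "?g x = frag_eval (values_of \<phi>) x" "?g y = frag_eval (values_of \<phi>) y"
    then have "keys (x - y) \<subseteq> Iso C" using keys_diff[of x y] by blast
    then show "?g (x - y) = frag_eval (values_of \<phi>) (x - y)" using add[of "x - y" y] y by (simp add: frag_eval_diff)
  next
    fix X show "?g (frag_of X) = frag_eval (values_of \<phi>) (frag_of X)"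
      unfolding values_of_def K0_class_coset by simp
  qed
qed

lemma values_of_additive:
  assumes phi: "\<phi> \<in> dual_space (K0 C E)" shows "conflation_additive (values_of \<phi>)"
  unfolding conflation_additive_def
proof
  fix x assume x: "x \<in> E"
  obtain i p where ip: "x = (i, p)" by (cases x)
  have k: "keys (euler_elt x) \<subseteq> Iso C" using keys_euler_elt conflation_arr x unfolding ip by blast
  have "K0_coset (euler_elt x) = K0_coset 0" by (rule K0.fcoset_eq) (use euler_elt_relation[OF x] in simp)
  then have "frag_eval (values_of \<phi>) (euler_elt x) = frag_eval (values_of \<phi>) 0"
    using dual_pure_coset[OF phi k] dual_pure_coset[OF phi, of 0] by simp
  then show "frag_eval (values_of \<phi>) (euler_elt x) = 0" by simp
qed

lemma dual_eq_values:
  assumes "\<phi> \<in> dual_space (K0 C E)" "\<psi> \<in> dual_space (K0 C E)" "\<And>X. X \<in> Iso C \<Longrightarrow> values_of \<phi> X = values_of \<psi> X"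
  shows "\<phi> = \<psi>"
proof (rule tensor_K0.dual_eqI[OF assms(1,2)])
  fix g assume "g \<in> carrier (K0 C E)"
  then obtain x where x: "g = K0_coset x" "keys x \<subseteq> Iso C" unfolding carrier_K0 by blast
  show "\<phi> (pure_tensor (K0 C E) g 1) = \<psi> (pure_tensor (K0 C E) g 1)"
    unfolding x(1) dual_pure_coset[OF assms(1) x(2)] dual_pure_coset[OF assms(2) x(2)]
    by (rule frag_eval_cong) (use x(2) assms(3) in blast)
qed

end

locale conflation_pair = small: conflation_class K C E' + big: conflation_class K C E
  for K :: "('k, 'x) ring_scheme" and C :: "('o, 'm, 'k) lincat" and E' E :: "('m \<times> 'm) set" +
  assumes subset: "E' \<subseteq> E"
begin

lemma K0_relations_mono: "K0_relations C E' \<subseteq> K0_relations C E"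
  unfolding small.K0_relations_euler big.K0_relations_euler
  by (rule group.mono_generate[OF group_free_Abelian_group]) (use subset in blast)

lemma K0_map_coset: "K0_map C E (small.K0_coset x) = big.K0_coset x"
proof -
  have id: "frag_extend frag_of = (\<lambda>x. x)" using frag_expansion[symmetric] by blast
  show ?thesis unfolding K0_map_def
    using big.K0.image_coset[of "K0_relations C E'" frag_of x] K0_relations_mono small.K0.zero
    by (auto simp: id)
qed

lemma carrier_Lambda: "carrier (Lambda C E E') = {U \<in> carrier (K0 C E'). K0_map C E U = K0_relations C E}"
  unfolding Lambda_def kernel_def by (simp add: K0_def big.K0.one_Mod)

lemma mult_Lambda: "g \<otimes>\<^bsub>Lambda C E E'\<^esub> h = g \<otimes>\<^bsub>K0 C E'\<^esub> h"
  unfolding Lambda_def by simp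

lemma Lambda_sub: "g \<in> carrier (Lambda C E E') \<Longrightarrow> g \<in> carrier (K0 C E')"
  unfolding carrier_Lambda by simp

sublocale tensor_Lambda: tensor "Lambda C E E'"
proof
  fix g h assume gh: "g \<in> carrier (Lambda C E E')" "h \<in> carrier (Lambda C E E')"
  then obtain x y where xy: "g = small.K0_coset x" "h = small.K0_coset y"
    unfolding carrier_Lambda small.carrier_K0 by blast
  have "big.K0_coset x = big.K0_coset 0" "big.K0_coset y = big.K0_coset 0"
    using gh unfolding carrier_Lambda xy by (simp_all add: K0_map_coset big.K0.fcoset_zero)
  then have "big.K0_coset (x + y) = big.K0_coset (0 + 0)" unfolding big.mult_K0[symmetric] by simp
  moreover have "g \<otimes>\<^bsub>K0 C E'\<^esub> h \<in> carrier (K0 C E')"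
    using gh Lambda_sub small.tensor_K0.closed by blast
  ultimately show "g \<otimes>\<^bsub>Lambda C E E'\<^esub> h \<in> carrier (Lambda C E E')"
    unfolding mult_Lambda carrier_Lambda by (simp add: xy small.mult_K0 K0_map_coset big.K0.fcoset_zero)
qed

lemma euler_class_Lambda: "x \<in> E \<Longrightarrow> euler_class C E' x \<in> carrier (Lambda C E E')"
proof -
  assume x: "x \<in> E"
  obtain i p where ip: "x = (i, p)" by (cases x)
  have a: "i \<in> arr C" "p \<in> arr C" using big.conflation_arr x ip by auto
  have "big.K0_coset (small.euler_elt x) = big.K0_coset 0"
    by (rule big.K0.fcoset_eq) (use big.euler_elt_relation[OF x] in simp)
  then show ?thesis unfolding ip small.euler_class_coset[OF a] carrier_Lambda K0_map_coset
    using small.K0_coset_carrier[OF small.keys_euler_elt[OF a]] by (simp add: K0_map_coset big.K0.fcoset_zero)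
qed

lemma dual_lattice_incl:
  assumes phi: "\<phi> \<in> dual_space (K0 C E')" and U: "U \<in> carrier (real_tensor (Lambda C E E'))"
  shows "\<phi> (lattice_incl C E' U) = tensor_Lambda.functional (\<lambda>g. \<phi> (pure_tensor (K0 C E') g 1)) U"
  unfolding lattice_incl_def
  by (rule tensor_Lambda.dual_tensor_map[OF small.tensor_K0.tensor_axioms _ _ phi U]) (auto simp: Lambda_sub mult_Lambda)

lemma functional_Lambda_additive:
  assumes phi: "\<phi> \<in> dual_space (K0 C E')" and "g \<in> carrier (Lambda C E E')" "h \<in> carrier (Lambda C E E')"
  shows "\<phi> (pure_tensor (K0 C E') (g \<otimes>\<^bsub>Lambda C E E'\<^esub> h) 1) = \<phi> (pure_tensor (K0 C E') g 1) + \<phi> (pure_tensor (K0 C E') h 1)"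
  unfolding mult_Lambda by (rule small.tensor_K0.dual_additive[OF phi]) (use assms Lambda_sub in auto)

lemma functional_euler:
  assumes phi: "\<phi> \<in> dual_space (K0 C E')" and x: "x \<in> E"
  shows "tensor_Lambda.functional (\<lambda>g. \<phi> (pure_tensor (K0 C E') g 1)) (pure_tensor (Lambda C E E') (euler_class C E' x) 1)
    = frag_eval (small.values_of \<phi>) (small.euler_elt x)"
proof -
  obtain i p where ip: "x = (i, p)" by (cases x)
  have a: "i \<in> arr C" "p \<in> arr C" using big.conflation_arr x ip by auto
  have "tensor_Lambda.functional (\<lambda>g. \<phi> (pure_tensor (K0 C E') g 1)) (pure_tensor (Lambda C E E') (euler_class C E' x) 1)
    = \<phi> (pure_tensor (K0 C E') (euler_class C E' x) 1)"
    by (rule tensor_Lambda.functional_pure[OF functional_Lambda_additive[OF phi] euler_class_Lambda[OF x]])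
  also have "\<dots> = frag_eval (small.values_of \<phi>) (small.euler_elt x)"
    unfolding ip small.euler_class_coset[OF a] by (rule small.dual_pure_coset[OF phi small.keys_euler_elt[OF a]])
  finally show ?thesis .
qed

lemma cone_image: "conflation_cone C E E' = cone_generated (Lambda C E E')
    ((\<lambda>g. pure_tensor (Lambda C E E') g 1) ` (euler_class C E' ` (E - E')))"
  unfolding conflation_cone_def image_image ..

lemma cone_gens: "euler_class C E' ` (E - E') \<subseteq> carrier (Lambda C E E')"
  using euler_class_Lambda by blast

lemma cone_gens_tensor: "(\<lambda>g. pure_tensor (Lambda C E E') g 1) ` (euler_class C E' ` (E - E')) \<subseteq> carrier (real_tensor (Lambda C E E'))"
  using cone_gens tensor_Lambda.pure_tensor_carrier by blast

lemma generator_in_cone: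
  assumes "x \<in> E - E'" shows "pure_tensor (Lambda C E E') (euler_class C E' x) 1 \<in> conflation_cone C E E'"
proof -
  let ?s = "pure_tensor (Lambda C E E') (euler_class C E' x) 1"
  have "\<one>\<^bsub>real_tensor (Lambda C E E')\<^esub> \<otimes>\<^bsub>real_tensor (Lambda C E E')\<^esub> real_scale (Lambda C E E') 1 ?s \<in> conflation_cone C E E'"
    unfolding cone_image by (rule cone_generated.add_multiple[OF cone_generated.zero]) (use assms in auto)
  then show ?thesis
    unfolding tensor_Lambda.tensor_one tensor_Lambda.pure_tensor_class tensor_Lambda.real_scale_class tensor_Lambda.tensor_mult by simp
qed

text \<open>
  The generators of the cone are the classes of the conflations outside \<open>E'\<close>; a functional
  on the Grothendieck group of \<open>E'\<close> vanishes on those of \<open>E'\<close> by definition.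
\<close>

lemma vanishes_on_cone_iff:
  assumes phi: "\<phi> \<in> dual_space (K0 C E')"
  shows "(\<forall>y\<in>conflation_cone C E E'. \<phi> (lattice_incl C E' y) = 0) \<longleftrightarrow> big.conflation_additive (small.values_of \<phi>)"
proof
  assume v: "\<forall>y\<in>conflation_cone C E E'. \<phi> (lattice_incl C E' y) = 0"
  show "big.conflation_additive (small.values_of \<phi>)" unfolding big.conflation_additive_def
  proof
    fix x assume x: "x \<in> E"
    show "frag_eval (small.values_of \<phi>) (small.euler_elt x) = 0"
    proof (cases "x \<in> E'")
      case True
      then show ?thesis using small.values_of_additive[OF phi] unfolding small.conflation_additive_def by blast
    next
      case False
      let ?s = "pure_tensor (Lambda C E E') (euler_class C E' x) 1"
      have "\<phi> (lattice_incl C E' ?s) = 0" using v generator_in_cone x False by blast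
      then show ?thesis
        using dual_lattice_incl[OF phi tensor_Lambda.pure_tensor_carrier[OF euler_class_Lambda[OF x]]] functional_euler[OF phi x]
        by simp
    qed
  qed
next
  assume a: "big.conflation_additive (small.values_of \<phi>)"
  let ?L = "tensor_Lambda.functional (\<lambda>g. \<phi> (pure_tensor (K0 C E') g 1))"
  have L: "?L \<in> dual_space (Lambda C E E')" by (rule tensor_Lambda.functional_dual[OF functional_Lambda_additive[OF phi]])
  show "\<forall>y\<in>conflation_cone C E E'. \<phi> (lattice_incl C E' y) = 0"
  proof
    fix y assume y: "y \<in> conflation_cone C E E'"
    have "?L s = 0" if "s \<in> (\<lambda>g. pure_tensor (Lambda C E E') g 1) ` (euler_class C E' ` (E - E'))" for s
      using that a functional_euler[OF phi] unfolding big.conflation_additive_def by auto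
    from tensor_Lambda.cone_zero[OF L cone_gens_tensor this y[unfolded cone_image]]
    show "\<phi> (lattice_incl C E' y) = 0"
      using dual_lattice_incl[OF phi tensor_Lambda.cone_carrier[OF cone_gens_tensor y[unfolded cone_image]]] by simp
  qed
qed

text \<open>
  A nonzero element of the cone is a combination of generators in which some coefficient is positive.
\<close>

lemma positive_on_cone:
  assumes phi: "\<phi> \<in> dual_space (K0 C E')" and pos: "\<And>x. x \<in> E - E' \<Longrightarrow> frag_eval (small.values_of \<phi>) (small.euler_elt x) > 0"
    and y: "y \<in> conflation_cone C E E'" "y \<noteq> \<one>\<^bsub>real_tensor (Lambda C E E')\<^esub>"
  shows "\<phi> (lattice_incl C E' y) > 0"
proof -
  let ?L = "tensor_Lambda.functional (\<lambda>g. \<phi> (pure_tensor (K0 C E') g 1))"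
  have L: "?L \<in> dual_space (Lambda C E E')" by (rule tensor_Lambda.functional_dual[OF functional_Lambda_additive[OF phi]])
  have "?L (pure_tensor (Lambda C E E') g 1) > 0" if "g \<in> euler_class C E' ` (E - E')" for g
    using that pos functional_euler[OF phi] by auto
  from tensor_Lambda.cone_positive[OF L cone_gens this y(1)[unfolded cone_image] y(2)]
  show ?thesis
    using dual_lattice_incl[OF phi tensor_Lambda.cone_carrier[OF cone_gens_tensor y(1)[unfolded cone_image]]] by simp
qed

text \<open>
  Positivity can only be tested on a generator that is nonzero, which the auxiliary functional \<open>\<psi>\<close>
  certifies.
\<close>

lemma positive_on_generator:
  assumes phi: "\<phi> \<in> dual_space (K0 C E')" and x: "x \<in> E - E'"
    and pos: "\<And>y. y \<in> conflation_cone C E E' \<Longrightarrow> y \<noteq> \<one>\<^bsub>real_tensor (Lambda C E E')\<^esub> \<Longrightarrow> \<phi> (lattice_incl C E' y) > 0"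
    and psi: "\<psi> \<in> dual_space (K0 C E')" "frag_eval (small.values_of \<psi>) (small.euler_elt x) \<noteq> 0"
  shows "frag_eval (small.values_of \<phi>) (small.euler_elt x) > 0"
proof -
  let ?s = "pure_tensor (Lambda C E E') (euler_class C E' x) 1"
  have xE: "x \<in> E" using x by simp
  have "?s \<noteq> \<one>\<^bsub>real_tensor (Lambda C E E')\<^esub>"
  proof
    assume s: "?s = \<one>\<^bsub>real_tensor (Lambda C E E')\<^esub>"
    have "tensor_Lambda.functional (\<lambda>g. \<psi> (pure_tensor (K0 C E') g 1)) ?s = 0"
      unfolding s by (rule tensor_Lambda.dual_one[OF tensor_Lambda.functional_dual[OF functional_Lambda_additive[OF psi(1)]]])
    then show False using functional_euler[OF psi(1) xE] psi(2) by simp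
  qed
  then have "\<phi> (lattice_incl C E' ?s) > 0" using pos generator_in_cone[OF x] by blast
  then show ?thesis
    using dual_lattice_incl[OF phi tensor_Lambda.pure_tensor_carrier[OF euler_class_Lambda[OF xE]]] functional_euler[OF phi xE] by simp
qed

end

locale split_pair = conflation_pair K C "split_structure C" E
  for K :: "('k, 'x) ring_scheme" and C :: "('o, 'm, 'k) lincat" and E :: "('m \<times> 'm) set"
begin

text \<open>
  Classes of objects generate both groups, so the descended functional is the one given by the same
  function on isomorphism classes.
\<close>

lemma descended_eq:
  assumes phi: "\<phi> \<in> dual_space (K0 C (split_structure C))" and a: "big.conflation_additive (small.values_of \<phi>)"
  shows "descended C E \<phi> = big.functional_of (small.values_of \<phi>)"
  unfolding descended_def
proof (rule the_equality)
  let ?S = "split_structure C"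
  have map_closed: "K0_map C E g \<in> carrier (K0 C E)" if "g \<in> carrier (K0 C ?S)" for g
    using that unfolding small.carrier_K0 by (auto simp: K0_map_coset intro!: big.K0_coset_carrier)
  have map_hom: "K0_map C E (g \<otimes>\<^bsub>K0 C ?S\<^esub> h) = K0_map C E g \<otimes>\<^bsub>K0 C E\<^esub> K0_map C E h"
    if "g \<in> carrier (K0 C ?S)" "h \<in> carrier (K0 C ?S)" for g h
    using that unfolding small.carrier_K0 by (auto simp: K0_map_coset small.mult_K0 big.mult_K0)
  have eval: "\<psi> (real_tensor_map (K0 C E) (K0_map C E) z) = small.tensor_K0.functional (\<lambda>g. \<psi> (pure_tensor (K0 C E) (K0_map C E g) 1)) z"
    if "\<psi> \<in> dual_space (K0 C E)" "z \<in> carrier (real_tensor (K0 C ?S))" for \<psi> z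
    by (rule small.tensor_K0.dual_tensor_map[OF big.tensor_K0.tensor_axioms map_closed map_hom that]) 
  have lin: "\<psi> (pure_tensor (K0 C E) (K0_map C E (g \<otimes>\<^bsub>K0 C ?S\<^esub> h)) 1) =
      \<psi> (pure_tensor (K0 C E) (K0_map C E g) 1) + \<psi> (pure_tensor (K0 C E) (K0_map C E h) 1)"
    if "\<psi> \<in> dual_space (K0 C E)" "g \<in> carrier (K0 C ?S)" "h \<in> carrier (K0 C ?S)" for \<psi> g h
    unfolding map_hom[OF that(2,3)] by (rule big.tensor_K0.dual_additive[OF that(1) map_closed[OF that(2)] map_closed[OF that(3)]])
  let ?F = "big.functional_of (small.values_of \<phi>)"
  have F: "?F \<in> dual_space (K0 C E)" by (rule big.functional_of_dual[OF a])
  have "small.tensor_K0.functional (\<lambda>g. ?F (pure_tensor (K0 C E) (K0_map C E g) 1)) = \<phi>"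
  proof (rule small.tensor_K0.dual_eqI[OF _ phi])
    show "small.tensor_K0.functional (\<lambda>g. ?F (pure_tensor (K0 C E) (K0_map C E g) 1)) \<in> dual_space (K0 C ?S)"
      by (rule small.tensor_K0.functional_dual[OF lin[OF F]])
    fix g assume g: "g \<in> carrier (K0 C ?S)"
    then obtain x where x: "g = small.K0_coset x" "keys x \<subseteq> Iso C" unfolding small.carrier_K0 by blast
    have "small.tensor_K0.functional (\<lambda>g. ?F (pure_tensor (K0 C E) (K0_map C E g) 1)) (pure_tensor (K0 C ?S) g 1)
        = ?F (pure_tensor (K0 C E) (K0_map C E g) 1)"
      by (rule small.tensor_K0.functional_pure[OF lin[OF F] g])
    also have "\<dots> = frag_eval (small.values_of \<phi>) x" unfolding x(1) K0_map_coset by (rule big.functional_of_pure[OF a x(2)])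
    also have "\<dots> = \<phi> (pure_tensor (K0 C ?S) g 1)" unfolding x(1) by (rule small.dual_pure_coset[OF phi x(2), symmetric])
    finally show "small.tensor_K0.functional (\<lambda>g. ?F (pure_tensor (K0 C E) (K0_map C E g) 1)) (pure_tensor (K0 C ?S) g 1)
        = \<phi> (pure_tensor (K0 C ?S) g 1)" .
  qed
  then show "?F \<in> dual_space (K0 C E) \<and> (\<forall>z\<in>carrier (real_tensor (K0 C ?S)). ?F (real_tensor_map (K0 C E) (K0_map C E) z) = \<phi> z)"
    using F eval[OF F] by simp
  fix \<psi> assume psi: "\<psi> \<in> dual_space (K0 C E) \<and> (\<forall>z\<in>carrier (real_tensor (K0 C ?S)). \<psi> (real_tensor_map (K0 C E) (K0_map C E) z) = \<phi> z)"
  show "\<psi> = ?F"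
  proof (rule big.dual_eq_values[OF _ F])
    show p: "\<psi> \<in> dual_space (K0 C E)" using psi by simp
    fix X assume X: "X \<in> Iso C"
    let ?g = "small.K0_coset (frag_of X)"
    have g: "?g \<in> carrier (K0 C ?S)" by (rule small.K0_coset_carrier) (use X in simp)
    have "big.values_of \<psi> X = \<psi> (pure_tensor (K0 C E) (K0_map C E ?g) 1)"
      unfolding big.values_of_def big.K0_class_coset K0_map_coset ..
    also have "\<dots> = small.tensor_K0.functional (\<lambda>g. \<psi> (pure_tensor (K0 C E) (K0_map C E g) 1)) (pure_tensor (K0 C ?S) ?g 1)"
      by (rule small.tensor_K0.functional_pure[OF lin[OF p] g, symmetric])
    also have "\<dots> = \<phi> (pure_tensor (K0 C ?S) ?g 1)"
      using psi eval[OF p small.tensor_K0.pure_tensor_carrier[OF g]] small.tensor_K0.pure_tensor_carrier[OF g] by metis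
    also have "\<dots> = small.values_of \<phi> X" unfolding small.values_of_def small.K0_class_coset ..
    also have "\<dots> = big.values_of ?F X" using big.values_functional_of[OF a X] by simp
    finally show "big.values_of \<psi> X = big.values_of ?F X" .
  qed
qed

end

section \<open>Degree filtrations of an algebra with a basis\<close>

text \<open>
  Rational linearity comes for free from additivity.
\<close>

lemma additive_rat_linear:
  fixes g :: "rat \<Rightarrow> rat"
  assumes add: "\<And>p q. g (p + q) = g p + g q"
  shows "g q = q * g 1"
proof -
  have g0: "g 0 = 0" using add[of 0 0] by simp
  have neg: "g (- p) = - g p" for p using add[of p "- p"] g0 by simp
  have nat: "g (of_nat n * p) = of_nat n * g p" for n p
    by (induction n) (simp_all add: g0 add distrib_right)
  have int: "g (of_int a) = of_int a * g 1" for a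
  proof (cases a)
    case (nonneg n) then show ?thesis using nat[of n 1] by simp
  next
    case (neg n) then show ?thesis using nat[of "Suc n" 1] \<open>\<And>p. g (- p) = - g p\<close> by (simp del: of_nat_Suc)
  qed
  obtain a b where ab: "q = of_int a / of_int b" "b > 0"
    by (metis quotient_of_div quotient_of_denom_pos surj_pair)
  then have "of_nat (nat b) * q = of_int a" by simp
  then have "of_nat (nat b) * g q = of_int a * g 1" using nat[of "nat b" q] int by simp
  then have "of_int b * g q = of_int a * g 1" using ab(2) by simp
  moreover have "of_int a = of_int b * q" using ab by simp
  ultimately have "of_int b * g q = of_int b * (q * g 1)" by (simp add: mult.assoc)
  then show ?thesis using ab(2) by simp
qed

text \<open>
  An algebra structure given by structure constants \<open>c\<close> on the rational vector space with basis \<open>I\<close> and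
  unit \<open>u\<close>, such as a Hall algebra.
\<close>

locale based_algebra =
  fixes R :: "('a \<Rightarrow>\<^sub>0 rat, 'b) ring_scheme" and I :: "'a set" and c :: "'a \<Rightarrow> 'a \<Rightarrow> 'a \<Rightarrow> rat" and u :: 'a
  assumes carrier: "carrier R = {x. keys x \<subseteq> I}"
    and add_R: "add R = (+)" and zero_R: "zero R = 0" and one_R: "one R = single u 1" and u: "u \<in> I"
    and keys_mult: "keys x \<subseteq> I \<Longrightarrow> keys y \<subseteq> I \<Longrightarrow> keys (x \<otimes>\<^bsub>R\<^esub> y) \<subseteq> I"
    and lookup_mult: "keys x \<subseteq> I \<Longrightarrow> keys y \<subseteq> I \<Longrightarrow> Y \<in> I \<Longrightarrow>
      lookup (x \<otimes>\<^bsub>R\<^esub> y) Y = (\<Sum>X\<in>keys x. \<Sum>Z\<in>keys y.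
        lookup x X * lookup y Z * c X Z Y)"
begin

lemma keys_subset_iff: "keys x \<subseteq> S \<longleftrightarrow> (\<forall>Y. lookup x Y \<noteq> 0 \<longrightarrow> Y \<in> S)"
  by (auto simp: in_keys_iff)

lemma abelian: "abelian_group R"
proof (rule abelian_groupI)
  show "\<exists>y\<in>carrier R. y \<oplus>\<^bsub>R\<^esub> x = \<zero>\<^bsub>R\<^esub>" if "x \<in> carrier R" for x
    by (rule bexI[of _ "- x"]) (use that in \<open>auto simp: carrier add_R zero_R keys_minus\<close>)
  show "x \<oplus>\<^bsub>R\<^esub> y \<in> carrier R" if "x \<in> carrier R" "y \<in> carrier R" for x y
    using that keys_add[of x y] by (auto simp: carrier add_R)
qed (auto simp: carrier add_R zero_R algebra_simps)

lemma minus_R: "x \<in> carrier R \<Longrightarrow> inv\<^bsub>add_monoid R\<^esub> x = - x"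
  using abelian_group.minus_equality[OF abelian, of "- x" x]
  by (simp add: a_inv_def add_R zero_R carrier keys_minus)

lemma finsum_R:
  assumes "finite S" "\<And>s. s \<in> S \<Longrightarrow> keys (f s) \<subseteq> I"
  shows "finsum R f S = sum f S \<and> keys (sum f S) \<subseteq> I"
  using assms
proof (induction S)
  case empty
  then show ?case by (simp add: abelian_monoid.finsum_empty[OF abelian_group.axioms(1)[OF abelian]] zero_R)
next
  case (insert s S)
  have "finsum R f (insert s S) = f s \<oplus>\<^bsub>R\<^esub> finsum R f S"
    by (rule abelian_monoid.finsum_insert[OF abelian_group.axioms(1)[OF abelian]]) (use insert in \<open>auto simp: carrier\<close>)
  then show ?case using insert keys_add[of "f s" "sum f S"] by (auto simp: add_R)
qed

lemma lookup_mult_superset: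
  assumes "keys x \<subseteq> I" "keys y \<subseteq> I" "Y \<in> I"
    and "finite A" "keys x \<subseteq> A" "finite B" "keys y \<subseteq> B"
  shows "lookup (x \<otimes>\<^bsub>R\<^esub> y) Y = (\<Sum>X\<in>A. \<Sum>Z\<in>B.
        lookup x X * lookup y Z * c X Z Y)"
proof -
  have "(\<Sum>X\<in>keys x. \<Sum>Z\<in>keys y. lookup x X * lookup y Z * c X Z Y)
      = (\<Sum>X\<in>keys x. \<Sum>Z\<in>B. lookup x X * lookup y Z * c X Z Y)"
    by (intro sum.cong refl sum.mono_neutral_left assms) (simp add: in_keys_iff)
  also have "\<dots> = (\<Sum>X\<in>A. \<Sum>Z\<in>B. lookup x X * lookup y Z * c X Z Y)"
    by (intro sum.mono_neutral_left assms) (simp add: in_keys_iff)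
  finally show ?thesis using lookup_mult[OF assms(1-3)] by simp
qed

lemma lookup_mult_single:
  assumes "X \<in> I" "Z \<in> I" "Y \<in> I"
  shows "lookup (single X 1 \<otimes>\<^bsub>R\<^esub> single Z 1) Y = c X Z Y"
  using lookup_mult[of "single X 1" "single Z 1" Y] assms by simp

lemma mult_zero:
  assumes "keys x \<subseteq> I" shows "0 \<otimes>\<^bsub>R\<^esub> x = 0" "x \<otimes>\<^bsub>R\<^esub> 0 = 0"
proof -
  have "lookup (0 \<otimes>\<^bsub>R\<^esub> x) Y = 0 \<and> lookup (x \<otimes>\<^bsub>R\<^esub> 0) Y = 0" for Y
  proof (cases "Y \<in> I")
    case True
    then show ?thesis using lookup_mult[of 0 x Y] lookup_mult[of x 0 Y] assms by simp
  next
    case False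
    then have "Y \<notin> keys (0 \<otimes>\<^bsub>R\<^esub> x)" "Y \<notin> keys (x \<otimes>\<^bsub>R\<^esub> 0)"
      using keys_mult[of 0 x] keys_mult[of x 0] assms by auto
    then show ?thesis by (simp add: in_keys_iff)
  qed
  then show "0 \<otimes>\<^bsub>R\<^esub> x = 0" "x \<otimes>\<^bsub>R\<^esub> 0 = 0" by (auto intro!: poly_mapping_eqI)
qed

end

locale based_filtration = based_algebra R I c u
  for R :: "('a \<Rightarrow>\<^sub>0 rat, 'b) ring_scheme" and I c u +
  fixes deg :: "'a \<Rightarrow> real"
  assumes deg_u: "deg u = 0"
begin

definition filt :: "real \<Rightarrow> ('a \<Rightarrow>\<^sub>0 rat) set" where
  "filt t = {x. keys x \<subseteq> {X \<in> I. deg X \<le> t}}"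

definition filtered :: bool where
  "filtered \<longleftrightarrow> (\<forall>X\<in>I. \<forall>Z\<in>I. \<forall>Y\<in>I. c X Z Y \<noteq> 0 \<longrightarrow> deg Y \<le> deg X + deg Z)"

lemma filt_carrier: "x \<in> filt t \<Longrightarrow> keys x \<subseteq> I" unfolding filt_def by auto

lemma filt_add: "x \<in> filt t \<Longrightarrow> y \<in> filt t \<Longrightarrow> x + y \<in> filt t"
  unfolding filt_def using keys_add[of x y] by auto

lemma filt_sum: "finite S \<Longrightarrow> (\<And>r. r \<in> S \<Longrightarrow> f r \<in> filt t) \<Longrightarrow> sum f S \<in> filt t"
proof (induction S rule: finite_induct)
  case empty
  show ?case by (simp add: filt_def)
next
  case (insert x S)
  then show ?case by (simp add: filt_add)
qed

lemma filt_minus: "x \<in> filt t \<Longrightarrow> - x \<in> filt t" unfolding filt_def by (simp add: keys_minus)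

lemma filtered_mult:
  assumes "filtered" "x \<in> filt s" "y \<in> filt t" shows "x \<otimes>\<^bsub>R\<^esub> y \<in> filt (s + t)"
proof -
  have k: "keys x \<subseteq> I" "keys y \<subseteq> I" using assms filt_carrier by auto
  have "Y \<in> I \<and> deg Y \<le> s + t" if Y: "Y \<in> keys (x \<otimes>\<^bsub>R\<^esub> y)" for Y
  proof -
    have YI: "Y \<in> I" using keys_mult[OF k] Y by auto
    have "(\<Sum>X\<in>keys x. \<Sum>Z\<in>keys y. lookup x X * lookup y Z * c X Z Y) \<noteq> 0"
      using Y lookup_mult[OF k YI] by (simp add: in_keys_iff)
    then obtain X where X: "X \<in> keys x" "(\<Sum>Z\<in>keys y. lookup x X * lookup y Z * c X Z Y) \<noteq> 0"
      using sum.neutral by meson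
    then obtain Z where Z: "Z \<in> keys y" "lookup x X * lookup y Z * c X Z Y \<noteq> 0"
      using sum.neutral by meson
    have "X \<in> I" "deg X \<le> s" "Z \<in> I" "deg Z \<le> t" using X Z assms(2,3) unfolding filt_def by auto
    then have "deg Y \<le> deg X + deg Z" using assms(1) YI Z(2) unfolding filtered_def by auto
    then show ?thesis using YI \<open>deg X \<le> s\<close> \<open>deg Z \<le> t\<close> by auto
  qed
  then show ?thesis unfolding filt_def by blast
qed

lemma algebra_filtration_iff: "algebra_filtration R filt \<longleftrightarrow> filtered"
proof
  assume a: "algebra_filtration R filt"
  show filtered unfolding filtered_def
  proof (intro ballI impI)
    fix X Z Y assume I: "X \<in> I" "Z \<in> I" "Y \<in> I" and c: "c X Z Y \<noteq> 0"
    let ?x = "single X 1 :: 'a \<Rightarrow>\<^sub>0 rat" and ?z = "single Z 1 :: 'a \<Rightarrow>\<^sub>0 rat"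
    have "?x \<in> filt (deg X)" "?z \<in> filt (deg Z)" unfolding filt_def using I by auto
    then have "?x \<otimes>\<^bsub>R\<^esub> ?z \<in> filt (deg X + deg Z)" using a unfolding algebra_filtration_def by blast
    moreover have "Y \<in> keys (?x \<otimes>\<^bsub>R\<^esub> ?z)" using lookup_mult_single[OF I] c by (simp add: in_keys_iff)
    ultimately show "deg Y \<le> deg X + deg Z" unfolding filt_def by auto
  qed
next
  assume f: filtered
  show "algebra_filtration R filt" unfolding algebra_filtration_def
  proof (intro conjI allI impI ballI)
    fix t show "additive_subgroup (filt t) R"
    proof (rule additive_subgroup.intro, rule subgroup.intro)
      show "filt t \<subseteq> carrier (add_monoid R)" using filt_carrier by (auto simp: carrier)
      show "x \<otimes>\<^bsub>add_monoid R\<^esub> y \<in> filt t" if "x \<in> filt t" "y \<in> filt t" for x y using filt_add that by (simp add: add_R)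
      show "\<one>\<^bsub>add_monoid R\<^esub> \<in> filt t" by (simp add: zero_R filt_def)
      show "inv\<^bsub>add_monoid R\<^esub> x \<in> filt t" if "x \<in> filt t" for x
        using minus_R[of x] filt_minus[OF that] filt_carrier[OF that] by (simp add: carrier)
    qed
  next
    show "filt s \<subseteq> filt t" if "s \<le> t" for s t using that unfolding filt_def by fastforce
    show "(\<Union>t. filt t) = carrier R"
    proof (intro equalityI subsetI)
      fix x assume "x \<in> carrier R"
      then have k: "keys x \<subseteq> I" by (simp add: carrier)
      have "x \<in> filt (Max (insert 0 (deg ` keys x)))"
        unfolding filt_def using k by (auto simp: subset_iff intro!: Max_ge)
      then show "x \<in> (\<Union>t. filt t)" by blast
    qed (use filt_carrier in \<open>auto simp: carrier\<close>)
    show "\<one>\<^bsub>R\<^esub> \<in> filt 0" unfolding one_R filt_def using u deg_u by simp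
    show "x \<otimes>\<^bsub>R\<^esub> y \<in> filt (s + t)" if "x \<in> filt s" "y \<in> filt t" for s t x y by (rule filtered_mult[OF f that])
  qed
qed

abbreviation below where "below \<equiv> filtration_below filt"

lemma below_eq: "below t = {x. keys x \<subseteq> {X \<in> I. deg X < t}}"
proof (intro equalityI subsetI)
  fix x assume "x \<in> below t" then show "x \<in> {x. keys x \<subseteq> {X \<in> I. deg X < t}}"
    unfolding filtration_below_def filt_def by fastforce
next
  fix x :: "'a \<Rightarrow>\<^sub>0 rat" assume x: "x \<in> {x. keys x \<subseteq> {X \<in> I. deg X < t}}"
  let ?m = "Max (insert (t - 1) (deg ` keys x))"
  have "?m < t" using x by (subst Max_less_iff) auto
  moreover have "x \<in> filt ?m" unfolding filt_def using x by (auto simp: subset_iff intro!: Max_ge)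
  ultimately show "x \<in> below t" unfolding filtration_below_def by auto
qed

text \<open>
  The coset of \<open>x\<close> in degree \<open>t\<close> is determined by the homogeneous component of \<open>x\<close> of degree \<open>t\<close>.  This pointwise
  description replaces computations with representatives.
\<close>

definition level :: "real \<Rightarrow> ('a \<Rightarrow>\<^sub>0 rat) \<Rightarrow> ('a \<Rightarrow>\<^sub>0 rat) set" where
  "level t x = {w \<in> filt t. \<forall>Y\<in>I. deg Y = t \<longrightarrow> lookup w Y = lookup x Y}"

lemma level_cong: "(\<And>Y. Y \<in> I \<Longrightarrow> deg Y = t \<Longrightarrow> lookup x Y = lookup y Y) \<Longrightarrow> level t x = level t y"
  unfolding level_def by auto

lemma below_iff: "w \<in> below t \<longleftrightarrow> w \<in> filt t \<and> (\<forall>Y\<in>I. deg Y = t \<longrightarrow> lookup w Y = 0)"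
  unfolding below_eq filt_def by (force simp: subset_iff in_keys_iff less_le)

lemma level_zero: "level t 0 = below t" using below_iff unfolding level_def by auto

lemma filt_diff: "x \<in> filt t \<Longrightarrow> y \<in> filt t \<Longrightarrow> x - y \<in> filt t"
  using filt_add[of x t "- y"] filt_minus by simp

lemma coset_eq: assumes "a \<in> filt t" shows "below t +>\<^bsub>R\<^esub> a = level t a"
proof (intro equalityI subsetI)
  fix w assume "w \<in> below t +>\<^bsub>R\<^esub> a"
  then obtain h where "h \<in> below t" "w = h + a" unfolding a_r_coset_def r_coset_def by (auto simp: add_R)
  then show "w \<in> level t a" using assms filt_add unfolding level_def below_iff by (auto simp: lookup_add)
next
  fix w assume w: "w \<in> level t a"
  then have "w - a \<in> below t" using assms filt_diff unfolding level_def below_iff by (auto simp: lookup_minus)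
  then show "w \<in> below t +>\<^bsub>R\<^esub> a" unfolding a_r_coset_def r_coset_def
    by (auto simp: add_R intro!: bexI[of _ "w - a"])
qed

definition homog :: "real \<Rightarrow> ('a \<Rightarrow>\<^sub>0 rat) \<Rightarrow> 'a \<Rightarrow>\<^sub>0 rat" where
  "homog t x = Abs_poly_mapping (\<lambda>X. if deg X = t then lookup x X else 0)"

lemma lookup_homog: "lookup (homog t x) X = (if deg X = t then lookup x X else 0)"
proof -
  have "finite {X. (if deg X = t then lookup x X else 0) \<noteq> 0}"
    by (rule finite_subset[OF _ finite_keys[of x]]) (auto simp: in_keys_iff)
  then show ?thesis unfolding homog_def by simp
qed

lemma homog_level: assumes "keys x \<subseteq> I" shows "homog t x \<in> level t x"
  unfolding level_def filt_def using assms by (auto simp: subset_iff in_keys_iff lookup_homog split: if_splits)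

lemma level_filt: "level t x \<subseteq> filt t" unfolding level_def by auto

lemma level_mem: "w \<in> level t x \<Longrightarrow> level t w = level t x" unfolding level_def by auto

lemma level_add_mem: "w \<in> level t x \<Longrightarrow> v \<in> level t y \<Longrightarrow> w + v \<in> level t (x + y)"
  unfolding level_def using filt_add by (auto simp: lookup_add)

lemma set_add_level:
  assumes "keys y \<subseteq> I"
  shows "level t x <+>\<^bsub>R\<^esub> level t y = level t (x + y)"
proof (intro equalityI subsetI)
  fix w assume "w \<in> level t x <+>\<^bsub>R\<^esub> level t y"
  then show "w \<in> level t (x + y)" using level_add_mem unfolding set_add_def set_mult_def by (auto simp: add_R)
next
  fix w assume w: "w \<in> level t (x + y)"
  let ?h = "homog t y"
  have h: "?h \<in> level t y" by (rule homog_level[OF assms])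
  have "w - ?h \<in> level t x" using w h filt_diff unfolding level_def by (auto simp: lookup_add lookup_minus)
  then have "\<exists>a\<in>level t x. \<exists>b\<in>level t y. w = a + b" using h
    by (intro bexI[of _ "w - ?h"] bexI[of _ ?h]) simp_all
  then show "w \<in> level t x <+>\<^bsub>R\<^esub> level t y" unfolding set_add_def set_mult_def by (auto simp: add_R)
qed

lemma graded_class_level:
  assumes "X \<in> I"
  shows "graded_class R filt (deg X) (single X 1) = (\<lambda>t. level t (single X 1))"
proof
  fix t
  have "single X 1 \<in> filt (deg X)" unfolding filt_def using assms by auto
  moreover have "level t (single X 1) = below t" if "t \<noteq> deg X"
    unfolding level_zero[symmetric] by (rule level_cong) (use that in \<open>auto simp: lookup_single when_def\<close>)
  ultimately show "graded_class R filt (deg X) (single X 1) t = level t (single X 1)"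
    unfolding graded_class_def using coset_eq by auto
qed

lemma graded_carrier:
  assumes "f \<in> carrier (associated_graded R filt)"
  obtains w where "\<And>t. w t \<in> filt t" "\<And>t. f t = level t (w t)" "finite {t. f t \<noteq> below t}"
proof -
  have "\<forall>t. \<exists>a\<in>filt t. f t = below t +>\<^bsub>R\<^esub> a" "finite {t. f t \<noteq> below t}"
    using assms unfolding associated_graded_def by auto
  moreover from this(1) obtain w where "\<And>t. w t \<in> filt t \<and> f t = below t +>\<^bsub>R\<^esub> w t" by metis
  ultimately show ?thesis using that[of w] coset_eq by auto
qed

lemma level_in_carrier:
  assumes x: "keys x \<subseteq> I" shows "(\<lambda>t. level t x) \<in> carrier (associated_graded R filt)"
proof -
  have "level t x \<in> (\<lambda>a. below t +>\<^bsub>R\<^esub> a) ` filt t" for t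
  proof
    have "homog t x \<in> level t x" by (rule homog_level[OF x])
    then show "homog t x \<in> filt t" "level t x = below t +>\<^bsub>R\<^esub> homog t x"
      using level_filt coset_eq[of "homog t x" t] level_mem by auto
  qed
  moreover have "finite {t. level t x \<noteq> below t}"
  proof (rule finite_subset[OF _ finite_imageI[OF finite_keys[of x], of deg]])
    show "{t. level t x \<noteq> below t} \<subseteq> deg ` keys x"
    proof
      fix t assume t: "t \<in> {t. level t x \<noteq> below t}"
      show "t \<in> deg ` keys x"
      proof (rule ccontr)
        assume n: "t \<notin> deg ` keys x"
        have "level t x = level t 0" by (rule level_cong) (use n in \<open>auto simp: in_keys_iff\<close>)
        then show False using t level_zero by simp
      qed
    qed
  qed
  ultimately show ?thesis unfolding associated_graded_def by simp
qed

text \<open>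
  In the top degree only the homogeneous components of the factors contribute: a nonzero structure
  constant does not raise degrees.
\<close>

lemma lookup_product:
  assumes f: filtered and x: "keys x \<subseteq> I" and y: "keys y \<subseteq> I"
    and a: "a \<in> level r x" and b: "b \<in> level s y" and Y: "Y \<in> I" "deg Y = r + s"
  shows "lookup (a \<otimes>\<^bsub>R\<^esub> b) Y = (\<Sum>X\<in>keys x. \<Sum>Z\<in>keys y.
    if deg X = r \<and> deg Z = s then lookup x X * lookup y Z * c X Z Y else 0)"
proof -
  let ?A = "keys a \<union> keys x" and ?B = "keys b \<union> keys y"
  let ?h = "\<lambda>X Z. if deg X = r \<and> deg Z = s then lookup x X * lookup y Z * c X Z Y else 0"
  have ka: "keys a \<subseteq> I" and kb: "keys b \<subseteq> I" using a b level_filt filt_carrier by blast+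
  have "lookup (a \<otimes>\<^bsub>R\<^esub> b) Y = (\<Sum>X\<in>?A. \<Sum>Z\<in>?B. lookup a X * lookup b Z * c X Z Y)"
    by (rule lookup_mult_superset[OF ka kb Y(1)]) auto
  also have "\<dots> = (\<Sum>X\<in>?A. \<Sum>Z\<in>?B. ?h X Z)"
  proof (intro sum.cong refl)
    fix X Z assume XZ: "X \<in> ?A" "Z \<in> ?B"
    then have I: "X \<in> I" "Z \<in> I" using ka kb x y by auto
    show "lookup a X * lookup b Z * c X Z Y = ?h X Z"
    proof (cases "deg X = r \<and> deg Z = s")
      case True
      then show ?thesis using a b I unfolding level_def by simp
    next
      case False
      have "lookup a X * lookup b Z * c X Z Y = 0"
      proof (rule ccontr)
        assume "lookup a X * lookup b Z * c X Z Y \<noteq> 0"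
        then have n: "X \<in> keys a" "Z \<in> keys b" "c X Z Y \<noteq> 0" by (auto simp: in_keys_iff)
        then have "deg X \<le> r" "deg Z \<le> s" using a b unfolding level_def filt_def by auto
        moreover have "deg Y \<le> deg X + deg Z" using f I Y n(3) unfolding filtered_def by blast
        ultimately show False using False Y(2) by linarith
      qed
      then show ?thesis using False by auto
    qed
  qed
  also have "\<dots> = (\<Sum>X\<in>?A. \<Sum>Z\<in>keys y. ?h X Z)"
    by (intro sum.cong refl sum.mono_neutral_right) (auto simp: in_keys_iff)
  also have "\<dots> = (\<Sum>X\<in>keys x. \<Sum>Z\<in>keys y. ?h X Z)"
    by (intro sum.mono_neutral_right) (auto simp: in_keys_iff intro!: sum.neutral)
  finally show ?thesis .
qed

end

locale graded_comparison = A: based_filtration R I c u deg + A': based_algebra R' I c' u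
  for R :: "('a \<Rightarrow>\<^sub>0 rat, 'b) ring_scheme" and I c u deg and R' :: "('a \<Rightarrow>\<^sub>0 rat, 'e) ring_scheme" and c'
begin

definition degree_part :: bool where
  "degree_part \<longleftrightarrow> (\<forall>X\<in>I. \<forall>Z\<in>I. \<forall>Y\<in>I. c' X Z Y = (if deg Y = deg X + deg Z then c X Z Y else 0))"

abbreviation "gr \<equiv> associated_graded R A.filt"

text \<open>
  The family of the homogeneous components of \<open>x\<close>, as an element of the associated graded algebra.
\<close>

definition \<Phi> :: "('a \<Rightarrow>\<^sub>0 rat) \<Rightarrow> real \<Rightarrow> ('a \<Rightarrow>\<^sub>0 rat) set" where "\<Phi> x = (\<lambda>t. A.level t x)"

lemma \<Phi>_add: 
  assumes "keys y \<subseteq> I"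
  shows "\<Phi> x \<oplus>\<^bsub>gr\<^esub> \<Phi> y = \<Phi> (x + y)"
  unfolding \<Phi>_def associated_graded_def by (simp add: A.set_add_level[OF assms])

lemma \<Phi>_product:
  "(\<Phi> x \<otimes>\<^bsub>gr\<^esub> \<Phi> y) t = {(\<Oplus>\<^bsub>R\<^esub>r\<in>{r. A.level r x \<noteq> A.below r}. a r \<otimes>\<^bsub>R\<^esub> b (t - r)) \<oplus>\<^bsub>R\<^esub> k | a b k.
      (\<forall>r. a r \<in> A.level r x) \<and> (\<forall>s. b s \<in> A.level s y) \<and> k \<in> A.below t}"
  unfolding \<Phi>_def associated_graded_def by simp

lemma \<Phi>_mult:
  assumes f: A.filtered and d: degree_part and x: "keys x \<subseteq> I" and y: "keys y \<subseteq> I"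
  shows "\<Phi> (x \<otimes>\<^bsub>R'\<^esub> y) = \<Phi> x \<otimes>\<^bsub>gr\<^esub> \<Phi> y"
proof
  fix t
  let ?S = "{r. A.level r x \<noteq> A.below r}"
  have fin: "finite ?S" using A.level_in_carrier[OF x] unfolding associated_graded_def by simp
  have key: "(\<Oplus>\<^bsub>R\<^esub>r\<in>?S. a r \<otimes>\<^bsub>R\<^esub> b (t - r)) \<in> A.level t (x \<otimes>\<^bsub>R'\<^esub> y)"
    if a: "\<And>r. a r \<in> A.level r x" and b: "\<And>s. b s \<in> A.level s y" for a b
  proof -
    let ?f = "\<lambda>r. a r \<otimes>\<^bsub>R\<^esub> b (t - r)"
    have fF: "?f r \<in> A.filt t" for r
      using A.filtered_mult[OF f subsetD[OF A.level_filt a[of r]] subsetD[OF A.level_filt b[of "t - r"]]] by simp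
    have sum: "(\<Oplus>\<^bsub>R\<^esub>r\<in>?S. ?f r) = sum ?f ?S" using A.finsum_R[OF fin, of ?f] A.filt_carrier[OF fF] by simp
    have sF: "sum ?f ?S \<in> A.filt t" by (rule A.filt_sum[OF fin fF])
    have "lookup (sum ?f ?S) Y = lookup (x \<otimes>\<^bsub>R'\<^esub> y) Y" if Y: "Y \<in> I" "deg Y = t" for Y
    proof -
      let ?v = "\<lambda>X Z. lookup x X * lookup y Z * c X Z Y"
      have "lookup (sum ?f ?S) Y = (\<Sum>r\<in>?S. lookup (?f r) Y)" by (rule lookup_sum)
      also have "\<dots> = (\<Sum>r\<in>?S. \<Sum>X\<in>keys x. \<Sum>Z\<in>keys y. if deg X = r \<and> deg Z = t - r then ?v X Z else 0)"
        by (intro sum.cong refl A.lookup_product[OF f x y a b]) (use Y in auto)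
      also have "\<dots> = (\<Sum>X\<in>keys x. \<Sum>Z\<in>keys y. \<Sum>r\<in>?S. if deg X = r \<and> deg Z = t - r then ?v X Z else 0)"
        by (subst sum.swap, intro sum.cong refl, rule sum.swap)
      also have "\<dots> = (\<Sum>X\<in>keys x. \<Sum>Z\<in>keys y. lookup x X * lookup y Z * c' X Z Y)"
      proof (intro sum.cong refl)
        fix X Z assume XZ: "X \<in> keys x" "Z \<in> keys y"
        then have I: "X \<in> I" "Z \<in> I" using x y by auto
        have "A.level (deg X) x \<noteq> A.below (deg X)"
        proof
          assume "A.level (deg X) x = A.below (deg X)"
          then have "A.homog (deg X) x \<in> A.below (deg X)" using A.homog_level[OF x, of "deg X"] by simp
          then show False using XZ(1) I(1) unfolding A.below_iff by (simp add: A.lookup_homog in_keys_iff)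
        qed
        then have S: "deg X \<in> ?S" by simp
        have "(\<Sum>r\<in>?S. if deg X = r \<and> deg Z = t - r then ?v X Z else 0)
            = (\<Sum>r\<in>?S. if r = deg X then (if deg Z = t - deg X then ?v X Z else 0) else 0)"
          by (intro sum.cong refl) auto
        also have "\<dots> = (if deg Z = t - deg X then ?v X Z else 0)"
          using fin S by (subst sum.delta) auto
        also have "\<dots> = lookup x X * lookup y Z * c' X Z Y"
          using d I Y unfolding degree_part_def by auto
        finally show "(\<Sum>r\<in>?S. if deg X = r \<and> deg Z = t - r then ?v X Z else 0) = lookup x X * lookup y Z * c' X Z Y" .
      qed
      also have "\<dots> = lookup (x \<otimes>\<^bsub>R'\<^esub> y) Y" by (rule A'.lookup_mult[OF x y Y(1), symmetric])
      finally show ?thesis .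
    qed
    then show ?thesis unfolding sum using sF unfolding A.level_def by simp
  qed
  show "\<Phi> (x \<otimes>\<^bsub>R'\<^esub> y) t = (\<Phi> x \<otimes>\<^bsub>gr\<^esub> \<Phi> y) t"
    unfolding \<Phi>_product
  proof (intro equalityI subsetI)
    fix w assume "w \<in> \<Phi> (x \<otimes>\<^bsub>R'\<^esub> y) t"
    then have w: "w \<in> A.level t (x \<otimes>\<^bsub>R'\<^esub> y)" unfolding \<Phi>_def .
    (* homogeneous components serve as representatives; the error term lies below degree t *)
    let ?s = "\<Oplus>\<^bsub>R\<^esub>r\<in>?S. A.homog r x \<otimes>\<^bsub>R\<^esub> A.homog (t - r) y"
    have s: "?s \<in> A.level t (x \<otimes>\<^bsub>R'\<^esub> y)" by (rule key[OF A.homog_level[OF x] A.homog_level[OF y]])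
    have "w - ?s \<in> A.below t" using w s A.filt_diff unfolding A.below_iff A.level_def by (auto simp: lookup_minus)
    moreover have "w = ?s \<oplus>\<^bsub>R\<^esub> (w - ?s)" by (simp add: A.add_R)
    ultimately show "w \<in> {(\<Oplus>\<^bsub>R\<^esub>r\<in>?S. a r \<otimes>\<^bsub>R\<^esub> b (t - r)) \<oplus>\<^bsub>R\<^esub> k | a b k.
        (\<forall>r. a r \<in> A.level r x) \<and> (\<forall>s. b s \<in> A.level s y) \<and> k \<in> A.below t}"
      using A.homog_level[OF x] A.homog_level[OF y]
      by (intro CollectI exI[of _ "\<lambda>r. A.homog r x"] exI[of _ "\<lambda>s. A.homog s y"] exI[of _ "w - ?s"] conjI allI)
  next
    fix w assume "w \<in> {(\<Oplus>\<^bsub>R\<^esub>r\<in>?S. a r \<otimes>\<^bsub>R\<^esub> b (t - r)) \<oplus>\<^bsub>R\<^esub> k | a b k.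
        (\<forall>r. a r \<in> A.level r x) \<and> (\<forall>s. b s \<in> A.level s y) \<and> k \<in> A.below t}"
    then obtain a b k where a: "\<And>r. a r \<in> A.level r x" and b: "\<And>s. b s \<in> A.level s y" and k: "k \<in> A.below t"
      and w: "w = (\<Oplus>\<^bsub>R\<^esub>r\<in>?S. a r \<otimes>\<^bsub>R\<^esub> b (t - r)) + k" by (auto simp: A.add_R)
    from A.level_add_mem[OF key[OF a b] k[folded A.level_zero]]
    show "w \<in> \<Phi> (x \<otimes>\<^bsub>R'\<^esub> y) t" unfolding \<Phi>_def w by simp
  qed
qed

lemma \<Phi>_one: "\<Phi> (single u 1) = \<one>\<^bsub>gr\<^esub>"
proof
  fix t
  show "\<Phi> (single u 1) t = \<one>\<^bsub>gr\<^esub> t"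
    using fun_cong[OF A.graded_class_level[OF A.u], of t] unfolding \<Phi>_def A.deg_u
    by (simp add: graded_class_def associated_graded_def A.one_R split: if_splits)
qed

lemma \<Phi>_inj: "inj_on \<Phi> {x. keys x \<subseteq> I}"
proof (rule inj_onI)
  fix x y assume x: "x \<in> {x. keys x \<subseteq> I}" and y: "y \<in> {x. keys x \<subseteq> I}" and e: "\<Phi> x = \<Phi> y"
  show "x = y"
  proof (rule poly_mapping_eqI)
    fix Y show "lookup x Y = lookup y Y"
    proof (cases "Y \<in> I")
      case True
      have "A.homog (deg Y) x \<in> A.level (deg Y) x" by (rule A.homog_level) (use x in simp)
      also have "A.level (deg Y) x = A.level (deg Y) y" using e unfolding \<Phi>_def by meson
      finally show ?thesis using True unfolding A.level_def by (simp add: A.lookup_homog)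
    next
      case False
      then have "Y \<notin> keys x" "Y \<notin> keys y" using x y by auto
      then show ?thesis by (simp add: in_keys_iff)
    qed
  qed
qed

lemma \<Phi>_surj:
  assumes "f \<in> carrier gr" shows "\<exists>x. keys x \<subseteq> I \<and> \<Phi> x = f"
proof -
  obtain w where w: "\<And>t. w t \<in> A.filt t" "\<And>t. f t = A.level t (w t)" "finite {t. f t \<noteq> A.below t}"
    using A.graded_carrier[OF assms] by blast
  let ?l = "\<lambda>Y. if Y \<in> I then lookup (w (deg Y)) Y else 0"
  have "{Y. ?l Y \<noteq> 0} \<subseteq> (\<Union>t\<in>{t. f t \<noteq> A.below t}. keys (w t))"
  proof
    fix Y assume "Y \<in> {Y. ?l Y \<noteq> 0}"
    then have Y: "Y \<in> I" "lookup (w (deg Y)) Y \<noteq> 0" by (auto split: if_splits)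
    have "w (deg Y) \<in> f (deg Y)" unfolding w(2) A.level_def using w(1) by simp
    then have "f (deg Y) \<noteq> A.below (deg Y)" using Y A.below_iff[of "w (deg Y)" "deg Y"] by auto
    then show "Y \<in> (\<Union>t\<in>{t. f t \<noteq> A.below t}. keys (w t))" using Y by (auto simp: in_keys_iff)
  qed
  then have "finite {Y. ?l Y \<noteq> 0}" by (rule finite_subset) (simp add: w(3))
  then have l: "lookup (Abs_poly_mapping ?l) = ?l" by simp
  have "keys (Abs_poly_mapping ?l) \<subseteq> I"
    by (auto simp: A.keys_subset_iff l)
  moreover have "\<Phi> (Abs_poly_mapping ?l) = f" unfolding \<Phi>_def
    by (rule ext, unfold w(2), rule A.level_cong) (simp add: l)
  ultimately show ?thesis by blast
qed

lemma \<Phi>_iso: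
  assumes f: A.filtered and d: degree_part
  shows "\<Phi> \<in> ring_iso R' gr"
proof -
  have "\<Phi> \<in> ring_hom R' gr"
  proof (rule ring_hom_memI)
    show "\<Phi> x \<in> carrier gr" if "x \<in> carrier R'" for x
      using A.level_in_carrier that unfolding \<Phi>_def A'.carrier by simp
    show "\<Phi> (x \<otimes>\<^bsub>R'\<^esub> y) = \<Phi> x \<otimes>\<^bsub>gr\<^esub> \<Phi> y" if "x \<in> carrier R'" "y \<in> carrier R'" for x y
      using \<Phi>_mult[OF f d] that unfolding A'.carrier by simp
    show "\<Phi> (x \<oplus>\<^bsub>R'\<^esub> y) = \<Phi> x \<oplus>\<^bsub>gr\<^esub> \<Phi> y" if "x \<in> carrier R'" "y \<in> carrier R'" for x y
      using \<Phi>_add that unfolding A'.carrier A'.add_R by simp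
    show "\<Phi> \<one>\<^bsub>R'\<^esub> = \<one>\<^bsub>gr\<^esub>" unfolding A'.one_R by (rule \<Phi>_one)
  qed
  moreover have "bij_betw \<Phi> (carrier R') (carrier gr)" unfolding bij_betw_def
  proof
    show "inj_on \<Phi> (carrier R')" unfolding A'.carrier by (rule \<Phi>_inj)
    show "\<Phi> ` carrier R' = carrier gr"
    proof (intro equalityI subsetI)
      fix f assume "f \<in> carrier gr"
      from \<Phi>_surj[OF this] show "f \<in> \<Phi> ` carrier R'" unfolding A'.carrier by blast
    qed (use A.level_in_carrier in \<open>auto simp: \<Phi>_def A'.carrier\<close>)
  qed
  ultimately show ?thesis unfolding ring_iso_def by simp
qed

text \<open>
  A homomorphism with the prescribed values on the basis is \<open>\<Phi>\<close>: compare both through the inverse of \<open>\<Phi>\<close>,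
  where additivity implies linearity over the rationals.
\<close>

lemma hom_eq_\<Phi>:
  assumes h: "\<Psi> \<in> ring_hom R' gr" and b: "\<And>X. X \<in> I \<Longrightarrow> \<Psi> (single X 1) = \<Phi> (single X 1)"
    and x: "keys x \<subseteq> I"
  shows "\<Psi> x = \<Phi> x"
proof -
  have inv: "\<exists>z. keys z \<subseteq> I \<and> \<Phi> z = \<Psi> y" if "keys y \<subseteq> I" for y
    using \<Phi>_surj ring_hom_closed[OF h, of y] that unfolding A'.carrier by blast
  define L where "L y = (SOME z. keys z \<subseteq> I \<and> \<Phi> z = \<Psi> y)" for y
  have L: "keys (L y) \<subseteq> I" "\<Phi> (L y) = \<Psi> y" if "keys y \<subseteq> I" for y
    using someI_ex[OF inv[OF that]] unfolding L_def by auto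
  have L_eq: "L y = z" if "keys y \<subseteq> I" "keys z \<subseteq> I" "\<Phi> z = \<Psi> y" for y z
    using inj_onD[OF \<Phi>_inj] L[OF that(1)] that by simp
  have k_add: "keys (y + z) \<subseteq> I" if "keys y \<subseteq> I" "keys z \<subseteq> I" for y z :: "'a \<Rightarrow>\<^sub>0 rat"
    using keys_add[of y z] that by blast
  have add: "L (y + z) = L y + L z" if "keys y \<subseteq> I" "keys z \<subseteq> I" for y z
  proof (rule L_eq[OF k_add[OF that] k_add[OF L(1)[OF that(1)] L(1)[OF that(2)]]])
    have "\<Psi> (y + z) = \<Psi> y \<oplus>\<^bsub>gr\<^esub> \<Psi> z" using ring_hom_add[OF h, of y z] that unfolding A'.carrier A'.add_R by simp
    then show "\<Phi> (L y + L z) = \<Psi> (y + z)" using \<Phi>_add[OF L(1)[OF that(2)], of "L y"] L(2) that by simp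
  qed
  have single: "L (single X q) = single X q" if X: "X \<in> I" for X q
  proof (rule poly_mapping_eqI)
    fix Y
    let ?g = "\<lambda>q. lookup (L (single X q)) Y"
    have "?g (p + q) = ?g p + ?g q" for p q
      using add[of "single X p" "single X q"] X by (simp add: single_add lookup_add)
    from additive_rat_linear[of ?g, OF this] have "?g q = q * ?g 1" .
    moreover have "L (single X 1) = single X 1" by (rule L_eq) (use X b in auto)
    ultimately show "?g q = lookup (single X q) Y" by (simp add: lookup_single when_def)
  qed
  have L0: "L 0 = 0" using add[of 0 0] by simp
  have sum: "L (sum f S) = sum f S \<and> keys (sum f S) \<subseteq> I"
    if "finite S" "\<And>s. s \<in> S \<Longrightarrow> L (f s) = f s \<and> keys (f s) \<subseteq> I" for f and S :: "'a set"
    using that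
  proof (induction S)
    case (insert s S)
    then show ?case using add[of "f s" "sum f S"] k_add[of "f s" "sum f S"] by simp
  qed (simp add: L0)
  have "x = (\<Sum>X\<in>keys x. single X (lookup x X))"
    by (rule poly_mapping_eqI) (auto simp: lookup_sum lookup_single when_def in_keys_iff)
  moreover have "L (\<Sum>X\<in>keys x. single X (lookup x X)) = (\<Sum>X\<in>keys x. single X (lookup x X))"
    by (rule conjunct1[OF sum]) (use single x in auto)
  ultimately have "L x = x" by simp
  then show ?thesis using L(2)[OF x] by simp
qed

text \<open>
  Multiplying two basis elements in the associated graded algebra gives their product in the sum of
  their degrees and zero in all other degrees.
\<close>

lemma degree_part_if_hom:
  assumes h: "\<Psi> \<in> ring_hom R' gr" and b: "\<And>X. X \<in> I \<Longrightarrow> \<Psi> (single X 1) = \<Phi> (single X 1)"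
  shows degree_part
  unfolding degree_part_def
proof (intro ballI)
  fix X Z Y assume I: "X \<in> I" "Z \<in> I" "Y \<in> I"
  let ?x = "single X 1 :: 'a \<Rightarrow>\<^sub>0 rat" and ?z = "single Z 1 :: 'a \<Rightarrow>\<^sub>0 rat"
  have k: "keys ?x \<subseteq> I" "keys ?z \<subseteq> I" using I by auto
  have "\<Phi> (?x \<otimes>\<^bsub>R'\<^esub> ?z) = \<Psi> (?x \<otimes>\<^bsub>R'\<^esub> ?z)" by (rule hom_eq_\<Phi>[OF h b A'.keys_mult[OF k], symmetric])
  also have "\<dots> = \<Phi> ?x \<otimes>\<^bsub>gr\<^esub> \<Phi> ?z" using ring_hom_mult[OF h, of ?x ?z] k b I unfolding A'.carrier by simp
  finally have eq: "\<Phi> (?x \<otimes>\<^bsub>R'\<^esub> ?z) = \<Phi> ?x \<otimes>\<^bsub>gr\<^esub> \<Phi> ?z" .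
  let ?S = "{r. A.level r ?x \<noteq> A.below r}"
  have fin: "finite ?S" using A.level_in_carrier[OF k(1)] unfolding associated_graded_def by simp
  define t where "t = deg Y"
  (* homogeneous representatives of the two basis elements *)
  define a where "a r = (if r = deg X then ?x else 0)" for r
  define d where "d s = (if s = deg Z then ?z else 0)" for s
  have level: "(if r = deg V then single V 1 else 0) \<in> A.level r (single V 1)" if "V \<in> I" for r V
    using that unfolding A.level_def A.filt_def by (auto simp: lookup_single when_def)
  have aG: "\<forall>r. a r \<in> A.level r ?x" and dG: "\<forall>s. d s \<in> A.level s ?z" unfolding a_def d_def using level I by blast+
  have "(\<Oplus>\<^bsub>R\<^esub>r\<in>?S. a r \<otimes>\<^bsub>R\<^esub> d (t - r)) \<oplus>\<^bsub>R\<^esub> 0 \<in> (\<Phi> ?x \<otimes>\<^bsub>gr\<^esub> \<Phi> ?z) t"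
    unfolding \<Phi>_product
  proof (intro CollectI, rule exI[of _ a], rule exI[of _ d], rule exI[of _ 0], intro conjI aG dG refl)
    show "0 \<in> A.below t" unfolding A.below_iff A.filt_def by simp
  qed
  then have mem: "(\<Oplus>\<^bsub>R\<^esub>r\<in>?S. a r \<otimes>\<^bsub>R\<^esub> d (t - r)) \<in> A.level t (?x \<otimes>\<^bsub>R'\<^esub> ?z)"
    unfolding eq[symmetric] by (simp add: \<Phi>_def A.add_R)
  have summand: "a r \<otimes>\<^bsub>R\<^esub> d (t - r) = (if r = deg X then (if deg Y = deg X + deg Z then ?x \<otimes>\<^bsub>R\<^esub> ?z else 0) else 0)" for r
    unfolding a_def d_def t_def using A.mult_zero k by (auto simp: algebra_simps)
  have "deg X \<in> ?S"
  proof -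
    have "?x \<in> A.level (deg X) ?x" using level[OF I(1), of "deg X"] by simp
    moreover have "?x \<notin> A.below (deg X)" unfolding A.below_iff using I(1) by auto
    ultimately show ?thesis by auto
  qed
  have "(\<Oplus>\<^bsub>R\<^esub>r\<in>?S. a r \<otimes>\<^bsub>R\<^esub> d (t - r)) = (\<Sum>r\<in>?S. a r \<otimes>\<^bsub>R\<^esub> d (t - r))"
    using A.finsum_R[OF fin, of "\<lambda>r. a r \<otimes>\<^bsub>R\<^esub> d (t - r)"] unfolding summand using A.keys_mult[OF k] by auto
  also have "\<dots> = (if deg Y = deg X + deg Z then ?x \<otimes>\<^bsub>R\<^esub> ?z else 0)"
    unfolding summand using fin \<open>deg X \<in> ?S\<close> by (subst sum.delta) auto
  finally have "(if deg Y = deg X + deg Z then ?x \<otimes>\<^bsub>R\<^esub> ?z else 0) \<in> A.level t (?x \<otimes>\<^bsub>R'\<^esub> ?z)" using mem by simp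
  then have "lookup (if deg Y = deg X + deg Z then ?x \<otimes>\<^bsub>R\<^esub> ?z else 0) Y = lookup (?x \<otimes>\<^bsub>R'\<^esub> ?z) Y"
    unfolding A.level_def t_def using I(3) by blast
  then show "c' X Z Y = (if deg Y = deg X + deg Z then c X Z Y else 0)"
    unfolding A'.lookup_mult_single[OF I] using A.lookup_mult_single[OF I] by (auto split: if_splits)
qed

theorem graded_iff:
  "(algebra_filtration R A.filt \<and> (\<exists>\<Psi>\<in>ring_iso R' gr. \<forall>X\<in>I. \<Psi> (single X 1) =
      graded_class R A.filt (deg X) (single X 1))) \<longleftrightarrow> A.filtered \<and> degree_part"
proof
  assume l: "algebra_filtration R A.filt \<and> (\<exists>\<Psi>\<in>ring_iso R' gr. \<forall>X\<in>I. \<Psi> (single X 1) =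
      graded_class R A.filt (deg X) (single X 1))"
  then obtain \<Psi> where "\<Psi> \<in> ring_hom R' gr" "\<And>X. X \<in> I \<Longrightarrow> \<Psi> (single X 1) = \<Phi> (single X 1)"
    unfolding ring_iso_def \<Phi>_def using A.graded_class_level by auto
  then show "A.filtered \<and> degree_part" using degree_part_if_hom l A.algebra_filtration_iff by blast
next
  assume r: "A.filtered \<and> degree_part"
  then have "\<Phi> \<in> ring_iso R' gr" using \<Phi>_iso by blast
  moreover have "\<forall>X\<in>I. \<Phi> (single X 1) = graded_class R A.filt (deg X) (single X 1)"
    using A.graded_class_level unfolding \<Phi>_def by simp
  ultimately show "algebra_filtration R A.filt \<and> (\<exists>\<Psi>\<in>ring_iso R' gr. \<forall>X\<in>I. \<Psi> (single X 1) =
      graded_class R A.filt (deg X) (single X 1))"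
    using r A.algebra_filtration_iff by blast
qed

end

section \<open>Hall algebras and the degree cone\<close>

context exact_category begin

lemma conflation_arrs:
  assumes "(i, p) \<in> E"
  shows "i \<in> arr C" "p \<in> arr C" "tgt C i = src C p" "src C i \<in> obj C" "tgt C i \<in> obj C" "tgt C p \<in> obj C"
  using kernelD[OF conflation_kernel[OF assms]] by auto

lemma conflation_change_ends:
  assumes E: "(i, p) \<in> E"
    and a: "a \<in> arr C" "a' \<in> arr C" "src C a' = src C i" "tgt C a' = src C a" "tgt C a = src C i"
      "a \<cdot> a' = id_arr C (src C i)" "a' \<cdot> a = id_arr C (src C a)"
    and c: "c \<in> arr C" "c' \<in> arr C" "src C c = tgt C p" "tgt C c = src C c'" "tgt C c' = tgt C p"
      "c' \<cdot> c = id_arr C (tgt C p)" "c \<cdot> c' = id_arr C (src C c')"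
  shows "(i \<cdot> a, c \<cdot> p) \<in> E"
proof -
  note I = conflation_arrs[OF E]
  show ?thesis
    by (rule conflation_iso_right[OF E kcp_iso_ends[OF conflation_kcp[OF E] a c],
        of "id_arr C (tgt C i)" "id_arr C (tgt C i)" c c'])
      (use I a c in simp_all)
qed

lemma extension_equiv_iff:
  "((i, p), (i', p')) \<in> extension_equiv C E A D \<longleftrightarrow> (i, p) \<in> conflations_on C E A D \<and> (i', p') \<in> conflations_on C E A D \<and>
    (\<exists>h h'. h \<in> Hom C (tgt C i) (tgt C i') \<and> h' \<in> Hom C (tgt C i') (tgt C i) \<and> h' \<cdot> h = id_arr C (tgt C i) \<and>
      h \<cdot> h' = id_arr C (tgt C i') \<and> h \<cdot> i = i' \<and> p' \<cdot> h = p)"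
proof
  assume "((i, p), (i', p')) \<in> extension_equiv C E A D"
  then obtain h where h: "(i, p) \<in> conflations_on C E A D" "(i', p') \<in> conflations_on C E A D"
    "h \<in> Hom C (tgt C i) (tgt C i')" "iso_arr C h" "h \<cdot> i = i'" "p' \<cdot> h = p"
    unfolding extension_equiv_def by blast
  from iso_arr_inverse[OF h(4,3)] obtain g where
    "g \<in> Hom C (tgt C i') (tgt C i)" "g \<cdot> h = id_arr C (tgt C i)" "h \<cdot> g = id_arr C (tgt C i')" .
  with h show "(i, p) \<in> conflations_on C E A D \<and> (i', p') \<in> conflations_on C E A D \<and>
    (\<exists>h h'. h \<in> Hom C (tgt C i) (tgt C i') \<and> h' \<in> Hom C (tgt C i') (tgt C i) \<and> h' \<cdot> h = id_arr C (tgt C i) \<and>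
      h \<cdot> h' = id_arr C (tgt C i') \<and> h \<cdot> i = i' \<and> p' \<cdot> h = p)" by blast
next
  assume "(i, p) \<in> conflations_on C E A D \<and> (i', p') \<in> conflations_on C E A D \<and>
    (\<exists>h h'. h \<in> Hom C (tgt C i) (tgt C i') \<and> h' \<in> Hom C (tgt C i') (tgt C i) \<and> h' \<cdot> h = id_arr C (tgt C i) \<and>
      h \<cdot> h' = id_arr C (tgt C i') \<and> h \<cdot> i = i' \<and> p' \<cdot> h = p)"
  then obtain h g where h: "(i, p) \<in> conflations_on C E A D" "(i', p') \<in> conflations_on C E A D"
    "h \<in> Hom C (tgt C i) (tgt C i')" "g \<in> Hom C (tgt C i') (tgt C i)"
    "g \<cdot> h = id_arr C (tgt C i)" "h \<cdot> g = id_arr C (tgt C i')" "h \<cdot> i = i'" "p' \<cdot> h = p" by blast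
  have "iso_arr C h" by (rule iso_arrI[of _ g]) (use h(3-6) in \<open>simp_all add: in_Hom\<close>)
  then show "((i, p), (i', p')) \<in> extension_equiv C E A D" unfolding extension_equiv_def using h by blast
qed

lemma equiv_extension_equiv: "equiv (conflations_on C E A D) (extension_equiv C E A D)"
proof (rule equivI)
  show "extension_equiv C E A D \<subseteq> conflations_on C E A D \<times> conflations_on C E A D"
    unfolding extension_equiv_def by auto
  show "refl_on (conflations_on C E A D) (extension_equiv C E A D)"
  proof (rule refl_onI)
    fix x assume x: "x \<in> conflations_on C E A D"
    obtain i p where ip: "x = (i, p)" by (cases x)
    have "(i, p) \<in> E" using x unfolding ip conflations_on_def by auto
    note I = conflation_arrs[OF this]
    show "(x, x) \<in> extension_equiv C E A D" unfolding ip extension_equiv_iff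
      using x I unfolding ip by (auto simp: in_Hom intro!: exI[of _ "id_arr C (tgt C i)"])
  qed
  show "sym (extension_equiv C E A D)"
  proof (rule symI)
    fix x y assume xy: "(x, y) \<in> extension_equiv C E A D"
    obtain i p i' p' where ip: "x = (i, p)" "y = (i', p')" by (metis surj_pair)
    from xy[unfolded ip extension_equiv_iff] obtain h h' where
      c: "(i, p) \<in> conflations_on C E A D" "(i', p') \<in> conflations_on C E A D" and
      h: "h \<in> Hom C (tgt C i) (tgt C i')" "h' \<in> Hom C (tgt C i') (tgt C i)" "h' \<cdot> h = id_arr C (tgt C i)"
      "h \<cdot> h' = id_arr C (tgt C i')" "h \<cdot> i = i'" "p' \<cdot> h = p" by blast
    have e: "(i, p) \<in> E" "(i', p') \<in> E" using c unfolding conflations_on_def by auto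
    note I = conflation_arrs[OF e(1)] and I' = conflation_arrs[OF e(2)]
    have H: "h \<in> arr C" "src C h = tgt C i" "tgt C h = tgt C i'" "h' \<in> arr C" "src C h' = tgt C i'" "tgt C h' = tgt C i"
      using h(1,2) by (auto simp: in_Hom)
    have "h' \<cdot> i' = i" unfolding h(5)[symmetric] using collapse[OF h(3), of i] H I by simp
    moreover have "p \<cdot> h' = p'" unfolding h(6)[symmetric] using H I' h(4) by simp
    ultimately show "(y, x) \<in> extension_equiv C E A D" unfolding ip extension_equiv_iff
      using c h by blast
  qed
  show "trans (extension_equiv C E A D)"
  proof (rule transI)
    fix x y z assume xy: "(x, y) \<in> extension_equiv C E A D" and yz: "(y, z) \<in> extension_equiv C E A D"
    obtain i p i' p' i'' p'' where ip: "x = (i, p)" "y = (i', p')" "z = (i'', p'')" by (metis surj_pair)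
    from xy[unfolded ip extension_equiv_iff] obtain h h' where
      c: "(i, p) \<in> conflations_on C E A D" "(i', p') \<in> conflations_on C E A D" and
      h: "h \<in> Hom C (tgt C i) (tgt C i')" "h' \<in> Hom C (tgt C i') (tgt C i)" "h' \<cdot> h = id_arr C (tgt C i)"
      "h \<cdot> h' = id_arr C (tgt C i')" "h \<cdot> i = i'" "p' \<cdot> h = p" by blast
    from yz[unfolded ip extension_equiv_iff] obtain g g' where
      c': "(i'', p'') \<in> conflations_on C E A D" and
      g: "g \<in> Hom C (tgt C i') (tgt C i'')" "g' \<in> Hom C (tgt C i'') (tgt C i')" "g' \<cdot> g = id_arr C (tgt C i')"
      "g \<cdot> g' = id_arr C (tgt C i'')" "g \<cdot> i' = i''" "p'' \<cdot> g = p'" by blast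
    have e: "(i, p) \<in> E" "(i'', p'') \<in> E" using c c' unfolding conflations_on_def by auto
    note I = conflation_arrs[OF e(1)] and I'' = conflation_arrs[OF e(2)]
    have H: "h \<in> arr C" "src C h = tgt C i" "tgt C h = tgt C i'" "h' \<in> arr C" "src C h' = tgt C i'" "tgt C h' = tgt C i"
      "g \<in> arr C" "src C g = tgt C i'" "tgt C g = tgt C i''" "g' \<in> arr C" "src C g' = tgt C i''" "tgt C g' = tgt C i'"
      using h(1,2) g(1,2) by (auto simp: in_Hom)
    have 1: "(g \<cdot> h) \<cdot> i = i''" using H(1-3,7-9) I(1) h(5) g(5) by simp
    have "p'' \<cdot> (g \<cdot> h) = p' \<cdot> h" using collapse[OF g(6), of h] H(1-3,7-9) I''(2,3) by simp
    then have 2: "p'' \<cdot> (g \<cdot> h) = p" using h(6) by simp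
    have 3: "(h' \<cdot> g') \<cdot> (g \<cdot> h) = id_arr C (tgt C i)" using collapse[OF g(3), of h] h(3) H by simp
    have 4: "(g \<cdot> h) \<cdot> (h' \<cdot> g') = id_arr C (tgt C i'')" using collapse[OF h(4), of g'] g(4) H by simp
    have 5: "g \<cdot> h \<in> Hom C (tgt C i) (tgt C i'')" "h' \<cdot> g' \<in> Hom C (tgt C i'') (tgt C i)" using H by (simp_all add: in_Hom)
    show "(x, z) \<in> extension_equiv C E A D" unfolding ip extension_equiv_iff
      using c c' 1 2 3 4 5 by blast
  qed
qed

text \<open>
  Up to equivalence the middle term can be replaced by the representative of its class, and there are
  only finitely many pairs of arrows through a fixed object between fixed ends.
\<close>

lemma finite_Ext1_mid:
  assumes Y: "Y \<in> Iso C" shows "finite (Ext1_mid C E A D Y)"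
proof -
  let ?R = "rep Y" and ?r = "extension_equiv C E A D"
  let ?S = "{(i, p) \<in> conflations_on C E A D. tgt C i \<in> Y}"
  have "\<exists>h h'. h \<in> Hom C M ?R \<and> h' \<in> Hom C ?R M \<and> h' \<cdot> h = id_arr C M \<and> h \<cdot> h' = id_arr C ?R" if "M \<in> Y" for M
    using iso_class_eq_iff[of M ?R] Iso_member[OF Y that] rep_Iso(2)[OF Y] unfolding isomorphic_iff by auto
  then obtain h h' where h: "\<And>M. M \<in> Y \<Longrightarrow> h M \<in> Hom C M ?R" "\<And>M. M \<in> Y \<Longrightarrow> h' M \<in> Hom C ?R M"
    "\<And>M. M \<in> Y \<Longrightarrow> h' M \<cdot> h M = id_arr C M" "\<And>M. M \<in> Y \<Longrightarrow> h M \<cdot> h' M = id_arr C ?R" by metis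
  define f where "f = (\<lambda>(i, p). (h (tgt C i) \<cdot> i, p \<cdot> h' (tgt C i)))"
  have "f ` ?S \<subseteq> Hom C D ?R \<times> Hom C ?R A"
  proof
    fix z assume "z \<in> f ` ?S"
    then obtain i p where z: "z = f (i, p)" and ip: "(i, p) \<in> conflations_on C E A D" "tgt C i \<in> Y" by auto
    then have e: "(i, p) \<in> E" "src C i = D" "tgt C p = A" unfolding conflations_on_def by auto
    then show "z \<in> Hom C D ?R \<times> Hom C ?R A" unfolding z
      using conflation_arrs[OF e(1)] h(1,2)[OF ip(2)] by (simp add: f_def in_Hom)
  qed
  then have fin: "finite (f ` ?S)" by (rule finite_subset) (simp add: fin_Hom)
  have eq: "?r `` {x} = ?r `` {y}" if x: "x \<in> ?S" and y: "y \<in> ?S" and xy: "f x = f y" for x y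
  proof -
    obtain i p j q where ip: "x = (i, p)" "y = (j, q)" by (metis surj_pair)
    define M N where MN: "M = tgt C i" "N = tgt C j"
    have on: "(i, p) \<in> conflations_on C E A D" "(j, q) \<in> conflations_on C E A D" "M \<in> Y" "N \<in> Y"
      using x y ip MN by auto
    then have e: "(i, p) \<in> E" "(j, q) \<in> E" unfolding conflations_on_def by auto
    have I: "i \<in> arr C" "p \<in> arr C" "tgt C i = M" "src C p = M" "j \<in> arr C" "q \<in> arr C" "tgt C j = N" "src C q = N"
      using conflation_arrs(1-3)[OF e(1)] conflation_arrs(1-3)[OF e(2)] unfolding MN by simp_all
    have H: "h M \<in> arr C" "src C (h M) = M" "tgt C (h M) = ?R" "h' M \<in> arr C" "src C (h' M) = ?R" "tgt C (h' M) = M"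
      "h N \<in> arr C" "src C (h N) = N" "tgt C (h N) = ?R" "h' N \<in> arr C" "src C (h' N) = ?R" "tgt C (h' N) = N"
      using h(1,2)[OF on(3)] h(1,2)[OF on(4)] by (simp_all add: in_Hom)
    have f: "h M \<cdot> i = h N \<cdot> j" "q \<cdot> h' N = p \<cdot> h' M" using xy unfolding ip f_def MN by auto
    have 1: "(h' N \<cdot> h M) \<cdot> i = j" using collapse[OF h(3)[OF on(4)], of j] f(1) H I by simp
    have 2: "q \<cdot> (h' N \<cdot> h M) = p" using collapse[OF f(2), of "h M"] h(3)[OF on(3)] H I by simp
    have 3: "(h' M \<cdot> h N) \<cdot> (h' N \<cdot> h M) = id_arr C M"
      using collapse[OF h(4)[OF on(4)], of "h M"] h(3)[OF on(3)] H by simp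
    have 4: "(h' N \<cdot> h M) \<cdot> (h' M \<cdot> h N) = id_arr C N"
      using collapse[OF h(4)[OF on(3)], of "h N"] h(3)[OF on(4)] H by simp
    have 5: "h' N \<cdot> h M \<in> Hom C M N" "h' M \<cdot> h N \<in> Hom C N M" using H by (simp_all add: in_Hom)
    have "(x, y) \<in> ?r" unfolding ip extension_equiv_iff I using on(1,2) 1 2 3 4 5 by blast
    then show ?thesis by (rule equiv_class_eq[OF equiv_extension_equiv])
  qed
  have "(\<lambda>x. ?r `` {x}) ` ?S \<subseteq> (\<lambda>z. ?r `` {inv_into ?S f z}) ` (f ` ?S)"
  proof
    fix e assume "e \<in> (\<lambda>x. ?r `` {x}) ` ?S"
    then obtain x where x: "x \<in> ?S" "e = ?r `` {x}" by blast
    have fx: "f x \<in> f ` ?S" using x(1) by blast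
    have "e = ?r `` {inv_into ?S f (f x)}"
      unfolding x(2) by (rule eq[OF x(1) inv_into_into[OF fx] f_inv_into_f[OF fx, symmetric]])
    then show "e \<in> (\<lambda>z. ?r `` {inv_into ?S f z}) ` (f ` ?S)" using x(1) by blast
  qed
  then have "finite ((\<lambda>x. ?r `` {x}) ` ?S)" by (rule finite_subset) (use fin in simp)
  moreover have "Ext1_mid C E A D Y = (\<lambda>x. ?r `` {x}) ` ?S" unfolding Ext1_mid_def quotient_def by blast
  ultimately show ?thesis by simp
qed

lemma Ext1_mid_nonempty_iff:
  "Ext1_mid C E A D Y \<noteq> {} \<longleftrightarrow> (\<exists>i p. (i, p) \<in> E \<and> src C i = D \<and> tgt C p = A \<and> tgt C i \<in> Y)"
  unfolding Ext1_mid_def quotient_def conflations_on_def by blast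

lemma hall_coeff_nonzero_iff:
  assumes "X \<in> Iso C" "Z \<in> Iso C" "Y \<in> Iso C"
  shows "hall_coeff C E X Z Y \<noteq> 0 \<longleftrightarrow> (\<exists>i p. (i, p) \<in> E \<and> src C i = rep Z \<and> tgt C p = rep X \<and> tgt C i \<in> Y)"
proof -
  have "card (Hom C (rep X) (rep Z)) > 0" using card_Hom_pos rep_Iso(1) assms by simp
  moreover have "card (Ext1_mid C E (rep X) (rep Z) Y) = 0 \<longleftrightarrow> Ext1_mid C E (rep X) (rep Z) Y = {}"
    using finite_Ext1_mid[OF assms(3)] by simp
  ultimately show ?thesis unfolding hall_coeff_def Ext1_mid_nonempty_iff[symmetric] by simp
qed

lemma conflation_change_ends_ex:
  assumes E: "(i, p) \<in> E" and "isomorphic C (src C i) Z" "isomorphic C (tgt C p) X"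
  obtains i' p' where "(i', p') \<in> E" "src C i' = Z" "tgt C p' = X" "tgt C i' = tgt C i"
    "\<And>E'. exact_category K C E' \<Longrightarrow> (i', p') \<in> E' \<Longrightarrow> (i, p) \<in> E'"
proof -
  note I = conflation_arrs[OF E]
  obtain a a' where "a \<in> Hom C (src C i) Z" "a' \<in> Hom C Z (src C i)" "a' \<cdot> a = id_arr C (src C i)" "a \<cdot> a' = id_arr C Z"
    using assms(2) unfolding isomorphic_iff by blast
  then have a: "a' \<in> arr C" "a \<in> arr C" "src C a = src C i" "tgt C a = src C a'" "tgt C a' = src C i"
    "a' \<cdot> a = id_arr C (src C i)" "a \<cdot> a' = id_arr C (src C a')" "src C a' = Z" by (auto simp: in_Hom)
  obtain c c' where "c \<in> Hom C (tgt C p) X" "c' \<in> Hom C X (tgt C p)" "c' \<cdot> c = id_arr C (tgt C p)" "c \<cdot> c' = id_arr C X"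
    using assms(3) unfolding isomorphic_iff by blast
  then have c: "c \<in> arr C" "c' \<in> arr C" "src C c = tgt C p" "tgt C c = src C c'" "tgt C c' = tgt C p"
    "c' \<cdot> c = id_arr C (tgt C p)" "c \<cdot> c' = id_arr C (src C c')" "src C c' = X" by (auto simp: in_Hom)
  show ?thesis
  proof (rule that[of "i \<cdot> a'" "c \<cdot> p"])
    show "(i \<cdot> a', c \<cdot> p) \<in> E" by (rule conflation_change_ends[OF E a(1-7) c(1-7)])
    fix E' assume "exact_category K C E'" and E': "(i \<cdot> a', c \<cdot> p) \<in> E'"
    then interpret E': exact_category K C E' by simp
    have "((i \<cdot> a') \<cdot> a, c' \<cdot> (c \<cdot> p)) \<in> E'"
      by (rule E'.conflation_change_ends[OF E', of a a' c' c]) (use a c I in simp_all)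
    moreover have "(i \<cdot> a') \<cdot> a = i" using a I by simp
    moreover have "c' \<cdot> (c \<cdot> p) = p" using collapse[OF c(6), of p] c I by simp
    ultimately show "(i, p) \<in> E'" by simp
  qed (use a c I in simp_all)
qed

end

sublocale exact_category \<subseteq> conflation_class K C E
  by unfold_locales (use conflation_arrs in blast)

context exact_krull_schmidt begin

text \<open>
  Left exactness of \<open>Hom\<close> bounds the total size of the middle term.
\<close>

lemma finite_middle_terms:
  assumes "X \<in> Iso C" "Z \<in> Iso C"
  shows "finite {Y \<in> Iso C. Ext1_mid C E (rep X) (rep Z) Y \<noteq> {}}"
proof (rule finite_subset[OF _ finite_bounded_log_card[of "total_log_card (rep Z) + total_log_card (rep X)"]], intro subsetI, clarify)
  fix Y assume Y: "Y \<in> Iso C" and "Ext1_mid C E (rep X) (rep Z) Y \<noteq> {}"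
  then obtain i p where ip: "(i, p) \<in> E" "src C i = rep Z" "tgt C p = rep X" "tgt C i \<in> Y"
    unfolding Ext1_mid_nonempty_iff by blast
  note I = conflation_arrs[OF ip(1)]
  have "isomorphic C (rep Y) (tgt C i)"
    using rep_iso_class[OF I(5)] Iso_member[OF Y ip(4)] by simp
  then have "total_log_card (rep Y) = total_log_card (src C p)"
    using additive_iso[of total_log_card, OF total_log_card_direct_sum] I(3) by simp
  also have "\<dots> \<le> total_log_card (src C i) + total_log_card (tgt C p)"
    unfolding total_log_card_def sum.distrib[symmetric]
    by (intro sum_mono log_card_subadditive[OF conflation_kernel[OF ip(1)]] indecomposable_obj ind_rep(2))
  finally show "total_log_card (rep Y) \<le> total_log_card (rep Z) + total_log_card (rep X)" using ip by simp
qed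

lemma zero_class_Iso: "{Z. zero_object C Z} \<in> Iso C"
proof -
  obtain Z where Z: "zero_object C Z" using zero_object_ex .
  then show ?thesis using zero_objects_class[OF Z] iso_class_in_Iso[of Z] by (simp add: zero_object_def)
qed

sublocale hall: based_algebra "hall_algebra C E" "Iso C" "hall_coeff C E" "{Z. zero_object C Z}"
proof
  show "carrier (hall_algebra C E) = {x. keys x \<subseteq> Iso C}" "add (hall_algebra C E) = (+)"
    "zero (hall_algebra C E) = 0" "one (hall_algebra C E) = single {Z. zero_object C Z} 1"
    unfolding hall_algebra_def by simp_all
  show "{Z. zero_object C Z} \<in> Iso C" by (rule zero_class_Iso)
  fix x y :: "'o set \<Rightarrow>\<^sub>0 rat"
  assume x: "keys x \<subseteq> Iso C" and y: "keys y \<subseteq> Iso C"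
  let ?S = "\<lambda>X Z. {Y \<in> Iso C. Ext1_mid C E (rep X) (rep Z) Y \<noteq> {}}"
  let ?v = "\<lambda>X Z Y. lookup x X * lookup y Z * hall_coeff C E X Z Y"
  have m: "x \<otimes>\<^bsub>hall_algebra C E\<^esub> y = (\<Sum>X\<in>keys x. \<Sum>Z\<in>keys y. \<Sum>Y\<in>?S X Z. single Y (?v X Z Y))"
    unfolding hall_algebra_def by simp
  have look: "lookup (x \<otimes>\<^bsub>hall_algebra C E\<^esub> y) Y =
      (\<Sum>X\<in>keys x. \<Sum>Z\<in>keys y. if Y \<in> Iso C then ?v X Z Y else 0)" for Y
    unfolding m lookup_sum
  proof (intro sum.cong refl)
    fix X Z assume "X \<in> keys x" "Z \<in> keys y"
    then have fin: "finite (?S X Z)" using finite_middle_terms x y by blast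
    have "(\<Sum>Y'\<in>?S X Z. lookup (single Y' (?v X Z Y')) Y) = (\<Sum>Y'\<in>?S X Z. if Y' = Y then ?v X Z Y' else 0)"
      by (intro sum.cong refl) (simp add: lookup_single when_def)
    also have "\<dots> = (if Y \<in> ?S X Z then ?v X Z Y else 0)" using fin by (simp add: sum.delta)
    also have "\<dots> = (if Y \<in> Iso C then ?v X Z Y else 0)" by (auto simp: hall_coeff_def)
    finally show "(\<Sum>Y'\<in>?S X Z. lookup (single Y' (?v X Z Y')) Y) = (if Y \<in> Iso C then ?v X Z Y else 0)" .
  qed
  show "keys (x \<otimes>\<^bsub>hall_algebra C E\<^esub> y) \<subseteq> Iso C"
  proof
    fix Y assume "Y \<in> keys (x \<otimes>\<^bsub>hall_algebra C E\<^esub> y)"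
    then show "Y \<in> Iso C" using look[of Y] by (cases "Y \<in> Iso C") (simp_all add: in_keys_iff)
  qed
  show "lookup (x \<otimes>\<^bsub>hall_algebra C E\<^esub> y) Y = (\<Sum>X\<in>keys x. \<Sum>Z\<in>keys y. ?v X Z Y)"
    if "Y \<in> Iso C" for Y using look[of Y] that by simp
qed

end

locale degree_cone_setup = small: exact_krull_schmidt K C E' + big: exact_krull_schmidt K C E
  for K :: "('k, 'x) ring_scheme" and C :: "('o, 'm, 'k) lincat" and E' E :: "('m \<times> 'm) set" +
  assumes sub: "E' \<subseteq> E"
begin

text \<open>
  An extension equivalent to one in \<open>E'\<close> is itself in \<open>E'\<close>, because \<open>E'\<close> is closed under isomorphism.  So
  equivalence classes for \<open>E'\<close> are equivalence classes for \<open>E\<close>.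
\<close>

lemma Ext1_mid_subset: "Ext1_mid C E' A D Y \<subseteq> Ext1_mid C E A D Y"
proof
  fix e assume "e \<in> Ext1_mid C E' A D Y"
  then obtain i p where ip: "(i, p) \<in> conflations_on C E' A D" "tgt C i \<in> Y" "e = extension_equiv C E' A D `` {(i, p)}"
    unfolding Ext1_mid_def by (auto elim!: quotientE)
  have on: "(i, p) \<in> conflations_on C E A D" using ip(1) sub unfolding conflations_on_def by auto
  have E': "(i, p) \<in> E'" using ip(1) unfolding conflations_on_def by auto
  have "extension_equiv C E' A D `` {(i, p)} = extension_equiv C E A D `` {(i, p)}"
  proof (intro equalityI subsetI)
    fix x assume "x \<in> extension_equiv C E' A D `` {(i, p)}"
    then show "x \<in> extension_equiv C E A D `` {(i, p)}" using sub unfolding extension_equiv_def conflations_on_def by auto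
  next
    fix x assume x: "x \<in> extension_equiv C E A D `` {(i, p)}"
    obtain i' p' where x': "x = (i', p')" by (cases x)
    from x obtain h h' where on': "(i', p') \<in> conflations_on C E A D"
      and h: "h \<in> Hom C (tgt C i) (tgt C i')" "h' \<in> Hom C (tgt C i') (tgt C i)" "h' \<cdot> h = id_arr C (tgt C i)"
      "h \<cdot> h' = id_arr C (tgt C i')" "h \<cdot> i = i'" "p' \<cdot> h = p"
      unfolding x' using big.extension_equiv_iff by auto
    have ends: "(i', p') \<in> E" "src C i' = D" "tgt C p' = A" "src C i = D" "tgt C p = A"
      using on' on unfolding conflations_on_def by auto
    note I = big.conflation_arrs[OF ends(1)] and J = small.conflation_arrs[OF E']
    have H: "h \<in> arr C" "src C h = tgt C i" "tgt C h = tgt C i'" "h' \<in> arr C" "src C h' = tgt C i'" "tgt C h' = tgt C i"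
      using h(1,2) by (auto simp: small.in_Hom)
    have "(i', p') \<in> E'"
      by (rule small.conflation_iso_left[OF E' big.conflation_kcp[OF ends(1)] H(1,4) H(2,3,5,6) h(3,4)]) (use ends h(5) in simp_all)
    then have "(i', p') \<in> conflations_on C E' A D" using ends unfolding conflations_on_def by simp
    then show "x \<in> extension_equiv C E' A D `` {(i, p)}" unfolding x' using small.extension_equiv_iff ip(1) h by blast
  qed
  then show "e \<in> Ext1_mid C E A D Y" unfolding ip(3) Ext1_mid_def using on ip(2) by (auto intro!: quotientI)
qed

text \<open>
  The classes for \<open>E'\<close> form a subset of the finite set of classes for \<open>E\<close>, so equal cardinality forces
  equality.
\<close>

lemma hall_coeff_eq_iff:
  assumes I: "X \<in> Iso C" "Z \<in> Iso C" "Y \<in> Iso C"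
  shows "hall_coeff C E' X Z Y = hall_coeff C E X Z Y \<longleftrightarrow>
    (\<forall>i p. (i, p) \<in> E \<and> src C i = rep Z \<and> tgt C p = rep X \<and> tgt C i \<in> Y \<longrightarrow> (i, p) \<in> E')"
proof -
  let ?M' = "Ext1_mid C E' (rep X) (rep Z) Y" and ?M = "Ext1_mid C E (rep X) (rep Z) Y"
  have "card (Hom C (rep X) (rep Z)) > 0" using small.card_Hom_pos small.rep_Iso(1) assms by simp
  then have "hall_coeff C E' X Z Y = hall_coeff C E X Z Y \<longleftrightarrow> card ?M' = card ?M" unfolding hall_coeff_def by simp
  also have "\<dots> \<longleftrightarrow> ?M' = ?M"
    using card_subset_eq[OF big.finite_Ext1_mid[OF I(3)] Ext1_mid_subset] by metis
  also have "\<dots> \<longleftrightarrow> (\<forall>i p. (i, p) \<in> E \<and> src C i = rep Z \<and> tgt C p = rep X \<and> tgt C i \<in> Y \<longrightarrow> (i, p) \<in> E')" (is "_ \<longleftrightarrow> ?R")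
  proof
    assume eq: "?M' = ?M"
    show ?R
    proof (intro allI impI)
      fix i p assume ip: "(i, p) \<in> E \<and> src C i = rep Z \<and> tgt C p = rep X \<and> tgt C i \<in> Y"
      then have on: "(i, p) \<in> conflations_on C E (rep X) (rep Z)" unfolding conflations_on_def by simp
      then have "extension_equiv C E (rep X) (rep Z) `` {(i, p)} \<in> ?M" unfolding Ext1_mid_def using ip by (auto intro!: quotientI)
      then have "extension_equiv C E (rep X) (rep Z) `` {(i, p)} \<in> ?M'" using eq by simp
      moreover have "(i, p) \<in> extension_equiv C E (rep X) (rep Z) `` {(i, p)}"
        by (rule equiv_class_self[OF big.equiv_extension_equiv on])
      ultimately show "(i, p) \<in> E'" unfolding Ext1_mid_def
        by (auto elim!: quotientE simp: extension_equiv_def conflations_on_def)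
    qed
  next
    assume R: ?R
    have "?M \<subseteq> ?M'"
    proof
      fix e assume "e \<in> ?M"
      then obtain i p where ip: "(i, p) \<in> conflations_on C E (rep X) (rep Z)" "tgt C i \<in> Y" "e = extension_equiv C E (rep X) (rep Z) `` {(i, p)}"
        unfolding Ext1_mid_def by (auto elim!: quotientE)
      have E': "(i, p) \<in> E'" using R ip unfolding conflations_on_def by auto
      then have on': "(i, p) \<in> conflations_on C E' (rep X) (rep Z)" using ip unfolding conflations_on_def by auto
      let ?e' = "extension_equiv C E' (rep X) (rep Z) `` {(i, p)}"
      have e': "?e' \<in> ?M'" unfolding Ext1_mid_def using on' ip(2) by (auto intro!: quotientI)
      then have "?e' \<in> ?M" using Ext1_mid_subset by blast
      then obtain j q where jq: "(j, q) \<in> conflations_on C E (rep X) (rep Z)" "?e' = extension_equiv C E (rep X) (rep Z) `` {(j, q)}"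
        unfolding Ext1_mid_def by (auto elim!: quotientE)
      have "(i, p) \<in> ?e'" by (rule equiv_class_self[OF small.equiv_extension_equiv on'])
      then have "((j, q), (i, p)) \<in> extension_equiv C E (rep X) (rep Z)" unfolding jq(2) by simp
      then have "?e' = e" unfolding jq(2) ip(3) by (rule equiv_class_eq[OF big.equiv_extension_equiv])
      then show "e \<in> ?M'" using e' by simp
    qed
    then show "?M' = ?M" using Ext1_mid_subset by blast
  qed
  finally show ?thesis .
qed

lemma frag_eval_euler:
  "frag_eval a (small.euler_elt (i, p)) = a (iso_class C (src C i)) - a (iso_class C (tgt C i)) + a (iso_class C (tgt C p))"
  unfolding small.euler_elt_def by (simp add: frag_eval_add frag_eval_diff)

lemma degree_zero_class: "degree C d {Z. zero_object C Z} = 0"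
proof -
  obtain Z where Z: "zero_object C Z" using small.zero_object_ex .
  then have "degree C d (iso_class C Z) = small.weight d Z" by (intro small.degree_eq) (simp add: zero_object_def)
  also have "\<dots> = 0" by (rule small.additive_zero[of "small.weight d", OF small.weight_direct_sum Z])
  finally show ?thesis using small.zero_objects_class[OF Z] by simp
qed

text \<open>
  A conflation is transported to representatives of its end terms, where it is seen by a structure
  constant; the comparison of constants then decides its membership in \<open>E'\<close>.
\<close>

lemma degree_cone_iff:
  "d \<in> degree_cone C E E' \<longleftrightarrow> d \<in> ind C \<rightarrow>\<^sub>E UNIV \<and>
    (\<forall>x\<in>E'. frag_eval (degree C d) (small.euler_elt x) = 0) \<and>
    (\<forall>x\<in>E - E'. frag_eval (degree C d) (small.euler_elt x) > 0)"
proof -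
  interpret gc: graded_comparison "hall_algebra C E" "Iso C" "hall_coeff C E" "{Z. zero_object C Z}" "degree C d"
    "hall_algebra C E'" "hall_coeff C E'"
    by unfold_locales (rule degree_zero_class)
  have F: "degree_filtration C d = gc.A.filt" by (rule ext) (simp add: degree_filtration_def gc.A.filt_def)
  have "d \<in> degree_cone C E E' \<longleftrightarrow> d \<in> ind C \<rightarrow>\<^sub>E UNIV \<and> gc.A.filtered \<and> gc.degree_part"
    unfolding gc.graded_iff[symmetric] unfolding degree_cone_def mem_Collect_eq F ..
  moreover have "gc.A.filtered \<and> gc.degree_part \<longleftrightarrow>
    (\<forall>x\<in>E'. frag_eval (degree C d) (small.euler_elt x) = 0) \<and> (\<forall>x\<in>E - E'. frag_eval (degree C d) (small.euler_elt x) > 0)"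
    (is "_ \<longleftrightarrow> ?R")
  proof
    assume l: "gc.A.filtered \<and> gc.degree_part"
    have key: "frag_eval (degree C d) (small.euler_elt (i, p)) \<ge> 0 \<and>
        (frag_eval (degree C d) (small.euler_elt (i, p)) = 0 \<longleftrightarrow> (i, p) \<in> E')" if ip: "(i, p) \<in> E" for i p
    proof -
      note I = big.conflation_arrs[OF ip]
      let ?Z = "iso_class C (src C i)" and ?Y = "iso_class C (tgt C i)" and ?X = "iso_class C (tgt C p)"
      have Iso: "?X \<in> Iso C" "?Z \<in> Iso C" "?Y \<in> Iso C" using I small.iso_class_in_Iso by auto
      (* structure constants refer to the representatives of the end terms *)
      obtain i' p' where ip': "(i', p') \<in> E" "src C i' = rep ?Z" "tgt C p' = rep ?X" "tgt C i' = tgt C i"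
        and reflect: "(i', p') \<in> E' \<Longrightarrow> (i, p) \<in> E'"
        using big.conflation_change_ends_ex[OF ip small.isomorphic_sym[OF small.rep_iso_class[OF I(4)]] small.isomorphic_sym[OF small.rep_iso_class[OF I(6)]]]
          small.exact_category_axioms by metis
      have Y: "tgt C i' \<in> ?Y" unfolding ip'(4) by (rule small.iso_class_self[OF I(5)])
      have cE: "hall_coeff C E ?X ?Z ?Y \<noteq> 0" using big.hall_coeff_nonzero_iff[OF Iso] ip' Y by blast
      then have le: "degree C d ?Y \<le> degree C d ?X + degree C d ?Z" using l Iso unfolding gc.A.filtered_def by blast
      have c': "hall_coeff C E' ?X ?Z ?Y = (if degree C d ?Y = degree C d ?X + degree C d ?Z then hall_coeff C E ?X ?Z ?Y else 0)"
        using l Iso unfolding gc.degree_part_def by blast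
      have "degree C d ?Y = degree C d ?X + degree C d ?Z \<longleftrightarrow> (i, p) \<in> E'"
      proof
        assume "degree C d ?Y = degree C d ?X + degree C d ?Z"
        then have "hall_coeff C E' ?X ?Z ?Y = hall_coeff C E ?X ?Z ?Y" using c' by simp
        then have "(i', p') \<in> E'" using hall_coeff_eq_iff[OF Iso] ip' Y by blast
        then show "(i, p) \<in> E'" by (rule reflect)
      next
        assume ip2: "(i, p) \<in> E'"
        obtain j q where "(j, q) \<in> E'" "src C j = rep ?Z" "tgt C q = rep ?X" "tgt C j = tgt C i"
          using small.conflation_change_ends_ex[OF ip2 small.isomorphic_sym[OF small.rep_iso_class[OF I(4)]] small.isomorphic_sym[OF small.rep_iso_class[OF I(6)]]]
          by metis
        moreover have "tgt C i \<in> ?Y" by (rule small.iso_class_self[OF I(5)])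
        ultimately have "hall_coeff C E' ?X ?Z ?Y \<noteq> 0" using small.hall_coeff_nonzero_iff[OF Iso] by metis
        then show "degree C d ?Y = degree C d ?X + degree C d ?Z" using c' by metis
      qed
      then show ?thesis unfolding frag_eval_euler using le by auto
    qed
    show ?R
    proof (intro conjI ballI)
      fix x assume x: "x \<in> E'"
      obtain i p where "x = (i, p)" by (cases x)
      then show "frag_eval (degree C d) (small.euler_elt x) = 0" using key[of i p] x sub by auto
    next
      fix x assume x: "x \<in> E - E'"
      obtain i p where "x = (i, p)" by (cases x)
      then show "frag_eval (degree C d) (small.euler_elt x) > 0" using key[of i p] x by (auto simp: less_le)
    qed
  next
    assume R: ?R
    have val: "degree C d Y \<le> degree C d X + degree C d Z \<and> (degree C d Y = degree C d X + degree C d Z \<longleftrightarrow> (i, p) \<in> E')"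
      if I: "X \<in> Iso C" "Z \<in> Iso C" "Y \<in> Iso C" and ip: "(i, p) \<in> E" "src C i = rep Z" "tgt C p = rep X" "tgt C i \<in> Y" for X Z Y i p
    proof -
      have "frag_eval (degree C d) (small.euler_elt (i, p)) = degree C d Z - degree C d Y + degree C d X"
        unfolding frag_eval_euler ip(2,3) using small.rep_Iso(2) I small.Iso_member[OF I(3) ip(4)] by simp
      moreover have "frag_eval (degree C d) (small.euler_elt (i, p)) = 0" if "(i, p) \<in> E'" using R that by blast
      moreover have "frag_eval (degree C d) (small.euler_elt (i, p)) > 0" if "(i, p) \<notin> E'" using R that ip(1) by blast
      ultimately show ?thesis by (cases "(i, p) \<in> E'") auto
    qed
    show "gc.A.filtered \<and> gc.degree_part"
    proof
      show "gc.A.filtered" unfolding gc.A.filtered_def using big.hall_coeff_nonzero_iff val by blast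
      show "gc.degree_part" unfolding gc.degree_part_def
      proof (intro ballI)
        fix X Z Y assume I: "X \<in> Iso C" "Z \<in> Iso C" "Y \<in> Iso C"
        show "hall_coeff C E' X Z Y = (if degree C d Y = degree C d X + degree C d Z then hall_coeff C E X Z Y else 0)"
        proof (cases "degree C d Y = degree C d X + degree C d Z")
          case True
          then show ?thesis using hall_coeff_eq_iff[OF I] val[OF I] by auto
        next
          case False
          then have "\<not> hall_coeff C E' X Z Y \<noteq> 0"
            unfolding small.hall_coeff_nonzero_iff[OF I] using val[OF I] sub by blast
          then show ?thesis using False by simp
        qed
      qed
    qed
  qed
  ultimately show ?thesis by simp
qed

sublocale split: conflation_class K C "split_structure C"
proof
  fix i p assume "(i, p) \<in> split_structure C"
  then obtain r s where b: "biproduct C (tgt C i) (src C i) (tgt C p) i s r p" "i \<in> arr C" "p \<in> arr C"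
    unfolding split_structure_def by auto
  show "i \<in> arr C \<and> p \<in> arr C \<and> tgt C i = src C p" using small.biproductD[OF b(1)] by simp
qed

sublocale over_split: split_pair K C E'
  by unfold_locales (rule small.split_structure_subset)

sublocale pair: conflation_pair K C E' E
  by unfold_locales (rule sub)

lemma basis_values_restrict: "basis_values C \<phi> = restrict (split.values_of \<phi>) (ind C)"
  unfolding basis_values_def split.values_of_def ..

lemma split_additive:
  assumes a: "split.conflation_additive a" and "direct_sum C M A B"
  shows "a (iso_class C M) = a (iso_class C A) + a (iso_class C B)"
proof -
  obtain i1 i2 p1 p2 where b: "biproduct C M A B i1 i2 p1 p2" using assms(2) unfolding direct_sum_def by blast
  note B = small.biproductD[OF b]
  have "(i1, p2) \<in> split_structure C" unfolding split_structure_def using b B by auto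
  then have "frag_eval a (small.euler_elt (i1, p2)) = 0" using a unfolding split.conflation_additive_def by blast
  then show ?thesis unfolding frag_eval_euler using B by simp
qed

lemma degree_split_additive: "split.conflation_additive (degree C d)"
  unfolding split.conflation_additive_def
proof
  fix x assume x: "x \<in> split_structure C"
  then obtain i p r s where b: "x = (i, p)" "biproduct C (tgt C i) (src C i) (tgt C p) i s r p"
    unfolding split_structure_def by auto
  note B = small.biproductD[OF b(2)]
  show "frag_eval (degree C d) (small.euler_elt x) = 0"
    unfolding b(1) frag_eval_euler small.degree_eq[OF B(18)] small.degree_eq[OF B(19)] small.degree_eq[OF B(20)]
    using small.weight_direct_sum[OF small.biproduct_direct_sum[OF b(2)], of d] by simp
qed

text \<open>
  A functional on the split Grothendieck group is additive on direct sums, hence is the additive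
  extension of its values on indecomposables.
\<close>

lemma values_eq_degree:
  assumes phi: "\<phi> \<in> dual_space (K0 C (split_structure C))" and X: "X \<in> Iso C"
  shows "split.values_of \<phi> X = degree C (basis_values C \<phi>) X"
proof -
  let ?a = "split.values_of \<phi>"
  have "?a (iso_class C (rep X)) = small.weight (basis_values C \<phi>) (rep X)"
    by (rule small.additive_eq_weight[of "\<lambda>A. ?a (iso_class C A)"])
      (use split_additive[OF split.values_of_additive[OF phi]] small.rep_Iso(1)[OF X] small.iso_class_ind in \<open>auto simp: basis_values_restrict\<close>)
  then show ?thesis using small.degree_eq[OF small.rep_Iso(1)[OF X], of "basis_values C \<phi>"] small.rep_Iso(2)[OF X] by simp
qed

lemma basis_values_bij: "bij_betw (basis_values C) (dual_space (K0 C (split_structure C))) (ind C \<rightarrow>\<^sub>E UNIV)"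
  unfolding bij_betw_def
proof
  show "inj_on (basis_values C) (dual_space (K0 C (split_structure C)))"
  proof (rule inj_onI)
    fix \<phi> \<psi> assume d: "\<phi> \<in> dual_space (K0 C (split_structure C))" "\<psi> \<in> dual_space (K0 C (split_structure C))"
      and eq: "basis_values C \<phi> = basis_values C \<psi>"
    show "\<phi> = \<psi>" by (rule split.dual_eq_values[OF d]) (simp add: values_eq_degree d eq)
  qed
  show "basis_values C ` dual_space (K0 C (split_structure C)) = ind C \<rightarrow>\<^sub>E UNIV"
  proof (intro equalityI subsetI)
    fix d :: "'o set \<Rightarrow> real" assume d: "d \<in> ind C \<rightarrow>\<^sub>E UNIV"
    let ?F = "split.functional_of (degree C d)"
    have F: "?F \<in> dual_space (K0 C (split_structure C))" by (rule split.functional_of_dual[OF degree_split_additive])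
    have "basis_values C ?F = d" unfolding basis_values_restrict
    proof
      fix X show "restrict (split.values_of ?F) (ind C) X = d X"
      proof (cases "X \<in> ind C")
        case True
        note r = small.ind_rep[OF True]
        have "split.values_of ?F X = degree C d X" by (rule split.values_functional_of[OF degree_split_additive r(1)])
        also have "\<dots> = d X"
          using small.degree_eq[OF small.indecomposable_obj[OF r(2)], of d] small.weight_indecomposable[OF r(2), of d] r(3) by simp
        finally show ?thesis using True by simp
      next
        case False
        then show ?thesis using d by (simp add: PiE_def extensional_def)
      qed
    qed
    then show "d \<in> basis_values C ` dual_space (K0 C (split_structure C))" using F by (metis imageI)
  qed (auto simp: basis_values_restrict)
qed

text \<open>
  The class of a conflation outside \<open>E'\<close> is nonzero in the real Grothendieck group of \<open>E'\<close>: choose an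
  \<open>E'\<close>-projective \<open>U\<close> with a map that does not lift, and take the logarithm of the number of maps from \<open>U\<close>.
\<close>

lemma detecting_functional:
  assumes x: "x \<in> E - E'"
  shows "\<exists>\<psi>\<in>dual_space (K0 C E'). frag_eval (small.values_of \<psi>) (small.euler_elt x) \<noteq> 0"
proof -
  obtain i p where ip: "x = (i, p)" by (cases x)
  have E: "(i, p) \<in> E" "(i, p) \<notin> E'" using x ip by auto
  note I = big.conflation_arrs[OF E(1)]
  obtain U f where U: "small.projective U" "f \<in> Hom C U (tgt C p)" "\<not> (\<exists>w\<in>Hom C U (src C p). p \<cdot> w = f)"
    using small.projective_detects[OF big.conflation_kcp[OF E(1)] E(2)] by blast
  have Uo: "U \<in> obj C" using U(1) unfolding small.projective_def by simp
  define a where "a X = small.log_card U (rep X)" for X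
  have a: "a (iso_class C A) = small.log_card U A" if "A \<in> obj C" for A
    unfolding a_def by (rule small.additive_iso[of "small.log_card U", OF small.log_card_direct_sum[OF _ Uo] small.rep_iso_class[OF that]])
  have add: "small.conflation_additive a" unfolding small.conflation_additive_def
  proof
    fix y assume y: "y \<in> E'"
    obtain j q where jq: "y = (j, q)" by (cases y)
    note J = small.conflation_arrs[OF y[unfolded jq]]
    show "frag_eval a (small.euler_elt y) = 0"
      unfolding jq frag_eval_euler a[OF J(4)] a[OF J(5)] a[OF J(6)]
      using small.log_card_projective[OF U(1) y[unfolded jq]] J(3) by simp
  qed
  let ?F = "small.functional_of a"
  have "frag_eval (small.values_of ?F) (small.euler_elt x) = frag_eval a (small.euler_elt x)"
    by (rule frag_eval_cong) (use small.values_functional_of[OF add] small.keys_euler_elt[OF I(1,2)] ip in blast)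
  also have "\<dots> > 0"
    unfolding ip frag_eval_euler a[OF I(4)] a[OF I(5)] a[OF I(6)]
    using small.log_card_strict[OF big.conflation_kernel[OF E(1)] Uo U(2,3)] I(3) by simp
  finally show ?thesis using small.functional_of_dual[OF add] by (intro bexI[of _ ?F]) simp_all
qed

text \<open>
  Only the passage from positivity on the cone to positivity on each generator uses
  \<open>detecting_functional\<close>.
\<close>

lemma dual_cone_iff:
  assumes phi: "\<phi> \<in> dual_space (K0 C (split_structure C))"
  shows "(\<forall>x\<in>conflation_cone C E E'. x \<noteq> \<one>\<^bsub>real_tensor (Lambda C E E')\<^esub> \<longrightarrow> 0 < descended C E' \<phi> (lattice_incl C E' x)) \<and>
      (\<forall>y\<in>conflation_cone C E' (split_structure C). \<phi> (lattice_incl C (split_structure C) y) = 0) \<longleftrightarrow>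
    (\<forall>x\<in>E'. frag_eval (split.values_of \<phi>) (small.euler_elt x) = 0) \<and>
    (\<forall>x\<in>E - E'. frag_eval (split.values_of \<phi>) (small.euler_elt x) > 0)"
proof -
  let ?a = "split.values_of \<phi>" and ?D = "descended C E' \<phi>"
  have van: "(\<forall>y\<in>conflation_cone C E' (split_structure C). \<phi> (lattice_incl C (split_structure C) y) = 0) \<longleftrightarrow> small.conflation_additive ?a"
    by (rule over_split.vanishes_on_cone_iff[OF phi])
  have "(\<forall>x\<in>conflation_cone C E E'. x \<noteq> \<one>\<^bsub>real_tensor (Lambda C E E')\<^esub> \<longrightarrow> 0 < ?D (lattice_incl C E' x)) \<longleftrightarrow>
      (\<forall>x\<in>E - E'. frag_eval ?a (small.euler_elt x) > 0)" if add: "small.conflation_additive ?a"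
  proof -
    have D: "?D = small.functional_of ?a" by (rule over_split.descended_eq[OF phi add])
    have dual: "?D \<in> dual_space (K0 C E')" unfolding D by (rule small.functional_of_dual[OF add])
    have val: "frag_eval (small.values_of ?D) (small.euler_elt x) = frag_eval ?a (small.euler_elt x)" if "x \<in> E - E'" for x
    proof -
      obtain i p where ip: "x = (i, p)" by (cases x)
      note I = big.conflation_arrs[of i p]
      show ?thesis unfolding D
        by (rule frag_eval_cong) (use small.values_functional_of[OF add] small.keys_euler_elt[OF I(1,2)] ip that in blast)
    qed
    show ?thesis
    proof
      assume pos: "\<forall>x\<in>conflation_cone C E E'. x \<noteq> \<one>\<^bsub>real_tensor (Lambda C E E')\<^esub> \<longrightarrow> 0 < ?D (lattice_incl C E' x)"
      show "\<forall>x\<in>E - E'. frag_eval ?a (small.euler_elt x) > 0"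
      proof
        fix x assume x: "x \<in> E - E'"
        obtain \<psi> where "\<psi> \<in> dual_space (K0 C E')" "frag_eval (small.values_of \<psi>) (small.euler_elt x) \<noteq> 0"
          using detecting_functional[OF x] by blast
        from pair.positive_on_generator[OF dual x _ this] pos
        show "frag_eval ?a (small.euler_elt x) > 0" unfolding val[OF x] by blast
      qed
    next
      assume "\<forall>x\<in>E - E'. frag_eval ?a (small.euler_elt x) > 0"
      then have "frag_eval (small.values_of ?D) (small.euler_elt x) > 0" if "x \<in> E - E'" for x using val that by simp
      from pair.positive_on_cone[OF dual this]
      show "\<forall>x\<in>conflation_cone C E E'. x \<noteq> \<one>\<^bsub>real_tensor (Lambda C E E')\<^esub> \<longrightarrow> 0 < ?D (lattice_incl C E' x)" by blast
    qed
  qed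
  then show ?thesis unfolding van small.conflation_additive_def by blast
qed

lemma degree_cone_eq:
  "degree_cone C E E' = basis_values C `
       {\<phi> \<in> dual_space (K0 C (split_structure C)).
          (\<forall>x\<in>conflation_cone C E E'. x \<noteq> \<one>\<^bsub>real_tensor (Lambda C E E')\<^esub> \<longrightarrow>
             0 < descended C E' \<phi> (lattice_incl C E' x)) \<and>
          (\<forall>y\<in>conflation_cone C E' (split_structure C).
             \<phi> (lattice_incl C (split_structure C) y) = 0)}" (is "_ = basis_values C ` ?S")
proof -
  have iff: "\<phi> \<in> ?S \<longleftrightarrow> basis_values C \<phi> \<in> degree_cone C E E'" if phi: "\<phi> \<in> dual_space (K0 C (split_structure C))" for \<phi>
  proof -
    have eq: "frag_eval (split.values_of \<phi>) (small.euler_elt x) = frag_eval (degree C (basis_values C \<phi>)) (small.euler_elt x)" if "x \<in> E" for x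
    proof -
      obtain i p where ip: "x = (i, p)" by (cases x)
      note I = big.conflation_arrs[of i p]
      show ?thesis
        by (rule frag_eval_cong) (use values_eq_degree[OF phi] small.keys_euler_elt[OF I(1,2)] ip that in blast)
    qed
    have "basis_values C \<phi> \<in> ind C \<rightarrow>\<^sub>E UNIV" using basis_values_bij phi unfolding bij_betw_def by blast
    moreover have "(\<forall>x\<in>E'. frag_eval (split.values_of \<phi>) (small.euler_elt x) = 0) \<longleftrightarrow>
        (\<forall>x\<in>E'. frag_eval (degree C (basis_values C \<phi>)) (small.euler_elt x) = 0)"
      by (rule ball_cong[OF refl]) (simp add: eq subsetD[OF sub])
    moreover have "(\<forall>x\<in>E - E'. frag_eval (split.values_of \<phi>) (small.euler_elt x) > 0) \<longleftrightarrow>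
        (\<forall>x\<in>E - E'. frag_eval (degree C (basis_values C \<phi>)) (small.euler_elt x) > 0)"
      by (rule ball_cong[OF refl]) (simp add: eq)
    ultimately show ?thesis
      by (simp only: mem_Collect_eq dual_cone_iff[OF phi] degree_cone_iff phi simp_thms)
  qed
  show ?thesis
  proof (intro equalityI subsetI)
    fix d assume d: "d \<in> degree_cone C E E'"
    then have "d \<in> ind C \<rightarrow>\<^sub>E UNIV" using degree_cone_iff by blast
    then obtain \<phi> where "\<phi> \<in> dual_space (K0 C (split_structure C))" "d = basis_values C \<phi>"
      using basis_values_bij unfolding bij_betw_def by blast
    then show "d \<in> basis_values C ` ?S" using iff d by blast
  next
    fix d assume "d \<in> basis_values C ` ?S"
    then obtain \<phi> where "\<phi> \<in> ?S" "d = basis_values C \<phi>" by blast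
    then show "d \<in> degree_cone C E E'" using iff by blast
  qed
qed

end

theorem theorem6:
  fixes K :: "('k, 'x) ring_scheme"
    and C :: "('o, 'm, 'k) lincat"
    and E E' :: "('m \<times> 'm) set"
  assumes "field K" and "finite (carrier K)"
    and "linear_category K C" and "additive_category C"
    and "hom_finite K C" and "idempotent_complete C" and "additively_finite C"
    and "exact_structure C E'" and "exact_structure C E" and "E' \<subset> E"
  shows
    "bij_betw (basis_values C) (dual_space (K0 C (split_structure C))) (ind C \<rightarrow>\<^sub>E UNIV) \<and>
     degree_cone C E E' = basis_values C `
       {\<phi> \<in> dual_space (K0 C (split_structure C)).
          (\<forall>x\<in>conflation_cone C E E'. x \<noteq> \<one>\<^bsub>real_tensor (Lambda C E E')\<^esub> \<longrightarrow>
             0 < descended C E' \<phi> (lattice_incl C E' x)) \<and>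
          (\<forall>y\<in>conflation_cone C E' (split_structure C).
             \<phi> (lattice_incl C (split_structure C) y) = 0)}"
proof -
  interpret linear_category K C by fact
  interpret finite_linear_category K C
    by unfold_locales (use finite_Hom assms in auto)
  interpret krull_schmidt K C
    by unfold_locales (use assms(7) in \<open>simp add: additively_finite_def\<close>)
  interpret degree_cone_setup K C E' E
    by unfold_locales (use assms in auto)
  show ?thesis using basis_values_bij degree_cone_eq by blast
qed

end
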